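(* Let $\mathbf{b}=(b_1,\dots,b_K)$ be an ordered $K$-partition of $N$, i.e. $b_i\in\mathbb{Z}_{\ge 0}$ and $\sum_{i=1}^K b_i=N$. Let $\mu=\mu([(\mathcal{E}_{\mathbf b},\varphi_{\mathbf b})])$ be the regulated $L^2$ norm of the Higgs field of the filtered Higgs bundle $(\mathcal{E}_{\mathbf b},\varphi_{\mathbf b})$, and let $c_{\mathrm{eff}}=c_{\mathrm{eff}}(\Lambda_{\mathbf b})$ be the effective Virasoro central charge of the representation of $\mathcal{W}_K$ with highest weight $\Lambda_{\mathbf b}$ in the $(K,K+N)$ minimal model. Then $$\mu=\frac{1}{12}\left(K-1-c_{\mathrm{eff}}\right).$$
   Context: $K\ge 2$ and $N\ge 1$ are coprime integers; indices $i$ are taken modulo $K$; $z$ is the standard coordinate on $\mathbb{C}\subset\mathbb{CP}^1$. Filtered bundles. A filtered rank $K$ bundle on $(\mathbb{CP}^1,\{\infty\})$ is a locally free $\mathcal{O}_{\mathbb{CP}^1}( *\{\infty\})$-module $\mathcal{E}$ of rank $K$ (where $\mathcal{O}_{\mathbb{CP}^1}( *\{\infty\})$ is the sheaf of meromorphic functions with poles only at $\infty$) with an increasing filtration by locally free $\mathcal{O}_{\mathbb{CP}^1}$-submodules $\mathcal{P}_\alpha\mathcal{E}$, $\alpha\in\mathbb{R}$, such that $\mathcal{P}_\alpha\mathcal{E}|_{\mathbb{C}}=\mathcal{E}|_{\mathbb{C}}$, $\mathcal{P}_\alpha\mathcal{E}=\bigcap_{\beta>\alpha}\mathcal{P}_\beta\mathcal{E}$,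 and near $\infty$, with $x=1/z$, $\mathcal{P}_{\alpha-1}\mathcal{E}=x\,\mathcal{P}_\alpha\mathcal{E}$. For a section $s$ near $\infty$, $\nu_\infty(s)=\inf\{\alpha: s\in\mathcal{P}_\alpha\mathcal{E}\}$. For $\alpha\in\mathbb{R}$, $\mathcal{O}(\alpha)$ is the filtered line bundle with underlying module $\mathcal{O}_{\mathbb{CP}^1}( *\{\infty\})$ and filtration by pole order at $\infty$ shifted by $-\alpha$; its canonical section $e$ (the element $1$) trivializes it on $\mathbb{C}$ and has $\nu_\infty(e)=-\alpha$. Direct sums carry $\mathcal{P}_\alpha(\mathcal{E}\oplus\mathcal{E}')=\mathcal{P}_\alpha\mathcal{E}\oplus\mathcal{P}_\alpha\mathcal{E}'$. The Higgs bundle $(\mathcal{E}_{\mathbf b},\varphi_{\mathbf b})$. Let $\alpha_1,\dots,\alpha_K\in\mathbb{R}$ be determined by $b_i-\frac NK=\alpha_i-\alpha_{i+1}$ (indices mod $K$) and $\sum_i\alpha_i=0$. Put $\mathcal{E}_{\mathbf b}=\bigoplus_{i=1}^K\mathcal{O}(\alpha_i)$ with canonical sections $e_i$, and let $\varphi_{\mathbf b}(e_{i+1})=z^{b_i}\,e_i\,dz$ (indices mod $K$). Harmonic metric and $\mu$. A Hermitian metric $h$ on $\mathcal{E}|_{\mathbb{C}}$ is adapted to the filtration if near $\infty$, $\mathcal{P}_\alpha\mathcal{E}=\{s:\|s\|_h=O(|x|^{-(\alpha+\epsilon)})\text{ for all }\epsilon>0\}$ for all $\alpha$. A harmonic metric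 on $(\mathcal{E},\varphi)$ is an adapted Hermitian metric with $F_{D(\mathcal{E},h)}+[\varphi,\varphi^{\dagger_h}]=0$ on $\mathbb{C}$, where $D(\mathcal{E},h)$ is the Chern connection, $\varphi^{\dagger_h}$ is the $h$-adjoint and $[\varphi,\varphi^{\dagger_h}]=\varphi\wedge\varphi^{\dagger_h}+\varphi^{\dagger_h}\wedge\varphi$. It is known that $(\mathcal{E}_{\mathbf b},\varphi_{\mathbf b})$ has a harmonic metric $h$, unique up to a positive scalar. Define $$\mu([(\mathcal{E}_{\mathbf b},\varphi_{\mathbf b})])=\frac{\mathrm{i}}{\pi}\int_{\mathbb{C}}\operatorname{Tr}\left(\varphi_{\mathbf b}\wedge\varphi_{\mathbf b}^{\dagger_h}-\mathrm{Id}\,|z|^{2N/K}\,dz\wedge d\bar z\right).$$ $W$-algebra side. $\mathcal{W}_K$ is the $W$-algebra obtained by quantum Drinfeld-Sokolov reduction of the affine vertex algebra $\widehat{sl(K)}$ by a principal $sl(2)\subset sl(K)$; it contains the Virasoro vertex algebra. The $(K,K+N)$ minimal model of $\mathcal{W}_K$ is a distinguished collection of highest-weight representations, parameterized by dominant weights $\Lambda$ of $sl(K)$, regarded as vectors in $\mathbf{1}^\perp\subset\mathbb{R}^K$, $\mathbf{1}=(1,\dots,1)$. Each has a Virasoro central charge $c$ and Virasoro highest weight $h$, and $c_{\mathrm{eff}}=c-24h$. The following known facts describe the data: the weights occurring are in bijection with cyclic $K$-partitions of $N$ (ordered $K$-partitions up to cyclic permutation), the weight associated with $\mathbf b$ being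 $$\Lambda_{\mathbf b}=P_{\mathbf{1}^\perp}(n_1,\dots,n_K),\qquad n_i=N-\sum_{j=1}^i b_j,$$ with $P_{\mathbf{1}^\perp}$ the orthogonal projection onto $\mathbf{1}^\perp$; and the effective Virasoro central charge of the representation with highest weight $\Lambda$ is $$c_{\mathrm{eff}}(\Lambda)=K-1-\frac{12K}{K+N}\left\|\Lambda-\frac NK\rho\right\|^2,\qquad \rho=\tfrac12(K-1,K-3,\dots,3-K,1-K).$$ *)

theory Defs
  imports "HOL-Complex_Analysis.Complex_Analysis" "Berlekamp_Zassenhaus.Finite_Field"
begin

text \<open>
  The rank is \<open>K = CARD('k)\<close> with \<open>'k::nontriv\<close>, so that \<open>K \<ge> 2\<close>, and the index set is
  \<open>'k mod_ring\<close>, the integers modulo \<open>K\<close>; thus \<open>i + 1\<close> is the cyclic successor.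
  A bundle is always given with a global meromorphic frame \<open>e\<^sub>i\<close> that is a holomorphic frame
  over \<open>\<complex>\<close>, and a section is the column of its coefficients in this frame.
\<close>

section \<open>Filtered bundles\<close>

definition meromorphic_at_infinity :: "(complex \<Rightarrow> complex) \<Rightarrow> bool" where
  "meromorphic_at_infinity f \<longleftrightarrow> (\<lambda>x. f (inverse x)) meromorphic_on {0}"

text \<open>Unspecified for the zero germ, whose pole order is \<open>-\<infinity>\<close>.\<close>

definition pole_order_infinity :: "(complex \<Rightarrow> complex) \<Rightarrow> int" where
  "pole_order_infinity f = - zorder (\<lambda>x. f (inverse x)) 0"

text \<open>
  Sections near infinity are germs, represented by functions whose values on bounded sets do
  not matter. The next definition is the stalk at infinity of \<open>\<P>\<^sub>\<beta> \<O>(\<alpha>)\<close>; away from infinity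
  the filtration is constant.
\<close>

definition line_filtration :: "real \<Rightarrow> real \<Rightarrow> (complex \<Rightarrow> complex) set" where
  "line_filtration \<alpha> \<beta> = {f. meromorphic_at_infinity f \<and>
     ((\<forall>\<^sub>F z in at_infinity. f z = 0) \<or> of_int (pole_order_infinity f) - \<alpha> \<le> \<beta>)}"

type_synonym 'n filtration = "real \<Rightarrow> (complex \<Rightarrow> complex ^ 'n) set"

text \<open>The filtered bundle \<open>\<Oplus>\<^sub>i \<O>(\<alpha>\<^sub>i)\<close>.\<close>

definition direct_sum_filtration :: "('n::finite \<Rightarrow> real) \<Rightarrow> 'n filtration" where
  "direct_sum_filtration \<alpha> \<beta> = {s. \<forall>i. (\<lambda>z. s z $ i) \<in> line_filtration (\<alpha> i) \<beta>}"

section \<open>Hermitian metrics\<close>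

primrec Ck :: "nat \<Rightarrow> (complex \<Rightarrow> complex) \<Rightarrow> bool" where
  "Ck 0 f \<longleftrightarrow> continuous_on UNIV f"
| "Ck (Suc k) f \<longleftrightarrow> f differentiable_on UNIV \<and>
     (\<forall>v. Ck k (\<lambda>z. frechet_derivative f (at z) v))"

definition smooth :: "(complex \<Rightarrow> complex) \<Rightarrow> bool" where
  "smooth f \<longleftrightarrow> (\<forall>k. Ck k f)"

definition conj_transpose :: "complex ^ 'n ^ 'm \<Rightarrow> complex ^ 'm ^ 'n" where
  "conj_transpose A = (\<chi> i j. cnj (A $ j $ i))"

text \<open>
  A metric \<open>h\<close> is given by its Gram matrix \<open>H $ i $ j = h(e\<^sub>j, e\<^sub>i)\<close>, where \<open>h\<close> is linear in its
  first argument, so that \<open>h(u, v) = v\<^sup>* H u\<close>.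
\<close>

definition hprod :: "complex ^ 'n ^ 'n \<Rightarrow> complex ^ 'n \<Rightarrow> complex ^ 'n \<Rightarrow> complex" where
  "hprod H u v = (\<Sum>i\<in>UNIV. \<Sum>j\<in>UNIV. cnj (v $ i) * H $ i $ j * u $ j)"

definition hnorm :: "complex ^ 'n ^ 'n \<Rightarrow> complex ^ 'n \<Rightarrow> real" where
  "hnorm H v = sqrt (Re (hprod H v v))"

definition hermitian_metric :: "(complex \<Rightarrow> complex ^ 'n ^ 'n) \<Rightarrow> bool" where
  "hermitian_metric H \<longleftrightarrow>
     (\<forall>i j. smooth (\<lambda>z. H z $ i $ j)) \<and>
     (\<forall>z. conj_transpose (H z) = H z) \<and>
     (\<forall>z v. v \<noteq> 0 \<longrightarrow> Re (hprod (H z) v v) > 0)"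

definition adapted :: "('n::finite) filtration \<Rightarrow> (complex \<Rightarrow> complex ^ 'n ^ 'n) \<Rightarrow> bool" where
  "adapted P H \<longleftrightarrow> (\<forall>\<beta>. P \<beta> =
     {s. (\<forall>i. meromorphic_at_infinity (\<lambda>z. s z $ i)) \<and>
         (\<forall>\<epsilon>>0. (\<lambda>z. hnorm (H z) (s z))
            \<in> O[at_infinity](\<lambda>z. norm (inverse z) powr (- (\<beta> + \<epsilon>))))})"

section \<open>Chern connection and harmonic metrics\<close>

definition d_z :: "(complex \<Rightarrow> complex) \<Rightarrow> complex \<Rightarrow> complex" where
  "d_z f z = (frechet_derivative f (at z) 1 - \<i> * frechet_derivative f (at z) \<i>) / 2"

definition d_zbar :: "(complex \<Rightarrow> complex) \<Rightarrow> complex \<Rightarrow> complex" where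
  "d_zbar f z = (frechet_derivative f (at z) 1 + \<i> * frechet_derivative f (at z) \<i>) / 2"

text \<open>
  The connection form of the Chern connection is \<open>A dz\<close> with \<open>A = H\<^sup>-\<^sup>1 \<partial>\<^sub>z H\<close>. Its curvature is
  \<open>\<partial>\<^sub>z\<^sub>b\<^sub>a\<^sub>r A dzbar \<and> dz\<close>. Here and below 2-forms are written as coefficients of \<open>dz \<and> dzbar\<close>.
\<close>

definition chern_connection ::
  "(complex \<Rightarrow> complex ^ 'n ^ 'n) \<Rightarrow> complex \<Rightarrow> complex ^ 'n ^ 'n" where
  "chern_connection H z = matrix_inv (H z) ** (\<chi> i j. d_z (\<lambda>w. H w $ i $ j) z)"

definition chern_curvature ::
  "(complex \<Rightarrow> complex ^ 'n ^ 'n) \<Rightarrow> complex \<Rightarrow> complex ^ 'n ^ 'n" where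
  "chern_curvature H z = - (\<chi> i j. d_zbar (\<lambda>w. chern_connection H w $ i $ j) z)"

text \<open>The endomorphism \<open>B\<close> with \<open>h(A u, v) = h(u, B v)\<close>.\<close>

definition h_adjoint :: "complex ^ 'n ^ 'n \<Rightarrow> complex ^ 'n ^ 'n \<Rightarrow> complex ^ 'n ^ 'n" where
  "h_adjoint H A = matrix_inv H ** conj_transpose A ** H"

text \<open>
  A Higgs field \<open>\<phi> = \<Phi> dz\<close> is given by its matrix \<open>\<Phi>\<close>, and \<open>\<phi>\<^sup>\<dagger> = \<Phi>\<^sup>\<dagger> dzbar\<close>. Since
  \<open>dzbar \<and> dz = - dz \<and> dzbar\<close>, the form \<open>\<phi> \<and> \<phi>\<^sup>\<dagger> + \<phi>\<^sup>\<dagger> \<and> \<phi>\<close> has coefficient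
  \<open>\<Phi> \<Phi>\<^sup>\<dagger> - \<Phi>\<^sup>\<dagger> \<Phi>\<close>.
\<close>

definition harmonic_metric ::
  "('n::finite) filtration \<Rightarrow> (complex \<Rightarrow> complex ^ 'n ^ 'n) \<Rightarrow>
     (complex \<Rightarrow> complex ^ 'n ^ 'n) \<Rightarrow> bool" where
  "harmonic_metric P \<Phi> H \<longleftrightarrow>
     hermitian_metric H \<and> adapted P H \<and>
     (\<forall>z. chern_curvature H z
        + (\<Phi> z ** h_adjoint (H z) (\<Phi> z) - h_adjoint (H z) (\<Phi> z) ** \<Phi> z) = 0)"

section \<open>The Higgs field and its regulated norm\<close>

text \<open>\<open>\<phi>(e\<^bsub>i+1\<^esub>) = z ^ b\<^sub>i e\<^sub>i dz\<close>: the entry in row \<open>i\<close> and column \<open>i + 1\<close> is \<open>z ^ b\<^sub>i\<close>.\<close>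

definition higgs_field :: "('k::nontriv mod_ring \<Rightarrow> nat) \<Rightarrow> complex \<Rightarrow>
    complex ^ 'k mod_ring ^ 'k mod_ring" where
  "higgs_field b z = (\<chi> i j. if j = i + 1 then z ^ b i else 0)"

text \<open>The integral over \<open>\<complex>\<close> of the 2-form \<open>f dz \<and> dzbar\<close>, where \<open>dz \<and> dzbar = -2\<i> dx \<and> dy\<close>.\<close>

definition integral_form :: "(complex \<Rightarrow> complex) \<Rightarrow> complex" where
  "integral_form f = (LINT z|lborel. f z * (- 2 * \<i>))"

definition regulated_norm :: "nat \<Rightarrow> (complex \<Rightarrow> complex ^ 'n ^ 'n) \<Rightarrow>
    (complex \<Rightarrow> complex ^ 'n ^ 'n) \<Rightarrow> complex" where
  "regulated_norm N \<Phi> H = \<i> / of_real pi * integral_form (\<lambda>z.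
     trace (\<Phi> z ** h_adjoint (H z) (\<Phi> z)
       - mat (of_real (norm z powr (2 * real N / real CARD('n))))))"

section \<open>Weights and the effective central charge\<close>

text \<open>The representative in \<open>{1..K}\<close> of an index modulo \<open>K\<close>.\<close>

definition index_of :: "'k::nontriv mod_ring \<Rightarrow> nat" where
  "index_of i = (if i = 0 then CARD('k) else nat (to_int_mod_ring i))"

definition proj_one_perp :: "real ^ 'n \<Rightarrow> real ^ 'n" where
  "proj_one_perp v = v - ((v \<bullet> 1) / (1 \<bullet> (1 :: real ^ 'n))) *\<^sub>R 1"

definition W_weight :: "nat \<Rightarrow> ('k::nontriv mod_ring \<Rightarrow> nat) \<Rightarrow> real ^ 'k mod_ring" where
  "W_weight N b = proj_one_perp (\<chi> i. real N - (\<Sum>j = 1..index_of i. real (b (of_nat j))))"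

definition weyl_vector :: "real ^ ('k::nontriv) mod_ring" where
  "weyl_vector = (\<chi> i. (real CARD('k) + 1 - 2 * real (index_of i)) / 2)"

text \<open>
  The effective Virasoro central charge \<open>c - 24 h\<close> of the representation with highest weight
  \<open>\<Lambda>\<close> in the \<open>(K, K + N)\<close> minimal model of \<open>W\<^sub>K\<close>, defined by its known closed formula.
\<close>

definition c_eff :: "nat \<Rightarrow> real ^ ('k::nontriv) mod_ring \<Rightarrow> real" where
  "c_eff N \<Lambda> = real CARD('k) - 1
     - 12 * real CARD('k) / (real CARD('k) + real N)
       * (norm (\<Lambda> - (real N / real CARD('k)) *\<^sub>R weyl_vector))\<^sup>2"

end

theory Submission
  imports Defs
begin

text \<open>
  For two solutions \<open>H, H'\<close> of Hitchin's equation the endomorphism \<open>g = H\<^sup>-\<^sup>1 H'\<close> satisfies that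
  \<open>ln (tr g)\<close> is subharmonic, and the growth prescribed by the filtration makes it \<open>o(ln |z|)\<close>. Hence
  \<open>g\<close> is holomorphic and commutes with the Higgs field, and by coprimality it is a scalar. Comparing
  \<open>H\<close> with its images under the circle action shows that \<open>H\<close> is diagonal and radial. In the
  coordinate \<open>x = ln |z|\<close> the diagonal entries then solve a Toda lattice
  \<open>v\<^sub>i'' = 4 exp (2 q x) (exp (v\<^sub>i - v\<^bsub>i+1\<^esub>) - exp (v\<^bsub>i-1\<^esub> - v\<^sub>i))\<close> with \<open>q = 1 + N/K\<close>. The integrand of
  the regulated norm is a multiple of the derivative of \<open>Q = \<Sum> v\<^sub>i'\<^sup>2 / 2 - 4 G\<close>, where
  \<open>G = exp (2 q x) \<Sum> (exp (v\<^sub>i - v\<^bsub>i+1\<^esub>) - 1)\<close>, and \<open>Q\<close> tends to \<open>2 \<Sum> \<alpha>\<^sub>i\<^sup>2\<close> at \<open>-\<infinity>\<close> and to \<open>0\<close> at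
  \<open>+\<infinity>\<close>. So the regulated norm is \<open>K / (K + N) \<Sum> \<alpha>\<^sub>i\<^sup>2\<close>, and the \<open>\<alpha>\<^sub>i\<close> are, up to a cyclic shift, the
  coordinates of \<open>\<Lambda> - (N/K) \<rho>\<close>.
\<close>

text \<open>Adaptedness controls norms only up to factors |z|^\<epsilon>, so no asymptotic expansion
  of the metric is at hand. All that happens at infinity has to follow from sublogarithmic bounds: a
  subharmonic function with such an upper bound is harmonic, a harmonic one is constant, and the
  limit of Q at +\<infinity> is extracted from the differential equation itself. With x = ln |z|,
  v_i is ln h(e_i, e_i) + 2 \<alpha>_i x; the added term makes v_i sublinear. As h is smooth at z =
  0, the x-derivative of ln h(e_i, e_i) dies at -\<infinity>, so v_i' tends to 2 \<alpha>_i there,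
  and half the sum of squares is 2 \<Sum> \<alpha>_i^2. Q is the energy that would be conserved if
  the coupling 4 exp (2 q x) were frozen; its variation gives Q' = - 8 q G. The -1 in each summand
  of G is the regulator |z|^(2N/K) in the new coordinate, and G >= 0 because the exponents sum to
  zero around the cycle. The integral is thus the total drop of a monotone function, and 2/pi * 2 pi
  * 2/(8 q) = 1/q is the factor K / (K + N).\<close>

no_notation fps_nth (infixl \<open>$\<close> 75)

section \<open>Wirtinger calculus\<close>

text \<open>\<open>Ck\<close> speaks of \<open>frechet_derivative\<close>, which is defined by
  choice. Uniqueness of the derivative lets any explicit formula take its place; the closure rules
  below rest on this.\<close>

lemma Ck_SucI:
  assumes "\<And>z. (f has_derivative f' z) (at z)" and "\<And>v. Ck k (\<lambda>z. f' z v)"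
  shows "Ck (Suc k) f"
proof -
  have "frechet_derivative f (at z) = f' z" for z
    using frechet_derivative_at[OF assms(1)] by simp
  then show ?thesis
    using assms by (auto simp: differentiable_on_def differentiable_def)
qed

lemma Ck_Suc_differentiable: "Ck (Suc k) f \<Longrightarrow> f differentiable (at z)"
  by (auto simp: differentiable_on_def)

lemma Ck_Suc_has_derivative:
  "Ck (Suc k) f \<Longrightarrow> (f has_derivative frechet_derivative f (at z)) (at z)"
  using Ck_Suc_differentiable frechet_derivative_works by blast

lemma Ck_SucD: "Ck (Suc k) f \<Longrightarrow> Ck k (\<lambda>z. frechet_derivative f (at z) v)"
  by simp

lemma Ck_Suc_imp_Ck: "Ck (Suc k) f \<Longrightarrow> Ck k f"
proof (induction k arbitrary: f)
  case 0
  then show ?case by (auto intro: differentiable_imp_continuous_on)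
next
  case (Suc k)
  then have "Ck k (\<lambda>z. frechet_derivative f (at z) v)" for v
    by (intro Suc.IH) simp
  with Suc.prems show ?case by simp
qed

lemma Ck_const: "Ck k (\<lambda>_. c)"
proof (induction k arbitrary: c)
  case (Suc k)
  show ?case by (rule Ck_SucI[where f' = "\<lambda>_ _. 0"]) (auto intro: Suc)
qed simp

lemma Ck_add: "Ck k f \<Longrightarrow> Ck k g \<Longrightarrow> Ck k (\<lambda>z. f z + g z)"
proof (induction k arbitrary: f g)
  case 0
  then show ?case by (auto intro: continuous_intros)
next
  case (Suc k)
  show ?case
    by (rule Ck_SucI, rule has_derivative_add,
        (rule Ck_Suc_has_derivative, rule Suc.prems)+, rule Suc.IH)
       (rule Ck_SucD, rule Suc.prems)+
qed

lemma Ck_mult: "Ck k f \<Longrightarrow> Ck k g \<Longrightarrow> Ck k (\<lambda>z. f z * g z)"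
proof (induction k arbitrary: f g)
  case 0
  then show ?case by (auto intro: continuous_intros)
next
  case (Suc k)
  note prems = Suc.prems[THEN Ck_Suc_imp_Ck] Suc.prems[THEN Ck_SucD]
  show ?case
    by (rule Ck_SucI, rule has_derivative_mult, (rule Ck_Suc_has_derivative, rule Suc.prems)+)
       (intro Ck_add Suc.IH prems)
qed

lemma Ck_bounded_linear: "bounded_linear L \<Longrightarrow> Ck k f \<Longrightarrow> Ck k (\<lambda>z. L (f z))"
proof (induction k arbitrary: f)
  case 0
  then show ?case by (auto intro: bounded_linear.continuous_on)
next
  case (Suc k)
  show ?case
    by (rule Ck_SucI, rule bounded_linear.has_derivative[OF Suc.prems(1)],
        rule Ck_Suc_has_derivative, rule Suc.prems)
       (intro Suc.IH Suc.prems Ck_SucD)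
qed

lemma Ck_cnj: "Ck k f \<Longrightarrow> Ck k (\<lambda>z. cnj (f z))"
  by (rule Ck_bounded_linear[OF bounded_linear_cnj])

lemma Ck_Re: "Ck k f \<Longrightarrow> Ck k (\<lambda>z. of_real (Re (f z)))"
  by (rule Ck_bounded_linear)
    (intro bounded_linear_compose[OF bounded_linear_of_real bounded_linear_Re])

lemma Ck_uminus: "Ck k f \<Longrightarrow> Ck k (\<lambda>z. - f z)"
  by (rule Ck_bounded_linear[OF bounded_linear_minus[OF bounded_linear_ident]])

lemma Ck_diff: "Ck k f \<Longrightarrow> Ck k g \<Longrightarrow> Ck k (\<lambda>z. f z - g z)"
  using Ck_add[of k f "\<lambda>z. - g z"] Ck_uminus by simp

lemma Ck_sum: "(\<And>i. i \<in> I \<Longrightarrow> Ck k (f i)) \<Longrightarrow> Ck k (\<lambda>z. \<Sum>i\<in>I. f i z)"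
  by (induction I rule: infinite_finite_induct) (auto intro: Ck_const Ck_add)

lemma Ck_prod: "(\<And>i. i \<in> I \<Longrightarrow> Ck k (f i)) \<Longrightarrow> Ck k (\<lambda>z. \<Prod>i\<in>I. f i z)"
  by (induction I rule: infinite_finite_induct) (auto intro: Ck_const Ck_mult)

lemma Ck_inverse: "Ck k f \<Longrightarrow> (\<And>z. f z \<noteq> 0) \<Longrightarrow> Ck k (\<lambda>z. inverse (f z))"
proof (induction k arbitrary: f)
  case 0
  then show ?case by (auto intro: continuous_intros)
next
  case (Suc k)
  show ?case
  proof (rule Ck_SucI)
    show "((\<lambda>z. inverse (f z)) has_derivative
        (\<lambda>v. - (inverse (f z) * frechet_derivative f (at z) v * inverse (f z)))) (at z)" for z
      by (rule Deriv.has_derivative_inverse[OF Suc.prems(2) Ck_Suc_has_derivative[OF Suc.prems(1)]])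
    show "Ck k (\<lambda>z. - (inverse (f z) * frechet_derivative f (at z) v * inverse (f z)))" for v
      by (intro Ck_uminus Ck_mult Suc.IH Suc.prems Ck_SucD Ck_Suc_imp_Ck[OF Suc.prems(1)])
  qed
qed

lemma Ck_divide: "Ck k f \<Longrightarrow> Ck k g \<Longrightarrow> (\<And>z. g z \<noteq> 0) \<Longrightarrow> Ck k (\<lambda>z. f z / g z)"
  by (simp add: divide_inverse Ck_mult Ck_inverse)

lemma has_derivative_of_real_ln:
  assumes "(f has_derivative f') (at z)" and "Re (f z) > 0"
  shows "((\<lambda>w. complex_of_real (ln (Re (f w)))) has_derivative
           (\<lambda>v. complex_of_real (Re (f' v)) / complex_of_real (Re (f z)))) (at z)"
proof -
  have "((\<lambda>w. Re (f w)) has_derivative (\<lambda>v. Re (f' v))) (at z)"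
    by (rule bounded_linear.has_derivative[OF bounded_linear_Re assms(1)])
  then have "((\<lambda>w. ln (Re (f w))) has_derivative (\<lambda>v. Re (f' v) * inverse (Re (f z)))) (at z)"
    using assms(2) by (intro has_derivative_ln) auto
  from bounded_linear.has_derivative[OF bounded_linear_of_real[where 'a = complex] this]
  show ?thesis by (simp add: divide_inverse)
qed

lemma Ck_of_real_ln:
  assumes "Ck k f" and "\<And>z. Re (f z) > 0"
  shows "Ck k (\<lambda>z. of_real (ln (Re (f z))))"
proof (cases k)
  case 0
  have "continuous_on UNIV (\<lambda>z. ln (Re (f z)))"
    using assms 0 by (intro continuous_intros) (auto simp: less_imp_neq[symmetric])
  then show ?thesis using 0 by (auto intro: continuous_intros)
next
  case (Suc j)
  show ?thesis unfolding Suc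
    by (rule Ck_SucI, rule has_derivative_of_real_ln, rule Ck_Suc_has_derivative,
        rule assms(1)[unfolded Suc], rule assms)
       (intro Ck_divide Ck_Re Ck_SucD Ck_Suc_imp_Ck[OF assms(1)[unfolded Suc]] assms(1)[unfolded Suc];
        use assms(2) in \<open>simp add: less_imp_neq[symmetric]\<close>)
qed

text \<open>The derivative of an entire function is again entire, so the induction closes.\<close>

lemma Ck_holomorphic: "f holomorphic_on UNIV \<Longrightarrow> Ck k f"
proof (induction k arbitrary: f)
  case 0
  then show ?case by (simp add: holomorphic_on_imp_continuous_on)
next
  case (Suc k)
  have "(f has_derivative (\<lambda>v. deriv f z * v)) (at z)" for z
    using holomorphic_derivI[OF Suc.prems open_UNIV UNIV_I]
    by (simp add: has_field_derivative_def)
  then show ?case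
    by (rule Ck_SucI)
       (intro Ck_mult Ck_const Suc.IH holomorphic_deriv Suc.prems open_UNIV)
qed

text \<open>A real-linear map of the plane is a complex linear map plus an antilinear one;
  \<open>d_z\<close> and \<open>d_zbar\<close> are the two coefficients. The rules below produce a
  derivative in this shape and read the coefficients off.\<close>

lemma frechet_derivative_eq_d_z:
  assumes "f differentiable (at z)"
  shows "frechet_derivative f (at z) v = d_z f z * v + d_zbar f z * cnj v"
proof -
  interpret linear "frechet_derivative f (at z)"
    using assms by (rule linear_frechet_derivative)
  have "v = Re v *\<^sub>R 1 + Im v *\<^sub>R \<i>"
    by (simp add: complex_eq_iff)
  then have "frechet_derivative f (at z) v
      = Re v *\<^sub>R frechet_derivative f (at z) 1 + Im v *\<^sub>R frechet_derivative f (at z) \<i>"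
    by (metis add scale)
  then show ?thesis
    by (simp add: d_z_def d_zbar_def complex_eq_iff field_simps)
qed

lemma d_z_eqI:
  assumes "(f has_derivative f') (at z)"
  shows "d_z f z = (f' 1 - \<i> * f' \<i>) / 2" and "d_zbar f z = (f' 1 + \<i> * f' \<i>) / 2"
  using frechet_derivative_at[OF assms] by (simp_all add: d_z_def d_zbar_def)

lemma has_derivative_d_z:
  assumes "f differentiable (at z)"
  shows "(f has_derivative (\<lambda>v. d_z f z * v + d_zbar f z * cnj v)) (at z)"
  using assms frechet_derivative_eq_d_z[OF assms] unfolding frechet_derivative_works
  by (metis (no_types, lifting) ext)

lemma d_z_eqI':
  assumes "(f has_derivative (\<lambda>v. a * v + b * cnj v)) (at z)"
  shows "d_z f z = a" and "d_zbar f z = b"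
  by (simp_all add: d_z_eqI[OF assms] algebra_simps)

lemma Ck_d_z: "Ck (Suc k) f \<Longrightarrow> Ck k (d_z f)"
  and Ck_d_zbar: "Ck (Suc k) f \<Longrightarrow> Ck k (d_zbar f)"
  unfolding d_z_def[abs_def] d_zbar_def[abs_def]
  by (intro Ck_divide Ck_diff Ck_add Ck_mult Ck_const Ck_SucD; simp)+

lemma d_z_const: "d_z (\<lambda>_. c) z = 0" and d_zbar_const: "d_zbar (\<lambda>_. c) z = 0"
  by (rule d_z_eqI'[where a = 0 and b = 0]; simp)+

lemma
  assumes "f differentiable (at z)" and "g differentiable (at z)"
  shows d_z_add: "d_z (\<lambda>w. f w + g w) z = d_z f z + d_z g z"
    and d_zbar_add: "d_zbar (\<lambda>w. f w + g w) z = d_zbar f z + d_zbar g z"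
    and d_zbar_diff: "d_zbar (\<lambda>w. f w - g w) z = d_zbar f z - d_zbar g z"
    and d_z_mult: "d_z (\<lambda>w. f w * g w) z = d_z f z * g z + f z * d_z g z"
    and d_zbar_mult: "d_zbar (\<lambda>w. f w * g w) z = d_zbar f z * g z + f z * d_zbar g z"
proof -
  note D = assms[THEN has_derivative_d_z]
  note [simp] = algebra_simps
  have "((\<lambda>w. f w + g w) has_derivative (\<lambda>v. (d_z f z + d_z g z) * v
      + (d_zbar f z + d_zbar g z) * cnj v)) (at z)"
    by (rule has_derivative_eq_rhs, rule has_derivative_add[OF D]) auto
  from d_z_eqI'[OF this] show "d_z (\<lambda>w. f w + g w) z = d_z f z + d_z g z"
    "d_zbar (\<lambda>w. f w + g w) z = d_zbar f z + d_zbar g z" .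
  have "((\<lambda>w. f w - g w) has_derivative (\<lambda>v. (d_z f z - d_z g z) * v
      + (d_zbar f z - d_zbar g z) * cnj v)) (at z)"
    by (rule has_derivative_eq_rhs, rule has_derivative_diff[OF D]) auto
  from d_z_eqI'(2)[OF this] show "d_zbar (\<lambda>w. f w - g w) z = d_zbar f z - d_zbar g z" .
  have "((\<lambda>w. f w * g w) has_derivative (\<lambda>v. (d_z f z * g z + f z * d_z g z) * v
      + (d_zbar f z * g z + f z * d_zbar g z) * cnj v)) (at z)"
    by (rule has_derivative_eq_rhs, rule has_derivative_mult[OF D]) auto
  from d_z_eqI'[OF this] show "d_z (\<lambda>w. f w * g w) z = d_z f z * g z + f z * d_z g z"
    "d_zbar (\<lambda>w. f w * g w) z = d_zbar f z * g z + f z * d_zbar g z" .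
qed

lemma
  assumes "f differentiable (at z)"
  shows d_z_cmult: "d_z (\<lambda>w. c * f w) z = c * d_z f z"
    and d_zbar_cmult: "d_zbar (\<lambda>w. c * f w) z = c * d_zbar f z"
  by (subst d_z_mult d_zbar_mult; use assms in \<open>simp add: d_z_const d_zbar_const\<close>)+

lemma
  assumes "\<And>i. i \<in> I \<Longrightarrow> f i differentiable (at z)"
  shows d_z_sum: "d_z (\<lambda>w. \<Sum>i\<in>I. f i w) z = (\<Sum>i\<in>I. d_z (f i) z)"
    and d_zbar_sum: "d_zbar (\<lambda>w. \<Sum>i\<in>I. f i w) z = (\<Sum>i\<in>I. d_zbar (f i) z)"
  using assms
  by (induction I rule: infinite_finite_induct)
     (auto simp: d_z_const d_zbar_const d_z_add d_zbar_add differentiable_sum)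

lemma
  assumes "f differentiable (at z)"
  shows d_z_cnj: "d_z (\<lambda>w. cnj (f w)) z = cnj (d_zbar f z)"
    and d_zbar_cnj: "d_zbar (\<lambda>w. cnj (f w)) z = cnj (d_z f z)"
proof -
  have "((\<lambda>w. cnj (f w)) has_derivative (\<lambda>v. cnj (d_zbar f z) * v + cnj (d_z f z) * cnj v)) (at z)"
    by (rule has_derivative_eq_rhs,
        rule bounded_linear.has_derivative[OF bounded_linear_cnj has_derivative_d_z[OF assms]]) auto
  from d_z_eqI'[OF this] show "d_z (\<lambda>w. cnj (f w)) z = cnj (d_zbar f z)"
    "d_zbar (\<lambda>w. cnj (f w)) z = cnj (d_z f z)" .
qed

text \<open>For real-valued \<open>f\<close> the coefficient of \<open>cnj v\<close> is the
  conjugate of that of \<open>v\<close>, so the derivative is real and the projection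
  \<open>Re\<close> under the logarithm disappears.\<close>

lemma d_z_ln:
  assumes "f differentiable (at z)" and "\<And>w. f w \<in> \<real>" and "Re (f z) > 0"
  shows "d_z (\<lambda>w. of_real (ln (Re (f w)))) z = d_z f z / f z"
proof -
  have *: "cnj (d_zbar f z) = d_z f z"
    using d_z_cnj[OF assms(1)] assms(2) by (simp add: Reals_cnj_iff)
  then have "d_z f z * v + d_zbar f z * cnj v = cnj (d_zbar f z * cnj v) + d_zbar f z * cnj v" for v
    by simp
  then have "complex_of_real (Re (d_z f z * v + d_zbar f z * cnj v))
       = d_z f z * v + d_zbar f z * cnj v" for v
    by (simp add: complex_eq_iff)
  then have "((\<lambda>w. complex_of_real (ln (Re (f w)))) has_derivative
      (\<lambda>v. (d_z f z / f z) * v + (d_zbar f z / f z) * cnj v)) (at z)"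
    using assms(2)
    by (intro has_derivative_eq_rhs[OF has_derivative_of_real_ln[of f _ z, OF has_derivative_d_z assms(3)]] assms(1))
       (auto simp: of_real_Re add_divide_distrib)
  from d_z_eqI'(1)[OF this] show ?thesis .
qed

lemma
  assumes "f differentiable (at (p z))" and "(p has_field_derivative p') (at z)"
  shows d_z_compose: "d_z (\<lambda>w. f (p w)) z = d_z f (p z) * p'"
    and d_zbar_compose: "d_zbar (\<lambda>w. f (p w)) z = d_zbar f (p z) * cnj p'"
proof -
  have "((\<lambda>w. f (p w)) has_derivative (\<lambda>v. (d_z f (p z) * p') * v + (d_zbar f (p z) * cnj p') * cnj v)) (at z)"
    by (rule has_derivative_eq_rhs,
        rule has_derivative_compose[of p "(*) p'", OF _ has_derivative_d_z[OF assms(1)]])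
       (use assms(2) in \<open>auto simp: has_field_derivative_def\<close>)
  from d_z_eqI'[OF this] show "d_z (\<lambda>w. f (p w)) z = d_z f (p z) * p'"
    "d_zbar (\<lambda>w. f (p w)) z = d_zbar f (p z) * cnj p'" .
qed

lemma d_zbar_holomorphic: "(f has_field_derivative f') (at z) \<Longrightarrow> d_zbar f z = 0"
  by (rule d_z_eqI'[where a = f']) (simp add: has_field_derivative_def)

lemma d_zbar_zero_imp_field_derivative:
  assumes "f differentiable (at z)" and "d_zbar f z = 0"
  shows "(f has_field_derivative d_z f z) (at z)"
  using has_derivative_d_z[OF assms(1)] assms(2) by (simp add: has_field_derivative_def)

lemma Ck_compose_holomorphic:
  assumes "p holomorphic_on UNIV"
  shows "Ck k f \<Longrightarrow> Ck k (\<lambda>z. f (p z))"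
proof (induction k arbitrary: f)
  case 0
  have "continuous_on UNIV (f \<circ> p)"
    using 0 holomorphic_on_imp_continuous_on[OF assms]
    by (intro continuous_on_compose) (auto intro: continuous_on_subset)
  then show ?case by (simp add: o_def)
next
  case (Suc k)
  have p: "(p has_derivative (\<lambda>v. deriv p z * v)) (at z)" for z
    using holomorphic_derivI[OF assms open_UNIV UNIV_I] by (simp add: has_field_derivative_def)
  show ?case
  proof (rule Ck_SucI)
    show "((\<lambda>z. f (p z)) has_derivative (\<lambda>v. d_z f (p z) * (deriv p z * v)
        + d_zbar f (p z) * cnj (deriv p z * v))) (at z)" for z
      by (rule has_derivative_compose[OF p has_derivative_d_z]) (rule Ck_Suc_differentiable[OF Suc.prems])
    show "Ck k (\<lambda>z. d_z f (p z) * (deriv p z * v) + d_zbar f (p z) * cnj (deriv p z * v))" for v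
      by (intro Ck_add Ck_mult Ck_cnj Ck_const Suc.IH Ck_d_z Ck_d_zbar Suc.prems
          Ck_holomorphic holomorphic_deriv assms open_UNIV)
  qed
qed

declare Ck.simps(2) [simp del]

section \<open>Liouville theorems for subharmonic functions of sublogarithmic growth\<close>

text \<open>A convex function lies above its tangents, so a positive slope at \<open>x\<close> would
  force growth at rate \<open>p' x\<close>, twice the rate allowed by \<epsilon> = p' x / 2.\<close>

lemma deriv_nonpos_of_convex_sublinear:
  fixes p :: "real \<Rightarrow> real"
  assumes p': "\<And>x. (p has_real_derivative p' x) (at x)"
    and p'': "\<And>x. (p' has_real_derivative p'' x) (at x)" and nonneg: "\<And>x. p'' x \<ge> 0"
    and growth: "\<And>\<epsilon>. \<epsilon> > 0 \<Longrightarrow> \<exists>C. \<forall>\<^sub>F x in at_top. p x \<le> \<epsilon> * x + C"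
  shows "p' x \<le> 0"
proof (rule ccontr)
  assume "\<not> p' x \<le> 0"
  then have pos: "p' x > 0" by simp
  have mono: "p' u \<le> p' v" if "u \<le> v" for u v
    using DERIV_nonneg_imp_nondecreasing[OF that] p'' nonneg by blast
  have lower: "p x + p' x * (y - x) \<le> p y" if less: "x < y" for y
  proof -
    obtain z where "x < z" "p y - p x = (y - x) * p' z"
      using MVT2[OF less, of p p'] p' by metis
    moreover have "(y - x) * p' x \<le> (y - x) * p' z"
      using mono[of x z] \<open>x < z\<close> less by (intro mult_left_mono) auto
    ultimately show ?thesis by (simp add: algebra_simps)
  qed
  obtain C where C: "\<forall>\<^sub>F y in at_top. p y \<le> p' x / 2 * y + C"
    using growth[of "p' x / 2"] pos by auto
  have "\<forall>\<^sub>F y in at_top. y > max x (2 / p' x * (C - p x + p' x * x))"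
    by (rule eventually_gt_at_top)
  with C have "\<forall>\<^sub>F y::real in at_top. False"
  proof eventually_elim
    case (elim y)
    then have "p x + p' x * (y - x) \<le> p' x / 2 * y + C" using lower[of y] by linarith
    then have "p' x / 2 * y \<le> C - p x + p' x * x" by (simp add: algebra_simps)
    then have "y \<le> 2 / p' x * (C - p x + p' x * x)" using pos by (simp add: field_simps)
    with elim show ?case by simp
  qed
  then show False by simp
qed

text \<open>The preceding bound is applied to \<open>p\<close> and to its reflection, for which
  boundedness on the left is sublinear growth on the right. Slopes of both signs are excluded, so
  \<open>p'\<close> is identically zero.\<close>

lemma deriv_zero_of_convex_sublinear:
  fixes p :: "real \<Rightarrow> real"
  assumes p': "\<And>x. (p has_real_derivative p' x) (at x)"
    and p'': "\<And>x. (p' has_real_derivative p'' x) (at x)" and nonneg: "\<And>x. p'' x \<ge> 0"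
    and growth: "\<And>\<epsilon>. \<epsilon> > 0 \<Longrightarrow> \<exists>C. \<forall>\<^sub>F x in at_top. p x \<le> \<epsilon> * x + C"
    and bounded: "\<And>x. x \<le> 0 \<Longrightarrow> p x \<le> B"
  shows "p'' x = 0"
proof -
  have "((\<lambda>x. p (- x)) has_real_derivative - p' (- x)) (at x)" for x
    using DERIV_chain2[OF p' DERIV_minus[OF DERIV_ident]] by simp
  moreover have "((\<lambda>x. - p' (- x)) has_real_derivative p'' (- x)) (at x)" for x
    using DERIV_minus[OF DERIV_chain2[OF p'' DERIV_minus[OF DERIV_ident]]] by simp
  moreover have "\<exists>C. \<forall>\<^sub>F x in at_top. p (- x) \<le> \<epsilon> * x + C" if "\<epsilon> > 0" for \<epsilon>
  proof (intro exI)
    show "\<forall>\<^sub>F x in at_top. p (- x) \<le> \<epsilon> * x + B"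
      using eventually_ge_at_top[of 0]
    proof eventually_elim
      case (elim x)
      then have "0 \<le> \<epsilon> * x" using that by simp
      with bounded[of "- x"] elim show ?case by linarith
    qed
  qed
  ultimately have "- p' (- x) \<le> 0" for x
    by (intro deriv_nonpos_of_convex_sublinear[where p = "\<lambda>x. p (- x)" and p' = "\<lambda>x. - p' (- x)"]) (use nonneg in auto)
  from this[of "- x" for x] have "p' x \<ge> 0" for x by simp
  moreover have "p' x \<le> 0" for x
    using p' p'' nonneg growth by (rule deriv_nonpos_of_convex_sublinear)
  ultimately have "p' = (\<lambda>_. 0)" by (intro ext antisym)
  with p''[of x] show ?thesis by (simp add: DERIV_unique[OF _ DERIV_const])
qed

section \<open>Laplacian and vertical averages in the plane\<close>

lemma
  assumes "F differentiable (at (Complex x t))"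
  shows DERIV_Re_along_real_axis: "((\<lambda>x. Re (F (Complex x t))) has_real_derivative
          Re (frechet_derivative F (at (Complex x t)) 1)) (at x)"
    and DERIV_Re_along_imaginary_axis: "((\<lambda>t. Re (F (Complex x t))) has_real_derivative
          Re (frechet_derivative F (at (Complex x t)) \<i>)) (at t)"
proof -
  have F: "(F has_derivative frechet_derivative F (at (Complex x t))) (at (Complex x t))"
    using assms frechet_derivative_works by blast
  interpret linear "frechet_derivative F (at (Complex x t))"
    using assms by (rule linear_frechet_derivative)
  have x: "((\<lambda>x. Complex x t) has_derivative (\<lambda>h. h *\<^sub>R 1)) (at x)"
    unfolding Complex_eq by (auto intro!: derivative_eq_intros simp: scaleR_conv_of_real)
  have t: "((\<lambda>t. Complex x t) has_derivative (\<lambda>h. h *\<^sub>R \<i>)) (at t)"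
    unfolding Complex_eq by (auto intro!: derivative_eq_intros simp: scaleR_conv_of_real)
  show "((\<lambda>x. Re (F (Complex x t))) has_real_derivative
          Re (frechet_derivative F (at (Complex x t)) 1)) (at x)"
    unfolding has_field_derivative_def
    by (rule has_derivative_eq_rhs,
        rule bounded_linear.has_derivative[OF bounded_linear_Re has_derivative_compose[OF x F]])
       (auto simp: scale)
  show "((\<lambda>t. Re (F (Complex x t))) has_real_derivative
          Re (frechet_derivative F (at (Complex x t)) \<i>)) (at t)"
    unfolding has_field_derivative_def
    by (rule has_derivative_eq_rhs,
        rule bounded_linear.has_derivative[OF bounded_linear_Re has_derivative_compose[OF t F]])
       (auto simp: scale)
qed

lemma frechet_derivative_real_valued:
  fixes F :: "'a::real_normed_vector \<Rightarrow> complex"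
  assumes "F differentiable (at z)" and "\<And>w. F w \<in> \<real>"
  shows "frechet_derivative F (at z) v \<in> \<real>"
proof -
  have F: "(F has_derivative frechet_derivative F (at z)) (at z)"
    using assms(1) frechet_derivative_works by blast
  have "(\<lambda>w. Im (F w)) = (\<lambda>_. 0)" using assms(2) by (auto simp: complex_is_Real_iff)
  with bounded_linear.has_derivative[OF bounded_linear_Im F]
  have "((\<lambda>_. 0) has_derivative (\<lambda>v. Im (frechet_derivative F (at z) v))) (at z)" by simp
  then have "(\<lambda>v. Im (frechet_derivative F (at z) v)) = (\<lambda>_. 0)"
    by (rule has_derivative_unique[OF _ has_derivative_const])
  then show ?thesis by (auto simp: complex_is_Real_iff dest: fun_cong)
qed

text \<open>The mixed second derivatives of a real-valued function enter with a factor \<i> and drop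
  out of the real part; what is left is the Laplacian.\<close>

lemma Re_d_zbar_d_z:
  assumes "Ck (Suc (Suc 0)) F" and real: "\<And>w. F w \<in> \<real>"
  shows "Re (4 * d_zbar (d_z F) z)
    = Re (frechet_derivative (\<lambda>z. frechet_derivative F (at z) 1) (at z) 1)
      + Re (frechet_derivative (\<lambda>z. frechet_derivative F (at z) \<i>) (at z) \<i>)"
proof -
  let ?D = "\<lambda>v z. frechet_derivative F (at z) v"
  have D: "?D v differentiable (at z)" for v z
    using assms(1) by (intro Ck_Suc_differentiable[OF Ck_SucD])
  have reals: "frechet_derivative (?D v) (at z) w \<in> \<real>" for v w
    by (intro frechet_derivative_real_valued D real Ck_Suc_differentiable[OF assms(1)])
  have "d_z F = (\<lambda>z. (1 / 2) * ?D 1 z - (\<i> / 2) * ?D \<i> z)"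
    by (auto simp: d_z_def fun_eq_iff field_simps)
  then have eq: "d_zbar (d_z F) z = (1 / 2) * d_zbar (?D 1) z - (\<i> / 2) * d_zbar (?D \<i>) z"
    using d_zbar_diff[of "\<lambda>z. (1 / 2) * ?D 1 z" z "\<lambda>z. (\<i> / 2) * ?D \<i> z"]
    by (simp only: d_zbar_cmult D differentiable_mult differentiable_const)
  show ?thesis
    unfolding eq unfolding d_zbar_def using reals by (simp add: complex_is_Real_iff)
qed

text \<open>The integral of \<open>S\<close> over a vertical period is convex in x: its second
  derivative is the integral of the Laplacian, since the vertical part integrates to zero. Being
  sublinear to the right and bounded to the left, it has zero second derivative, and a continuous
  nonnegative integrand with integral zero vanishes.\<close>

lemma Re_d_zbar_d_z_eq_0_of_periodic:
  assumes C2: "Ck (Suc (Suc 0)) S" and real: "\<And>z. S z \<in> \<real>"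
    and periodic: "\<And>z. S (z + Complex 0 (2 * pi)) = S z"
    and subharmonic: "\<And>z. Re (d_zbar (d_z S) z) \<ge> 0"
    and growth: "\<And>\<epsilon>. \<epsilon> > 0 \<Longrightarrow> \<exists>C. \<forall>\<^sub>F x in at_top. \<forall>t. Re (S (Complex x t)) \<le> \<epsilon> * x + C"
    and bounded: "\<And>x t. x \<le> 0 \<Longrightarrow> Re (S (Complex x t)) \<le> B"
    and "0 \<le> t" "t \<le> 2 * pi"
  shows "Re (d_zbar (d_z S) (Complex x t)) = 0"
proof -
  define D where "D v z = frechet_derivative S (at z) v" for v z
  define D2 where "D2 v z = frechet_derivative (D v) (at z) v" for v z
  have C1: "Ck (Suc 0) (D v)" for v
    unfolding D_def using C2 by (rule Ck_SucD)
  have C0: "continuous_on UNIV (D2 v)" for v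
    using Ck_SucD[OF C1] by (simp add: D2_def[abs_def])
  have SD: "S differentiable (at z)" "D v differentiable (at z)" for z v
    using C2 C1 by (auto intro: Ck_Suc_differentiable)
  have cont: "continuous_on UNIV S" "continuous_on UNIV (D v)" for v
    using Ck_Suc_imp_Ck[OF Ck_Suc_imp_Ck[OF C2]] Ck_Suc_imp_Ck[OF C1] by simp_all
  have C: "continuous_on A (\<lambda>(x, t). Re (f (Complex x t)))"
    if "continuous_on UNIV f" for f :: "complex \<Rightarrow> complex" and A
    unfolding split_beta Complex_eq
    by (intro continuous_intros continuous_on_compose2[OF that]) auto
  have C': "continuous_on A (\<lambda>t. Re (f (Complex x t)))"
    if "continuous_on UNIV f" for f :: "complex \<Rightarrow> complex" and A x
    unfolding Complex_eq by (intro continuous_intros continuous_on_compose2[OF that]) auto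
  define mean where "mean f x = integral {0..2*pi} (\<lambda>t. Re (f (Complex x t)))"
    for f :: "complex \<Rightarrow> complex" and x
  have int: "(\<lambda>t. Re (f (Complex x t))) integrable_on {0..2*pi}"
    if "continuous_on UNIV f" for f :: "complex \<Rightarrow> complex" and x
    by (intro integrable_continuous_real C' that)
  have mean': "(mean f has_real_derivative mean (\<lambda>z. frechet_derivative f (at z) 1) x) (at x)"
    if f: "Ck (Suc 0) f" for f x
  proof -
    have "continuous_on UNIV f" "continuous_on UNIV (\<lambda>z. frechet_derivative f (at z) 1)"
      using Ck_Suc_imp_Ck[OF f] Ck_SucD[OF f] by simp_all
    then have "((\<lambda>x. integral (cbox 0 (2 * pi)) (\<lambda>t. Re (f (Complex x t)))) has_field_derivative
        integral (cbox 0 (2 * pi)) (\<lambda>t. Re (frechet_derivative f (at (Complex x t)) 1)))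
        (at x within UNIV)"
      by (intro leibniz_rule_field_derivative C)
         (simp_all only: cbox_interval int DERIV_Re_along_real_axis Ck_Suc_differentiable[OF f]
           UNIV_I convex_UNIV)
    then show ?thesis by (simp only: mean_def[abs_def] cbox_interval)
  qed
  have periodic_D: "D v (z + Complex 0 (2 * pi)) = D v z" for v z
  proof -
    have "((\<lambda>z. S (z + Complex 0 (2 * pi))) has_derivative (\<lambda>v. D v (z + Complex 0 (2 * pi)))) (at z)"
    proof (rule has_derivative_compose[of "\<lambda>z. z + Complex 0 (2 * pi)" "\<lambda>v. v"])
      show "((\<lambda>z. z + Complex 0 (2 * pi)) has_derivative (\<lambda>v. v)) (at z)"
        by (auto intro!: derivative_eq_intros)
      show "(S has_derivative (\<lambda>v. D v (z + Complex 0 (2 * pi)))) (at (z + Complex 0 (2 * pi)))"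
        using SD(1) unfolding D_def frechet_derivative_works by simp
    qed
    then have "(S has_derivative (\<lambda>v. D v (z + Complex 0 (2 * pi)))) (at z)"
      by (simp add: periodic)
    from frechet_derivative_at[OF this] show ?thesis by (metis D_def)
  qed
  \<comment> \<open>The vertical part of the Laplacian integrates to a difference of end values,
    which agree by \<open>periodic_D\<close>.\<close>
  have "((\<lambda>t. Re (D2 \<i> (Complex x t))) has_integral
      Re (D \<i> (Complex x (2 * pi))) - Re (D \<i> (Complex x 0))) {0..2*pi}" for x
    unfolding D2_def
    by (intro fundamental_theorem_of_calculus)
       (auto intro!: has_field_derivative_at_within DERIV_Re_along_imaginary_axis SD
             simp flip: has_real_derivative_iff_has_vector_derivative)
  moreover have "Complex x (2 * pi) = Complex x 0 + Complex 0 (2 * pi)" for x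
    by (simp add: complex_eq_iff)
  ultimately have imag: "mean (D2 \<i>) x = 0" for x
    unfolding mean_def using periodic_D by (metis diff_self integral_unique)
  have laplace: "Re (4 * d_zbar (d_z S) z) = Re (D2 1 z) + Re (D2 \<i> z)" for z
    unfolding D2_def D_def by (rule Re_d_zbar_d_z[OF C2 real])
  have mean2: "mean (D2 1) x = integral {0..2*pi} (\<lambda>t. Re (4 * d_zbar (d_z S) (Complex x t)))" for x
    using imag[of x] unfolding laplace mean_def by (simp add: integral_add int C0)
  have CZ: "continuous_on UNIV (d_zbar (d_z S))"
    using Ck_d_zbar[OF Ck_d_z[OF C2]] by simp
  have "mean (D2 1) x = 0"
  proof (rule deriv_zero_of_convex_sublinear[where p = "mean S" and p' = "mean (D 1)" and p'' = "mean (D2 1)"])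
    show "(mean S has_real_derivative mean (D 1) x) (at x)" for x
      using mean'[OF Ck_Suc_imp_Ck[OF C2]] by (simp add: D_def[abs_def])
    show "(mean (D 1) has_real_derivative mean (D2 1) x) (at x)" for x
      using mean'[OF C1] by (simp add: D2_def[abs_def])
    show "mean (D2 1) x \<ge> 0" for x
      unfolding mean2 using subharmonic int[OF CZ]
      by (intro integral_nonneg) (auto intro: continuous_intros)
    have upper: "mean S x \<le> 2 * pi * c" if "\<And>t. Re (S (Complex x t)) \<le> c" for c x
    proof -
      have "mean S x \<le> integral {0..2*pi} (\<lambda>_. c)"
        unfolding mean_def by (intro integral_le int cont that) auto
      then show ?thesis by simp
    qed
    show "\<exists>C. \<forall>\<^sub>F x in at_top. mean S x \<le> \<epsilon> * x + C" if \<epsilon>: "\<epsilon> > 0" for \<epsilon>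
    proof -
      obtain C where "\<forall>\<^sub>F x in at_top. \<forall>t. Re (S (Complex x t)) \<le> \<epsilon> / (2 * pi) * x + C"
        using growth[of "\<epsilon> / (2 * pi)"] \<epsilon> by (auto simp del: times_divide_eq_left)
      then have "\<forall>\<^sub>F x in at_top. mean S x \<le> \<epsilon> * x + 2 * pi * C"
      proof eventually_elim
        case (elim x)
        then have "mean S x \<le> 2 * pi * (\<epsilon> / (2 * pi) * x + C)" by (intro upper) simp
        also have "\<dots> = \<epsilon> * x + 2 * pi * C" by (simp add: distrib_left)
        finally show ?case .
      qed
      then show ?thesis by blast
    qed
    show "mean S x \<le> 2 * pi * B" if "x \<le> 0" for x
      using that by (intro upper bounded)
  qed
  moreover have "continuous_on {0..2*pi} (\<lambda>t. Re (4 * d_zbar (d_z S) (Complex x t)))"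
    unfolding laplace by (intro continuous_intros C' C0)
  ultimately have "\<forall>t\<in>{0..2*pi}. Re (4 * d_zbar (d_z S) (Complex x t)) = 0"
    unfolding mean2 using subharmonic
    by (subst (asm) integral_eq_0_iff) auto
  then show ?thesis using assms(7,8) by simp
qed

text \<open>One factor \<open>deriv p\<close> comes from \<open>d_z\<close> and its conjugate from
  \<open>d_zbar\<close>; the remaining term of the product rule contains
  \<open>d_zbar (deriv p)\<close>, which is zero because \<open>deriv p\<close> is
  holomorphic.\<close>

lemma d_zbar_d_z_compose:
  assumes "Ck (Suc (Suc 0)) s" and "p holomorphic_on UNIV"
  shows "d_zbar (d_z (\<lambda>z. s (p z))) z = d_zbar (d_z s) (p z) * (deriv p z * cnj (deriv p z))"
proof -
  have p: "(p has_field_derivative deriv p z) (at z)" for z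
    using holomorphic_derivI[OF assms(2) open_UNIV UNIV_I] by simp
  have p': "deriv p holomorphic_on UNIV"
    by (intro holomorphic_deriv assms open_UNIV)
  have "d_z (\<lambda>z. s (p z)) = (\<lambda>z. d_z s (p z) * deriv p z)"
    by (intro ext d_z_compose p Ck_Suc_differentiable[OF assms(1)])
  moreover have "d_zbar (\<lambda>z. d_z s (p z) * deriv p z) z
      = d_zbar (d_z s) (p z) * cnj (deriv p z) * deriv p z + d_z s (p z) * d_zbar (deriv p) z"
    using d_zbar_mult[OF
        Ck_Suc_differentiable[OF Ck_compose_holomorphic[OF assms(2) Ck_d_z[OF assms(1)]]]
        Ck_Suc_differentiable[OF Ck_holomorphic[OF p', of "Suc 0"]]]
    by (simp add: d_zbar_compose[OF Ck_Suc_differentiable[OF Ck_d_z[OF assms(1)]] p])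
  moreover have "d_zbar (deriv p) z = 0"
    using holomorphic_derivI[OF p' open_UNIV UNIV_I] by (rule d_zbar_holomorphic)
  ultimately show ?thesis by (simp add: mult_ac)
qed

text \<open>Pulling back along \<open>exp\<close> makes the punctured plane periodic: circles become
  vertical segments, ln |z| becomes the coordinate x, and the punctured unit disc becomes the left
  half-plane. The Laplacian only acquires the positive factor |exp z|^2.\<close>

lemma Re_d_zbar_d_z_eq_0:
  assumes C2: "Ck (Suc (Suc 0)) s" and real: "\<And>z. s z \<in> \<real>"
    and subharmonic: "\<And>z. Re (d_zbar (d_z s) z) \<ge> 0"
    and growth: "\<And>\<epsilon>. \<epsilon> > 0 \<Longrightarrow> \<exists>C. \<forall>\<^sub>F z in at_infinity. Re (s z) \<le> \<epsilon> * ln (norm z) + C"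
  shows "Re (d_zbar (d_z s) z) = 0"
proof -
  let ?S = "\<lambda>z. s (exp z)"
  have cont: "continuous_on UNIV s"
    using Ck_Suc_imp_Ck[OF Ck_Suc_imp_Ck[OF C2]] by simp
  \<comment> \<open>The bound on the closed unit disc is the bound on the left half-plane required
    after the pull-back.\<close>
  have "compact (s ` cball 0 1)"
    by (intro compact_continuous_image continuous_on_subset[OF cont]) auto
  then have "bounded (s ` cball 0 1)" by (rule compact_imp_bounded)
  then obtain B where B: "\<And>z. norm z \<le> 1 \<Longrightarrow> norm (s z) \<le> B"
    unfolding bounded_iff by fastforce
  have exp: "exp holomorphic_on UNIV" by (intro holomorphic_intros)
  have laplace: "d_zbar (d_z ?S) z = d_zbar (d_z s) (exp z) * of_real ((norm (exp z))\<^sup>2)" for z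
    using d_zbar_d_z_compose[OF C2 exp, of z]
    by (simp only: DERIV_imp_deriv[OF DERIV_exp] complex_norm_square)
  have nonzero: "Re (d_zbar (d_z s) z) = 0" if "z \<noteq> 0" for z
  proof -
    let ?w = "Complex (ln (norm z)) (Arg2pi z)"
    have "Re (d_zbar (d_z ?S) ?w) = 0"
    proof (rule Re_d_zbar_d_z_eq_0_of_periodic)
      show "Ck (Suc (Suc 0)) ?S" by (rule Ck_compose_holomorphic[OF exp C2])
      show "?S (z + Complex 0 (2 * pi)) = ?S z" for z
        by (simp add: exp_add Complex_eq exp_Euler)
      show "Re (d_zbar (d_z ?S) z) \<ge> 0" for z
        unfolding laplace using subharmonic by simp
      show "\<exists>C. \<forall>\<^sub>F x in at_top. \<forall>t. Re (?S (Complex x t)) \<le> \<epsilon> * x + C" if \<epsilon>: "\<epsilon> > 0" for \<epsilon>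
      proof -
        obtain C R where CR: "\<And>z. norm z \<ge> R \<Longrightarrow> Re (s z) \<le> \<epsilon> * ln (norm z) + C"
          using growth[OF \<epsilon>] by (auto simp: eventually_at_infinity)
        have "\<forall>\<^sub>F x in at_top. x > ln (max R 1)" by (rule eventually_gt_at_top)
        then have "\<forall>\<^sub>F x in at_top. \<forall>t. Re (?S (Complex x t)) \<le> \<epsilon> * x + C"
        proof eventually_elim
          case (elim x)
          then have "exp (ln (max R 1)) < exp x" by (subst exp_less_cancel_iff)
          then show ?case using CR[of "exp (Complex x _)"] by (auto simp: norm_exp_eq_Re)
        qed
        then show ?thesis by blast
      qed
      show "Re (?S (Complex x t)) \<le> B" if "x \<le> 0" for x t
        using B[of "exp (Complex x t)"] that complex_Re_le_cmod[of "?S (Complex x t)"]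
        by (simp add: norm_exp_eq_Re)
      show "0 \<le> Arg2pi z" "Arg2pi z \<le> 2 * pi"
        using Arg2pi[of z] by auto
    qed (rule real)
    moreover have "exp ?w = z"
      using that Arg2pi_eq[of z] by (simp add: Complex_eq exp_add exp_of_real)
    ultimately show ?thesis unfolding laplace using that by simp
  qed
  \<comment> \<open>The origin is not a value of \<open>exp\<close>; there the claim follows by
    continuity.\<close>
  have "continuous_on UNIV (\<lambda>z. Re (d_zbar (d_z s) z))"
    using Ck_d_zbar[OF Ck_d_z[OF C2]] by (auto intro: continuous_intros)
  then have "((\<lambda>z. Re (d_zbar (d_z s) z)) \<longlongrightarrow> Re (d_zbar (d_z s) 0)) (at 0)"
    by (simp add: continuous_on_def)
  moreover have "((\<lambda>z. Re (d_zbar (d_z s) z)) \<longlongrightarrow> 0) (at 0)"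
    by (rule tendsto_eventually) (auto simp: eventually_at_filter nonzero)
  ultimately have "Re (d_zbar (d_z s) 0) = 0"
    using tendsto_unique[of "at (0::complex)"] by (metis at_neq_bot)
  with nonzero show ?thesis by (cases "z = 0") auto
qed

text \<open>A real harmonic function on the plane is 2 Re F plus a constant, with F an entire
  primitive of \<open>d_z s\<close>. An upper bound on \<open>s\<close> is a bound on |exp F|, so a
  one-sided bound is enough for Liouville's argument applied to exp F.\<close>

lemma harmonic_constant:
  assumes C2: "Ck (Suc (Suc 0)) s" and real: "\<And>z. s z \<in> \<real>"
    and harmonic: "\<And>z. d_zbar (d_z s) z = 0"
    and growth: "\<And>\<epsilon>. \<epsilon> > 0 \<Longrightarrow> \<exists>C. \<forall>\<^sub>F z in at_infinity. Re (s z) \<le> \<epsilon> * ln (norm z) + C"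
  shows "s z = s 0"
proof -
  have s: "(s has_derivative (\<lambda>v. d_z s z * v + d_zbar s z * cnj v)) (at z)" for z
    by (intro has_derivative_d_z Ck_Suc_differentiable[OF C2])
  have conj: "d_zbar s z = cnj (d_z s z)" for z
    using d_zbar_cnj[OF Ck_Suc_differentiable[OF C2], of z] real by (simp add: Reals_cnj_iff)
  have "d_z s holomorphic_on UNIV"
    unfolding holomorphic_on_def field_differentiable_def
    using d_zbar_zero_imp_field_derivative[OF Ck_Suc_differentiable[OF Ck_d_z[OF C2]] harmonic]
    by blast
  then obtain F where F: "\<And>z. (F has_field_derivative d_z s z) (at z)"
    using holomorphic_convex_primitive'[OF convex_UNIV open_UNIV] by (metis UNIV_I)
  let ?r = "\<lambda>z. s z - 2 * of_real (Re (F z))"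
  have "(?r has_derivative (\<lambda>_. 0)) (at z)" for z
  proof -
    have "((\<lambda>z. of_real (Re (F z))) has_derivative
        (\<lambda>v. complex_of_real (Re (d_z s z * v)))) (at z)"
      using F[of z] unfolding has_field_derivative_def
      by (intro bounded_linear.has_derivative[OF bounded_linear_of_real]
          bounded_linear.has_derivative[OF bounded_linear_Re])
    from has_derivative_diff[OF s[of z] has_derivative_mult_right[OF this, of 2]]
    show ?thesis
      by (rule has_derivative_eq_rhs) (auto simp: conj complex_eq_iff)
  qed
  then have "?r z = ?r 0" for z
    using has_derivative_zero_constant[of UNIV ?r] by force
  then have eq: "s z = 2 * of_real (Re (F z)) + ?r 0" for z
    by (metis add.commute diff_add_cancel)
  define r where "r = Re (?r 0)"
  have Re_s: "Re (s z) = 2 * Re (F z) + r" for z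
    using arg_cong[OF eq[of z], of Re] by (simp add: r_def)
  \<comment> \<open>With \<epsilon> = 1 the modulus of exp F is at most a multiple of |z|^(1/2),
    since Re F is half of \<open>s\<close> up to a constant. This is below linear growth, so
    Cauchy's inequality on large circles kills the derivative.\<close>
  obtain C where "\<forall>\<^sub>F z in at_infinity. Re (s z) \<le> 1 * ln (norm z) + C"
    using growth[of 1] by auto
  then obtain R where R: "\<And>z. norm z \<ge> R \<Longrightarrow> Re (s z) \<le> ln (norm z) + C"
    by (auto simp: eventually_at_infinity)
  have hol: "(\<lambda>z. exp (F z)) holomorphic_on UNIV"
    using F by (intro holomorphic_intros) (auto simp: holomorphic_on_open)
  have bound: "norm (exp (F z)) \<le> exp ((C - r) / 2) * sqrt (norm z)" if "norm z \<ge> max R 1" for z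
  proof -
    have z: "norm z > 0" using that by linarith
    have "Re (F z) \<le> (C - r) / 2 + ln (norm z) / 2"
      using R[of z] Re_s[of z] that by (simp add: field_simps)
    then have "exp (Re (F z)) \<le> exp ((C - r) / 2 + ln (norm z) / 2)"
      by (subst exp_le_cancel_iff)
    also have "\<dots> = exp ((C - r) / 2) * sqrt (norm z)"
      using z by (simp add: exp_add powr_half_sqrt[symmetric] powr_def)
    finally show ?thesis by (simp add: norm_exp_eq_Re)
  qed
  have d0: "deriv (\<lambda>z. exp (F z)) \<xi> = 0" for \<xi>
  proof -
    let ?c = "exp ((C - r) / 2)"
    have "norm (deriv (\<lambda>z. exp (F z)) \<xi>) \<le> ?c * sqrt (norm \<xi> + \<rho>) / \<rho>"
      if "\<rho> \<ge> norm \<xi> + max R 1" for \<rho>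
    proof -
      have \<rho>: "\<rho> > 0" using that norm_ge_zero[of \<xi>] by linarith
      have "norm ((deriv ^^ 1) (\<lambda>z. exp (F z)) \<xi>) \<le> fact 1 * (?c * sqrt (norm \<xi> + \<rho>)) / \<rho> ^ 1"
      proof (rule Cauchy_inequality)
        show "norm (exp (F x)) \<le> ?c * sqrt (norm \<xi> + \<rho>)" if x: "norm (\<xi> - x) = \<rho>" for x
        proof -
          have "norm x \<ge> max R 1"
            using norm_triangle_ineq4[of \<xi> x] x \<open>\<rho> \<ge> _\<close> by linarith
          note bound[OF this]
          also have "norm x \<le> norm \<xi> + \<rho>"
            using norm_triangle_ineq4[of \<xi> "\<xi> - x"] x by simp
          then have "?c * sqrt (norm x) \<le> ?c * sqrt (norm \<xi> + \<rho>)" by simp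
          finally show ?thesis .
        qed
      qed (auto intro: holomorphic_on_subset[OF hol] \<rho>
             continuous_on_subset[OF holomorphic_on_imp_continuous_on[OF hol]])
      then show ?thesis by simp
    qed
    then have "\<forall>\<^sub>F \<rho> in at_top. norm (deriv (\<lambda>z. exp (F z)) \<xi>) \<le> ?c * sqrt (norm \<xi> + \<rho>) / \<rho>"
      using eventually_ge_at_top by (rule eventually_mono[rotated])
    moreover have "((\<lambda>\<rho>. ?c * sqrt (norm \<xi> + \<rho>) / \<rho>) \<longlongrightarrow> 0) at_top"
      by real_asymp
    ultimately have "norm (deriv (\<lambda>z. exp (F z)) \<xi>) \<le> 0"
      by (intro tendsto_lowerbound[where F = at_top]) auto
    then show ?thesis by simp
  qed
  have "((\<lambda>z. exp (F z)) has_field_derivative 0) (at z)" for z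
    using holomorphic_derivI[OF hol open_UNIV UNIV_I, of z] d0 by simp
  then have "exp (F z) = exp (F 0)"
    using has_field_derivative_zero_constant[OF convex_UNIV, of "\<lambda>z. exp (F z)"] by force
  then have "exp (Re (F z)) = exp (Re (F 0))"
    by (metis norm_exp_eq_Re)
  then show ?thesis using eq[of z] by simp
qed

section \<open>Complex matrices and positive forms\<close>

lemma
  fixes A :: "'a::semiring_1 ^ 'n ^ 'm"
  assumes "invertible A"
  shows matrix_mul_matrix_inv: "A ** matrix_inv A = mat 1"
    and matrix_inv_matrix_mul: "matrix_inv A ** A = mat 1"
proof -
  have "A ** matrix_inv A = mat 1 \<and> matrix_inv A ** A = mat 1"
    using assms unfolding invertible_def matrix_inv_def by (rule someI_ex)
  then show "A ** matrix_inv A = mat 1" "matrix_inv A ** A = mat 1" by auto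
qed

lemma matrix_inv_unique:
  fixes A :: "'a::field ^ 'n ^ 'n"
  assumes "B ** A = mat 1"
  shows "matrix_inv A = B"
proof -
  have "invertible A" using assms invertible_left_inverse by blast
  then have "B ** (A ** matrix_inv A) = B" by (simp add: matrix_mul_matrix_inv)
  then show ?thesis by (simp add: matrix_mul_assoc assms)
qed

lemma matrix_mul_uminus_left: "(- A) ** B = - (A ** (B :: 'a::ring_1 ^ 'n ^ 'm))"
  and matrix_mul_uminus_right: "C ** (- B) = - (C ** (B :: 'a::ring_1 ^ 'n ^ 'm))"
  by (simp_all add: vec_eq_iff matrix_matrix_mult_def sum_negf)

lemma matrix_mul_diff_left: "(A - B) ** C = A ** C - B ** (C :: 'a::ring_1 ^ 'n ^ 'm)"
  and matrix_mul_diff_right: "C ** (D - E) = C ** D - C ** (E :: 'a::ring_1 ^ 'l ^ 'n)"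
  by (simp_all add: vec_eq_iff matrix_matrix_mult_def sum_subtractf left_diff_distrib right_diff_distrib)

lemma mat_mult_nth: "(mat d ** A) $ i $ j = d * A $ i $ j"
  for A :: "'a::semiring_1 ^ 'n ^ 'm"
  by (simp add: matrix_matrix_mult_def mat_def if_distrib[where f = "\<lambda>x. x * _"] cong: if_cong)

lemma mult_mat_nth: "(A ** mat d) $ i $ j = A $ i $ j * d"
  for A :: "'a::semiring_1 ^ 'n ^ 'm"
  by (simp add: matrix_matrix_mult_def mat_def if_distrib[where f = "\<lambda>x. _ * x"] cong: if_cong)

lemma mat_central: "A ** mat d = mat d ** A" for A :: "'a::comm_semiring_1 ^ 'n ^ 'm"
  by (simp add: vec_eq_iff mat_mult_nth mult_mat_nth mult.commute)

lemma mat_mult_mat: "mat c ** mat d = (mat (c * d) :: 'a::semiring_1 ^ 'n ^ 'n)"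
  by (auto simp: vec_eq_iff mat_mult_nth) (auto simp: mat_def)

lemma trace_mat_mult: "trace (mat d ** A) = d * trace A" for A :: "'a::semiring_1 ^ 'n ^ 'n"
  by (simp add: trace_def mat_mult_nth sum_distrib_left)

lemma conj_transpose_mult: "conj_transpose (A ** B) = conj_transpose B ** conj_transpose A"
  by (simp add: conj_transpose_def vec_eq_iff matrix_matrix_mult_def mult.commute)

lemma conj_transpose_diff: "conj_transpose (A - B) = conj_transpose A - conj_transpose B"
  by (simp add: conj_transpose_def vec_eq_iff)

lemma conj_transpose_involutive [simp]: "conj_transpose (conj_transpose A) = A"
  by (simp add: conj_transpose_def vec_eq_iff)

lemma conj_transpose_mat: "conj_transpose (mat c :: complex ^ 'n ^ 'n) = mat (cnj c)"
  by (auto simp: conj_transpose_def vec_eq_iff mat_def)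

lemma trace_conj_transpose: "trace (conj_transpose A) = cnj (trace A)"
  by (simp add: trace_def conj_transpose_def)

lemma conj_transpose_matrix_inv:
  fixes A :: "complex ^ 'n ^ 'n"
  assumes "invertible A"
  shows "matrix_inv (conj_transpose A) = conj_transpose (matrix_inv A)"
  by (rule matrix_inv_unique)
     (simp add: matrix_mul_matrix_inv[OF assms] conj_transpose_mat flip: conj_transpose_mult)

lemma det_conj_transpose: "det (conj_transpose A) = cnj (det A)"
proof -
  have "det (conj_transpose A) = det (\<chi> i j. cnj (A $ i $ j))"
    by (subst det_transpose[symmetric]) (simp add: conj_transpose_def transpose_def)
  also have "\<dots> = cnj (det A)"
    by (simp add: det_def)
  finally show ?thesis .
qed

lemma hprod_alt: "hprod M u v = (\<Sum>i\<in>UNIV. cnj (v $ i) * (M *v u) $ i)"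
  by (simp add: hprod_def matrix_vector_mult_def sum_distrib_left mult.assoc)

lemma hprod_mult_right: "hprod (M ** P) u v = hprod M (P *v u) v"
  by (simp add: hprod_alt matrix_vector_mul_assoc)

lemma hprod_mult_left: "hprod (P ** M) u v = hprod M u (conj_transpose P *v v)"
proof -
  have "hprod (P ** M) u v = (\<Sum>i\<in>UNIV. cnj (v $ i) * (P *v (M *v u)) $ i)"
    by (simp add: hprod_alt matrix_vector_mul_assoc)
  also have "\<dots> = (\<Sum>i\<in>UNIV. \<Sum>j\<in>UNIV. cnj (v $ i) * (P $ i $ j * (M *v u) $ j))"
    by (simp add: matrix_vector_mult_def[of P] sum_distrib_left)
  also have "\<dots> = (\<Sum>j\<in>UNIV. \<Sum>i\<in>UNIV. cnj (v $ i) * (P $ i $ j * (M *v u) $ j))"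
    by (rule sum.swap)
  also have "\<dots> = hprod M u (conj_transpose P *v v)"
    unfolding hprod_alt matrix_vector_mult_def[of "conj_transpose P"]
    by (simp add: conj_transpose_def sum_distrib_left mult_ac)
  finally show ?thesis .
qed

lemma cnj_hprod: "cnj (hprod M u v) = hprod (conj_transpose M) v u"
  unfolding hprod_def by (simp, subst sum.swap) (simp add: conj_transpose_def mult_ac)

lemma hprod_diff_left: "hprod M (u - u') v = hprod M u v - hprod M u' v"
  and hprod_diff_right: "hprod M u (v - v') = hprod M u v - hprod M u v'"
  by (simp_all add: hprod_def algebra_simps sum_subtractf)

lemma hprod_scale_left: "hprod M (c *s u) v = c * hprod M u v"
  and hprod_scale_right: "hprod M u (c *s v) = cnj c * hprod M u v"
  by (simp_all add: hprod_def sum_distrib_left mult_ac)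

lemma matrix_vector_mult_axis: "(A *v axis j 1) $ i = A $ i $ j" for A :: "'a::semiring_1 ^ 'n ^ 'm"
  by (simp add: matrix_vector_mult_def axis_def if_distrib cong: if_cong)

lemma hprod_axis_right: "hprod M u (axis i 1) = (M *v u) $ i"
proof -
  have "hprod M u (axis i 1) = (\<Sum>k\<in>UNIV. if k = i then (M *v u) $ k else 0)"
    unfolding hprod_alt by (intro sum.cong) (auto simp: axis_def)
  then show ?thesis by simp
qed

lemma hprod_axis: "hprod M (axis j 1) (axis i 1) = M $ i $ j"
  by (simp add: hprod_axis_right matrix_vector_mult_axis)

text \<open>Nonnegativity of the form on e_j - t m e_i, with m the (i, j) entry, is a quadratic
  inequality in t; t = 1 / M_ii yields the two by two minor.\<close>

lemma psd_entry_bound: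
  assumes herm: "conj_transpose M = M" and psd: "\<And>v. Re (hprod M v v) \<ge> 0"
  shows "(norm (M $ i $ j))\<^sup>2 \<le> Re (M $ i $ i) * Re (M $ j $ j)"
proof -
  define m where "m = M $ i $ j"
  have ji: "M $ j $ i = cnj m"
    using arg_cong[OF herm, of "\<lambda>A. A $ j $ i"] by (simp add: conj_transpose_def m_def)
  have ge: "t\<^sup>2 * (norm m)\<^sup>2 * Re (M $ i $ i) + Re (M $ j $ j) - 2 * t * (norm m)\<^sup>2 \<ge> 0" for t :: real
  proof -
    let ?v = "axis j 1 - (of_real t * m) *s axis i 1"
    have "hprod M ?v ?v = M $ j $ j - 2 * of_real t * (m * cnj m) + (of_real t)\<^sup>2 * (m * cnj m) * M $ i $ i"
      by (simp add: hprod_diff_left hprod_diff_right hprod_scale_left hprod_scale_right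
          hprod_axis ji m_def algebra_simps power2_eq_square)
    also have "m * cnj m = of_real ((norm m)\<^sup>2)" by (rule complex_norm_square[symmetric])
    finally have "hprod M ?v ?v = M $ j $ j - of_real (2 * t * (norm m)\<^sup>2)
        + of_real (t\<^sup>2 * (norm m)\<^sup>2) * M $ i $ i"
      by simp
    then have "Re (hprod M ?v ?v) = Re (M $ j $ j) - 2 * t * (norm m)\<^sup>2 + t\<^sup>2 * (norm m)\<^sup>2 * Re (M $ i $ i)"
      by simp
    with psd[of ?v] show ?thesis by simp
  qed
  have a: "Re (M $ i $ i) \<ge> 0"
    using psd[of "axis i 1"] by (simp add: hprod_axis)
  have "(norm m)\<^sup>2 \<le> Re (M $ i $ i) * Re (M $ j $ j)"
  proof (cases "Re (M $ i $ i) = 0")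
    case True
    have "m = 0"
    proof (rule ccontr)
      assume "m \<noteq> 0"
      \<comment> \<open>With M_ii = 0 the inequality is linear in t, and this t makes its left-hand
        side equal to -1.\<close>
      then have "2 * ((Re (M $ j $ j) + 1) / (2 * (norm m)\<^sup>2)) * (norm m)\<^sup>2 = Re (M $ j $ j) + 1"
        by simp
      with ge[of "(Re (M $ j $ j) + 1) / (2 * (norm m)\<^sup>2)"] True show False by simp
    qed
    then show ?thesis using True by simp
  next
    case False
    with ge[of "1 / Re (M $ i $ i)"] a show ?thesis
      by (simp add: field_simps power2_eq_square)
  qed
  then show ?thesis by (simp add: m_def)
qed

text \<open>Cholesky elimination. \<open>S\<close> holds the indices not yet eliminated, and
  \<open>M\<close> vanishes outside \<open>S\<close>; each nonzero pivot splits off one rank one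
  form and leaves the Schur complement \<open>M'\<close>.\<close>

lemma psd_decomposition_aux:
  fixes M :: "complex ^ 'n ^ 'n"
  assumes "finite S" and "conj_transpose M = M" and "\<And>v. Re (hprod M v v) \<ge> 0"
    and "\<And>i j. i \<notin> S \<or> j \<notin> S \<Longrightarrow> M $ i $ j = 0"
  shows "\<exists>w :: 'n \<Rightarrow> complex ^ 'n. \<forall>i j. M $ i $ j = (\<Sum>k\<in>S. w k $ i * cnj (w k $ j))"
  using assms
proof (induction S arbitrary: M rule: finite_induct)
  case empty
  then show ?case by simp
next
  case (insert a S)
  note herm = insert.prems(1) and psd = insert.prems(2) and supp = insert.prems(3)
  have cnj_entry: "cnj (M $ i $ j) = M $ j $ i" for i j
    using arg_cong[OF herm, of "\<lambda>A. A $ j $ i"] by (simp add: conj_transpose_def)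
  have a_real: "M $ a $ a = of_real (Re (M $ a $ a))"
    using cnj_entry[of a a] by (simp add: complex_eq_iff)
  have a_nonneg: "Re (M $ a $ a) \<ge> 0"
    using psd[of "axis a 1"] by (simp add: hprod_axis)
  show ?case
  proof (cases "Re (M $ a $ a) = 0")
    case True
    \<comment> \<open>A zero pivot forces its whole row and column to vanish, so there is nothing to
      split off.\<close>
    have row: "M $ a $ j = 0" for j
      using psd_entry_bound[OF herm psd, of a j] True by simp
    have col: "M $ j $ a = 0" for j
      using cnj_entry[of a j] row by simp
    have "M $ i $ j = 0" if "i \<notin> S \<or> j \<notin> S" for i j
      using supp[of i j] that row[of j] col[of i] by (cases "i = a \<or> j = a") auto
    from insert.IH[OF herm psd this] obtain w :: "'n \<Rightarrow> complex ^ 'n"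
      where w: "\<And>i j. M $ i $ j = (\<Sum>k\<in>S. w k $ i * cnj (w k $ j))"
      by blast
    have "M $ i $ j = (\<Sum>k\<in>insert a S. (w(a := 0)) k $ i * cnj ((w(a := 0)) k $ j))" for i j
    proof -
      have "(\<Sum>k\<in>S. (w(a := 0)) k $ i * cnj ((w(a := 0)) k $ j)) = (\<Sum>k\<in>S. w k $ i * cnj (w k $ j))"
        using insert.hyps by (intro sum.cong) auto
      then show ?thesis using insert.hyps by (simp add: w)
    qed
    then show ?thesis by blast
  next
    case False
    define d where "d = Re (M $ a $ a)"
    have d: "d > 0" "M $ a $ a = of_real d"
      using False a_nonneg a_real by (auto simp: d_def)
    define M' where "M' = (\<chi> i j. M $ i $ j - M $ i $ a * M $ a $ j / of_real d)"
    have M'1: "conj_transpose M' = M'"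
      by (simp add: conj_transpose_def M'_def vec_eq_iff cnj_entry mult.commute)
    have M'2: "Re (hprod M' v v) \<ge> 0" for v
    proof -
      define c where "c = hprod M v (axis a 1)"
      have c': "hprod M (axis a 1) v = cnj c"
        unfolding c_def cnj_hprod herm ..
      have c_sum: "c = (\<Sum>j\<in>UNIV. M $ a $ j * v $ j)"
        by (simp add: c_def hprod_axis_right matrix_vector_mult_def)
      have "cnj c = (\<Sum>i\<in>UNIV. cnj (v $ i) * M $ i $ a)"
        by (simp add: c_sum cnj_entry mult.commute)
      then have "cnj c * c / of_real d = (\<Sum>i\<in>UNIV. \<Sum>j\<in>UNIV. cnj (v $ i) * M $ i $ a * (M $ a $ j * v $ j) / of_real d)"
        by (simp add: c_sum sum_product sum_divide_distrib)
      then have "hprod M' v v = hprod M v v - cnj c * c / of_real d"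
        unfolding hprod_def M'_def by (simp add: algebra_simps sum_subtractf)
      \<comment> \<open>The Schur complement evaluates \<open>M\<close> on the component of
        \<open>v\<close> that is \<open>M\<close>-orthogonal to the pivot vector, hence stays
        nonnegative.\<close>
      also have "\<dots> = hprod M (v - (c / of_real d) *s axis a 1) (v - (c / of_real d) *s axis a 1)"
        using d by (simp add: hprod_diff_left hprod_diff_right hprod_scale_left hprod_scale_right
            hprod_axis c' c_def[symmetric] field_simps)
      finally show ?thesis using psd by simp
    qed
    have M'3: "M' $ i $ j = 0" if "i \<notin> S \<or> j \<notin> S" for i j
    proof (cases "i = a \<or> j = a")
      case True
      then show ?thesis using d by (auto simp: M'_def)
    next
      case False
      then have "i \<notin> insert a S \<or> j \<notin> insert a S" using that by auto
      then have "M $ i $ j = 0" "M $ i $ a = 0 \<or> M $ a $ j = 0"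
        using supp by blast+
      then show ?thesis by (auto simp: M'_def)
    qed
    from insert.IH[OF M'1 M'2 M'3] obtain w :: "'n \<Rightarrow> complex ^ 'n"
      where w: "\<And>i j. M' $ i $ j = (\<Sum>k\<in>S. w k $ i * cnj (w k $ j))"
      by blast
    define wa where "wa = (\<chi> i. M $ i $ a / of_real (sqrt d))"
    have "M $ i $ j = (\<Sum>k\<in>insert a S. (w(a := wa)) k $ i * cnj ((w(a := wa)) k $ j))" for i j
    proof -
      have "(\<Sum>k\<in>S. (w(a := wa)) k $ i * cnj ((w(a := wa)) k $ j)) = M' $ i $ j"
        unfolding w using insert.hyps by (intro sum.cong) auto
      moreover have "wa $ i * cnj (wa $ j) = M $ i $ a * M $ a $ j / of_real d"
        using d by (simp add: wa_def cnj_entry flip: of_real_mult)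
      ultimately show ?thesis using insert.hyps by (simp add: M'_def)
    qed
    then show ?thesis by blast
  qed
qed

text \<open>The vectors \<open>w k\<close> play the part of a square root of \<open>M\<close> in the
  positivity argument for traces.\<close>

lemma psd_decomposition:
  fixes M :: "complex ^ 'n ^ 'n"
  assumes "conj_transpose M = M" and "\<And>v. Re (hprod M v v) \<ge> 0"
  obtains w :: "'n \<Rightarrow> complex ^ 'n"
  where "\<And>i j. M $ i $ j = (\<Sum>k\<in>UNIV. w k $ i * cnj (w k $ j))"
  using psd_decomposition_aux[of UNIV M] assms by auto

definition positive_definite :: "complex ^ 'n ^ 'n \<Rightarrow> bool" where
  "positive_definite M \<longleftrightarrow> conj_transpose M = M \<and> (\<forall>v. v \<noteq> 0 \<longrightarrow> Re (hprod M v v) > 0)"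

lemma positive_definite_psd: "positive_definite M \<Longrightarrow> Re (hprod M v v) \<ge> 0"
  by (cases "v = 0") (auto simp: positive_definite_def hprod_def less_imp_le)

lemma positive_definite_invertible:
  fixes M :: "complex ^ 'n ^ 'n"
  assumes "positive_definite M"
  shows "invertible M"
proof -
  have "v = 0" if "M *v v = 0" for v
    using assms that by (auto simp: positive_definite_def hprod_alt dest!: spec[of _ v])
  then show ?thesis
    unfolding invertible_left_inverse matrix_left_invertible_ker by blast
qed

lemma positive_definite_matrix_inv:
  fixes M :: "complex ^ 'n ^ 'n"
  assumes "positive_definite M"
  shows "positive_definite (matrix_inv M)"
proof -
  let ?J = "matrix_inv M"
  have inv: "invertible M" by (rule positive_definite_invertible[OF assms])
  have herm: "conj_transpose ?J = ?J"
    using conj_transpose_matrix_inv[OF inv] assms by (simp add: positive_definite_def)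
  have "Re (hprod ?J v v) > 0" if "v \<noteq> 0" for v
  proof -
    have "M *v (?J *v v) = v"
      by (simp add: matrix_vector_mul_assoc matrix_mul_matrix_inv[OF inv])
    then have "?J *v v \<noteq> 0" using that by auto
    then have "Re (hprod M (?J *v v) (?J *v v)) > 0"
      using assms by (simp add: positive_definite_def)
    also have "hprod M (?J *v v) (?J *v v) = hprod (?J ** M ** ?J) v v"
      unfolding hprod_mult_right[of "?J ** M"] hprod_mult_left[of ?J M] herm ..
    also have "?J ** M ** ?J = ?J" by (simp add: matrix_inv_matrix_mul[OF inv])
    finally show ?thesis .
  qed
  then show ?thesis using herm by (simp add: positive_definite_def)
qed

text \<open>The Hermitian form \<open>tr (P Q\<^sup>\<dagger>)\<close>, with the adjoint taken for \<open>Q\<close> as a map from a space with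
  metric \<open>M\<^sup>-\<^sup>1\<close> to a space with metric \<open>H\<close>.\<close>

definition endo_form :: "complex ^ 'n ^ 'n \<Rightarrow> complex ^ 'n ^ 'n \<Rightarrow> complex ^ 'n ^ 'n \<Rightarrow>
    complex ^ 'n ^ 'n \<Rightarrow> complex" where
  "endo_form M H P Q = trace (P ** M ** conj_transpose Q ** H)"

text \<open>Splitting \<open>H\<close> into rank one forms turns the trace into a sum of values of
  \<open>M\<close>, where positivity is visible.\<close>

lemma endo_form_eq_sum:
  fixes H :: "complex ^ 'n ^ 'n"
  assumes "\<And>i j. H $ i $ j = (\<Sum>k\<in>UNIV. w k $ i * cnj (w k $ j))"
  shows "endo_form M H P P
    = (\<Sum>k\<in>(UNIV :: 'n set). hprod M (conj_transpose P *v w k) (conj_transpose P *v w k))"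
proof -
  let ?N = "P ** M ** conj_transpose P"
  have "endo_form M H P P = (\<Sum>i\<in>UNIV. \<Sum>j\<in>UNIV. \<Sum>k\<in>UNIV. ?N $ i $ j * (w k $ j * cnj (w k $ i)))"
    unfolding endo_form_def trace_def by (simp add: matrix_matrix_mult_def[of ?N] assms sum_distrib_left)
  also have "\<dots> = (\<Sum>i\<in>UNIV. \<Sum>k\<in>UNIV. \<Sum>j\<in>UNIV. ?N $ i $ j * (w k $ j * cnj (w k $ i)))"
    by (intro sum.cong refl sum.swap)
  also have "\<dots> = (\<Sum>k\<in>UNIV. \<Sum>i\<in>UNIV. \<Sum>j\<in>UNIV. ?N $ i $ j * (w k $ j * cnj (w k $ i)))"
    by (rule sum.swap)
  also have "\<dots> = (\<Sum>k\<in>UNIV. hprod ?N (w k) (w k))"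
    by (simp add: hprod_def mult_ac)
  finally show ?thesis
    unfolding hprod_mult_right[of "P ** M"] hprod_mult_left[of P M] .
qed

text \<open>Each term of the sum in \<open>endo_form_eq_sum\<close> is real and nonnegative. If all
  vanish, the adjoint of \<open>P\<close> kills every \<open>w k\<close>, hence
  \<open>conj_transpose P ** H = 0\<close>, and \<open>H\<close> can be cancelled.\<close>

lemma
  fixes H :: "complex ^ 'n ^ 'n"
  assumes M: "positive_definite M" and H: "positive_definite H"
  shows endo_form_real: "endo_form M H P P \<in> \<real>"
    and endo_form_nonneg: "Re (endo_form M H P P) \<ge> 0"
    and endo_form_eq_0D: "Re (endo_form M H P P) = 0 \<Longrightarrow> P = 0"
proof -
  obtain w :: "'n \<Rightarrow> complex ^ 'n"
    where w: "\<And>i j. H $ i $ j = (\<Sum>k\<in>UNIV. w k $ i * cnj (w k $ j))"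
    using psd_decomposition[of H] H positive_definite_psd[OF H] by (auto simp: positive_definite_def)
  let ?x = "\<lambda>k. conj_transpose P *v w k"
  have eq: "endo_form M H P P = (\<Sum>k\<in>UNIV. hprod M (?x k) (?x k))"
    by (rule endo_form_eq_sum[OF w])
  have "hprod M (?x k) (?x k) \<in> \<real>" for k
    using cnj_hprod[of M "?x k" "?x k"] M by (simp add: positive_definite_def Reals_cnj_iff)
  then show "endo_form M H P P \<in> \<real>" unfolding eq by (intro sum_in_Reals)
  show "Re (endo_form M H P P) \<ge> 0"
    unfolding eq using positive_definite_psd[OF M] by (auto intro: sum_nonneg)
  show "P = 0" if "Re (endo_form M H P P) = 0"
  proof -
    have "(\<Sum>k\<in>UNIV. Re (hprod M (?x k) (?x k))) = 0"
      using that unfolding eq by simp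
    then have "Re (hprod M (?x k) (?x k)) = 0" for k
      using positive_definite_psd[OF M] by (subst (asm) sum_nonneg_eq_0_iff) auto
    then have x: "?x k = 0" for k
      using M unfolding positive_definite_def by (metis less_irrefl)
    have "(conj_transpose P ** H) $ i $ l = 0" for i l
    proof -
      have "(conj_transpose P ** H) $ i $ l
        = (\<Sum>j\<in>UNIV. \<Sum>k\<in>UNIV. conj_transpose P $ i $ j * (w k $ j * cnj (w k $ l)))"
        by (simp add: matrix_matrix_mult_def w sum_distrib_left)
      also have "\<dots> = (\<Sum>k\<in>UNIV. \<Sum>j\<in>UNIV. conj_transpose P $ i $ j * (w k $ j * cnj (w k $ l)))"
        by (rule sum.swap)
      also have "\<dots> = (\<Sum>k\<in>UNIV. ?x k $ i * cnj (w k $ l))"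
        by (simp add: matrix_vector_mult_def sum_distrib_left mult_ac)
      finally show ?thesis by (simp add: x)
    qed
    then have "conj_transpose P ** H = 0" by (simp add: vec_eq_iff)
    then have "conj_transpose P ** H ** matrix_inv H = 0"
      by (simp add: vec_eq_iff matrix_matrix_mult_def)
    then have "conj_transpose P = 0"
      using matrix_mul_matrix_inv[OF positive_definite_invertible[OF H]]
      by (simp flip: matrix_mul_assoc)
    then show "P = 0" by (simp add: conj_transpose_def vec_eq_iff)
  qed
qed

section \<open>Matrix-valued functions\<close>

definition mat_Ck :: "nat \<Rightarrow> (complex \<Rightarrow> complex ^ 'n ^ 'm) \<Rightarrow> bool" where
  "mat_Ck k A \<longleftrightarrow> (\<forall>i j. Ck k (\<lambda>z. A z $ i $ j))"

definition mat_d_z :: "(complex \<Rightarrow> complex ^ 'n ^ 'm) \<Rightarrow> complex \<Rightarrow> complex ^ 'n ^ 'm" where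
  "mat_d_z A z = (\<chi> i j. d_z (\<lambda>w. A w $ i $ j) z)"

definition mat_d_zbar :: "(complex \<Rightarrow> complex ^ 'n ^ 'm) \<Rightarrow> complex \<Rightarrow> complex ^ 'n ^ 'm" where
  "mat_d_zbar A z = (\<chi> i j. d_zbar (\<lambda>w. A w $ i $ j) z)"

lemma mat_Ck_Suc_differentiable: "mat_Ck (Suc k) A \<Longrightarrow> (\<lambda>w. A w $ i $ j) differentiable (at z)"
  by (auto simp: mat_Ck_def intro: Ck_Suc_differentiable)

lemma mat_Ck_const: "mat_Ck k (\<lambda>_. A)"
  by (simp add: mat_Ck_def Ck_const)

lemma mat_Ck_mult: "mat_Ck k A \<Longrightarrow> mat_Ck k B \<Longrightarrow> mat_Ck k (\<lambda>z. A z ** B z)"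
  by (auto simp: mat_Ck_def matrix_matrix_mult_def intro!: Ck_sum Ck_mult)

lemma mat_Ck_diff: "mat_Ck k A \<Longrightarrow> mat_Ck k B \<Longrightarrow> mat_Ck k (\<lambda>z. A z - B z)"
  by (auto simp: mat_Ck_def intro!: Ck_diff)

lemma mat_Ck_d_z: "mat_Ck (Suc k) A \<Longrightarrow> mat_Ck k (mat_d_z A)"
  by (auto simp: mat_Ck_def mat_d_z_def intro!: Ck_d_z)

lemma Ck_trace: "mat_Ck k A \<Longrightarrow> Ck k (\<lambda>z. trace (A z))"
  by (auto simp: mat_Ck_def trace_def intro!: Ck_sum)

lemma Ck_det: "mat_Ck k A \<Longrightarrow> Ck k (\<lambda>z. det (A z))"
  by (auto simp: mat_Ck_def det_def intro!: Ck_sum Ck_mult Ck_prod Ck_const)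

text \<open>Cramer's rule with a basis vector on the right-hand side. The explicit quotient serves
  twice: for smoothness of the inverse metric and for its growth at infinity.\<close>

lemma matrix_inv_entry:
  fixes A :: "'a::field ^ 'n ^ 'n"
  assumes "invertible A"
  shows "matrix_inv A $ i $ j
    = det (\<chi> k l. if l = i then (if k = j then 1 else 0) else A $ k $ l) / det A"
proof -
  have "A *v (matrix_inv A *v axis j 1) = axis j 1"
    by (simp add: matrix_vector_mul_assoc matrix_mul_matrix_inv[OF assms])
  then have "matrix_inv A *v axis j 1 = (\<chi> m. det (\<chi> k l. if l = m then axis j 1 $ k else A $ k $ l) / det A)"
    using assms by (subst (asm) cramer) (simp_all add: invertible_det_nz)
  then have "(matrix_inv A *v axis j 1) $ i = det (\<chi> k l. if l = i then axis j 1 $ k else A $ k $ l) / det A"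
    by simp
  moreover have "axis j 1 $ k = (if k = j then 1 else 0 :: 'a)" for k
    by (simp add: axis_def)
  ultimately show ?thesis
    by (simp only: matrix_vector_mult_axis)
qed

lemma mat_Ck_matrix_inv:
  fixes A :: "complex \<Rightarrow> complex ^ 'n ^ 'n"
  assumes "mat_Ck k A" and "\<And>z. invertible (A z)"
  shows "mat_Ck k (\<lambda>z. matrix_inv (A z))"
proof -
  have "Ck k (\<lambda>z. det (\<chi> m l. if l = i then (if m = j then 1 else 0) else A z $ m $ l))" for i j
  proof (intro Ck_det, unfold mat_Ck_def, intro allI)
    fix m l
    show "Ck k (\<lambda>z. (\<chi> m l. if l = i then (if m = j then 1 else 0) else A z $ m $ l) $ m $ l)"
      using assms(1) by (cases "l = i") (simp_all add: mat_Ck_def Ck_const)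
  qed
  then show ?thesis
    using assms(2) unfolding mat_Ck_def
    by (auto simp: matrix_inv_entry invertible_det_nz intro!: Ck_divide Ck_det[OF assms(1)])
qed

lemma
  assumes "mat_Ck (Suc 0) A" and "mat_Ck (Suc 0) B"
  shows mat_d_z_mult: "mat_d_z (\<lambda>w. A w ** B w) z = mat_d_z A z ** B z + A z ** mat_d_z B z"
    and mat_d_zbar_mult: "mat_d_zbar (\<lambda>w. A w ** B w) z = mat_d_zbar A z ** B z + A z ** mat_d_zbar B z"
  using assms[THEN mat_Ck_Suc_differentiable]
  by (simp_all add: mat_d_z_def mat_d_zbar_def matrix_matrix_mult_def vec_eq_iff
      d_z_sum d_zbar_sum d_z_mult d_zbar_mult differentiable_mult sum.distrib)

lemma mat_d_zbar_diff:
  assumes "mat_Ck (Suc 0) A" and "mat_Ck (Suc 0) B"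
  shows "mat_d_zbar (\<lambda>w. A w - B w) z = mat_d_zbar A z - mat_d_zbar B z"
  using assms[THEN mat_Ck_Suc_differentiable]
  by (simp add: mat_d_zbar_def vec_eq_iff d_zbar_diff)

lemma
  assumes "mat_Ck (Suc 0) A"
  shows d_z_trace: "d_z (\<lambda>w. trace (A w)) z = trace (mat_d_z A z)"
    and d_zbar_trace: "d_zbar (\<lambda>w. trace (A w)) z = trace (mat_d_zbar A z)"
  using assms[THEN mat_Ck_Suc_differentiable]
  by (simp_all add: mat_d_z_def mat_d_zbar_def trace_def d_z_sum d_zbar_sum)

lemma mat_d_z_conj_transpose:
  assumes "mat_Ck (Suc 0) A"
  shows "mat_d_z (\<lambda>w. conj_transpose (A w)) z = conj_transpose (mat_d_zbar A z)"
  using assms[THEN mat_Ck_Suc_differentiable]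
  by (simp add: mat_d_z_def mat_d_zbar_def conj_transpose_def vec_eq_iff d_z_cnj)

lemma mat_d_z_matrix_inv:
  fixes A :: "complex \<Rightarrow> complex ^ 'n ^ 'n"
  assumes "mat_Ck (Suc 0) A" and inv: "\<And>z. invertible (A z)"
  shows "mat_d_z (\<lambda>w. matrix_inv (A w)) z = - (matrix_inv (A z) ** mat_d_z A z ** matrix_inv (A z))"
proof -
  let ?J = "\<lambda>w. matrix_inv (A w)"
  have "mat_d_z (\<lambda>w. ?J w ** A w) z = mat_d_z ?J z ** A z + ?J z ** mat_d_z A z"
    by (intro mat_d_z_mult assms mat_Ck_matrix_inv)
  moreover have "mat_d_z (\<lambda>w. ?J w ** A w) z = 0"
    by (simp add: matrix_inv_matrix_mul[OF inv] mat_d_z_def vec_eq_iff d_z_const)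
  ultimately have "mat_d_z ?J z ** A z = - (?J z ** mat_d_z A z)"
    by (simp add: eq_neg_iff_add_eq_0)
  then have "mat_d_z ?J z ** A z ** ?J z = - (?J z ** mat_d_z A z ** ?J z)"
    by (simp add: matrix_mul_uminus_left)
  then show ?thesis
    using matrix_mul_matrix_inv[OF inv] by (simp flip: matrix_mul_assoc)
qed

section \<open>Jacobi's formula for the derivative of a determinant\<close>

lemma differentiable_prod:
  fixes f :: "'i \<Rightarrow> complex \<Rightarrow> complex"
  shows "(\<And>i. i \<in> I \<Longrightarrow> f i differentiable (at z)) \<Longrightarrow> (\<lambda>w. \<Prod>i\<in>I. f i w) differentiable (at z)"
  by (induction I rule: infinite_finite_induct) (auto intro: differentiable_mult)

lemma d_z_prod:
  assumes "finite I" and "\<And>i. i \<in> I \<Longrightarrow> f i differentiable (at z)"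
  shows "d_z (\<lambda>w. \<Prod>i\<in>I. f i w) z = (\<Sum>k\<in>I. d_z (f k) z * (\<Prod>i\<in>I - {k}. f i z))"
  using assms
proof (induction I rule: finite_induct)
  case empty
  show ?case by (simp add: d_z_const)
next
  case (insert a I)
  have diff: "f a differentiable (at z)" "(\<lambda>w. \<Prod>i\<in>I. f i w) differentiable (at z)"
    using insert.prems by (auto intro: differentiable_prod)
  have "(\<Prod>i\<in>insert a I - {k}. f i z) = f a z * (\<Prod>i\<in>I - {k}. f i z)" if "k \<in> I" for k
  proof -
    have "insert a I - {k} = insert a (I - {k})" using that insert.hyps by auto
    then show ?thesis using insert.hyps by simp
  qed
  then have "(\<Sum>k\<in>I. d_z (f k) z * (\<Prod>i\<in>insert a I - {k}. f i z))
      = f a z * (\<Sum>k\<in>I. d_z (f k) z * (\<Prod>i\<in>I - {k}. f i z))"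
    by (simp add: sum_distrib_left mult_ac)
  moreover have "d_z (\<lambda>w. \<Prod>i\<in>insert a I. f i w) z
      = d_z (f a) z * (\<Prod>i\<in>I. f i z) + f a z * (\<Sum>k\<in>I. d_z (f k) z * (\<Prod>i\<in>I - {k}. f i z))"
    using insert by (simp add: d_z_mult diff)
  ultimately show ?case
    using insert.hyps by simp
qed

text \<open>The determinant is differentiated row by row. Writing the derivative of \<open>A\<close>
  as \<open>B ** A z\<close>, the differentiated k-th row is a combination of the rows of
  \<open>A z\<close>, and putting it in place of row k multiplies the determinant by
  \<open>B $ k $ k\<close>.\<close>

lemma d_z_det:
  assumes A: "mat_Ck (Suc 0) A" and inv: "invertible (A z)"
  shows "d_z (\<lambda>w. det (A w)) z = trace (matrix_inv (A z) ** mat_d_z A z) * det (A z)"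
proof -
  define B where "B = mat_d_z A z ** matrix_inv (A z)"
  have BA: "mat_d_z A z = B ** A z"
    unfolding B_def using matrix_inv_matrix_mul[OF inv] by (simp flip: matrix_mul_assoc)
  let ?R = "\<lambda>k. \<chi> i. if i = k then (\<Sum>l\<in>UNIV. B $ k $ l *s row l (A z)) else row i (A z)"
  have diff: "(\<lambda>w. A w $ i $ j) differentiable (at z)" for i j
    by (rule mat_Ck_Suc_differentiable[OF A])
  have row: "(\<Sum>l\<in>UNIV. B $ k $ l *s row l (A z)) $ j = d_z (\<lambda>w. A w $ k $ j) z" for k j
    using arg_cong[OF BA, of "\<lambda>M. M $ k $ j"]
    by (simp add: mat_d_z_def matrix_matrix_mult_def row_def)
  have entry: "?R k $ i $ j = (if i = k then d_z (\<lambda>w. A w $ k $ j) z else A z $ i $ j)" for k i j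
    using row[of k j] by (simp add: row_def)
  have prod: "(\<Prod>i\<in>UNIV. ?R k $ i $ p i)
      = d_z (\<lambda>w. A w $ k $ p k) z * (\<Prod>i\<in>UNIV - {k}. A z $ i $ p i)" for k p
    unfolding entry by (subst prod.remove[of UNIV k]) auto
  have d_prod: "(\<lambda>w. \<Prod>i\<in>UNIV. A w $ i $ p i) differentiable (at z)" for p
    by (intro differentiable_prod diff)
  have "d_z (\<lambda>w. of_int (sign p) * (\<Prod>i\<in>UNIV. A w $ i $ p i)) z = of_int (sign p) *
      (\<Sum>k\<in>UNIV. d_z (\<lambda>w. A w $ k $ p k) z * (\<Prod>i\<in>UNIV - {k}. A z $ i $ p i))" for p
    by (subst d_z_cmult[OF d_prod], subst d_z_prod) (simp_all add: diff)
  then have "d_z (\<lambda>w. det (A w)) z = (\<Sum>p | p permutes UNIV. of_int (sign p) *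
      (\<Sum>k\<in>UNIV. d_z (\<lambda>w. A w $ k $ p k) z * (\<Prod>i\<in>UNIV - {k}. A z $ i $ p i)))"
    unfolding det_def
    by (subst d_z_sum) (simp_all add: d_prod differentiable_mult)
  also have "\<dots> = (\<Sum>p | p permutes UNIV. \<Sum>k\<in>UNIV. of_int (sign p) * (\<Prod>i\<in>UNIV. ?R k $ i $ p i))"
    by (simp only: prod sum_distrib_left)
  also have "\<dots> = (\<Sum>k\<in>UNIV. det (?R k))"
    by (subst sum.swap) (simp only: det_def)
  also have "\<dots> = (\<Sum>k\<in>UNIV. B $ k $ k * det (A z))"
    by (intro sum.cong refl cramer_lemma_transpose)
  also have "\<dots> = trace B * det (A z)"
    by (simp add: trace_def sum_distrib_right)
  finally show ?thesis
    unfolding B_def trace_mul_sym[of "mat_d_z A z" "matrix_inv (A z)"] .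
qed

section \<open>Growth of solutions of Hitchin's equation\<close>

text \<open>The upper bounds in the last clause are all that is used of adaptedness; the lower bounds
  follow from them because the determinant is constant.\<close>

definition hitchin_metric :: "(complex \<Rightarrow> complex ^ 'n ^ 'n) \<Rightarrow> ('n \<Rightarrow> real) \<Rightarrow>
    (complex \<Rightarrow> complex ^ 'n ^ 'n) \<Rightarrow> bool" where
  "hitchin_metric \<Phi> a H \<longleftrightarrow> hermitian_metric H \<and>
     (\<forall>z. mat_d_zbar (chern_connection H) z
        = \<Phi> z ** h_adjoint (H z) (\<Phi> z) - h_adjoint (H z) (\<Phi> z) ** \<Phi> z) \<and>
     (\<forall>\<epsilon>>0. \<exists>C. \<forall>\<^sub>F z in at_infinity. \<forall>i. Re (H z $ i $ i) \<le> C * norm z powr (\<epsilon> - 2 * a i))"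

lemma hermitian_metricD:
  assumes "hermitian_metric H"
  shows "mat_Ck k H" "positive_definite (H z)" "conj_transpose (H z) = H z" "invertible (H z)"
proof -
  show "mat_Ck k H" "conj_transpose (H z) = H z" and *: "positive_definite (H z)"
    using assms by (auto simp: hermitian_metric_def mat_Ck_def smooth_def positive_definite_def)
  show "invertible (H z)" using * by (rule positive_definite_invertible)
qed

lemma mat_Ck_chern_connection:
  assumes "hermitian_metric H"
  shows "mat_Ck k (chern_connection H)"
proof -
  have "chern_connection H = (\<lambda>z. matrix_inv (H z) ** mat_d_z H z)"
    by (simp add: chern_connection_def mat_d_z_def fun_eq_iff)
  then show ?thesis
    by (simp only:) (intro mat_Ck_mult mat_Ck_matrix_inv mat_Ck_d_z hermitian_metricD[OF assms])
qed

lemma meromorphic_at_infinity_const: "meromorphic_at_infinity (\<lambda>_. c)"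
  unfolding meromorphic_at_infinity_def by (intro meromorphic_intros)

text \<open>Adaptedness is tested on the frame sections e_i: the squared norm of e_i is the i-th
  diagonal entry of the Gram matrix. The sign in the equation changes because
  \<open>chern_curvature\<close> carries the minus sign of dzbar \<and> dz = - dz \<and>
  dzbar.\<close>

lemma hitchin_metric_of_harmonic_metric:
  assumes "harmonic_metric (direct_sum_filtration a) \<Phi> H"
  shows "hitchin_metric \<Phi> a H"
proof -
  have herm: "hermitian_metric H" and adapted: "adapted (direct_sum_filtration a) H"
    and eq: "\<And>z. chern_curvature H z
        + (\<Phi> z ** h_adjoint (H z) (\<Phi> z) - h_adjoint (H z) (\<Phi> z) ** \<Phi> z) = 0"
    using assms by (auto simp: harmonic_metric_def)
  have "mat_d_zbar (chern_connection H) z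
        = \<Phi> z ** h_adjoint (H z) (\<Phi> z) - h_adjoint (H z) (\<Phi> z) ** \<Phi> z" for z
    using eq[of z] by (simp add: chern_curvature_def mat_d_zbar_def)
  moreover have "\<exists>C. \<forall>\<^sub>F z in at_infinity. \<forall>i. Re (H z $ i $ i) \<le> C * norm z powr (\<epsilon> - 2 * a i)"
    if \<epsilon>: "\<epsilon> > 0" for \<epsilon>
  proof -
    have "\<exists>C. \<forall>\<^sub>F z in at_infinity. Re (H z $ i $ i) \<le> C * norm z powr (\<epsilon> - 2 * a i)" for i
    proof -
      \<comment> \<open>The section e_i has pole order 0 in its own summand, hence lies in step
        \<open>- a i\<close>; its other components are zero germs, which belong to every
        step.\<close>
      have "(\<lambda>z. axis i 1) \<in> direct_sum_filtration a (- a i)"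
      proof -
        have "zorder (\<lambda>x. 1 :: complex) 0 = 0"
          by (rule zorder_eqI[of UNIV]) auto
        then have "(\<lambda>z. axis i 1 $ j) \<in> line_filtration (a j) (- a i)" for j
          by (cases "j = i") (auto simp: line_filtration_def meromorphic_at_infinity_const
              axis_def pole_order_infinity_def)
        then show ?thesis by (simp add: direct_sum_filtration_def)
      qed
      \<comment> \<open>Half of \<epsilon>, because the norm is squared to reach the diagonal
        entry.\<close>
      then have "(\<lambda>z. hnorm (H z) (axis i 1))
            \<in> O[at_infinity](\<lambda>z. norm (inverse z) powr (- (- a i + \<epsilon> / 2)))"
        using adapted \<epsilon> unfolding adapted_def by (simp add: set_eq_iff)
      then obtain C where C: "\<forall>\<^sub>F z in at_infinity.
          norm (hnorm (H z) (axis i 1)) \<le> C * norm (norm (inverse z) powr (- (- a i + \<epsilon> / 2)))"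
        by (auto elim: landau_o.bigE)
      have "\<forall>\<^sub>F z in at_infinity. norm (z :: complex) \<ge> 1"
        by (auto simp: eventually_at_infinity)
      with C have "\<forall>\<^sub>F z in at_infinity. Re (H z $ i $ i) \<le> C\<^sup>2 * norm z powr (\<epsilon> - 2 * a i)"
      proof eventually_elim
        case (elim z)
        have nonneg: "Re (H z $ i $ i) \<ge> 0"
          using positive_definite_psd[OF hermitian_metricD(2)[OF herm, of z], of "axis i 1"]
          by (simp add: hprod_axis)
        have "norm (inverse z) powr (- (- a i + \<epsilon> / 2)) = norm z powr (\<epsilon> / 2 - a i)"
          using elim by (auto simp: norm_inverse powr_def ln_inverse algebra_simps)
        with elim have "sqrt (Re (H z $ i $ i)) \<le> C * norm z powr (\<epsilon> / 2 - a i)"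
          using nonneg by (simp add: hnorm_def hprod_axis)
        then have "(sqrt (Re (H z $ i $ i)))\<^sup>2 \<le> (C * norm z powr (\<epsilon> / 2 - a i))\<^sup>2"
          using nonneg by (intro power_mono) auto
        also have "\<dots> = C\<^sup>2 * norm z powr ((\<epsilon> / 2 - a i) + (\<epsilon> / 2 - a i))"
          by (simp only: powr_add power2_eq_square mult_ac)
        also have "(\<epsilon> / 2 - a i) + (\<epsilon> / 2 - a i) = \<epsilon> - 2 * a i" by simp
        finally show ?case using nonneg by simp
      qed
      then show ?thesis by blast
    qed
    then obtain C where C: "\<And>i. \<forall>\<^sub>F z in at_infinity. Re (H z $ i $ i) \<le> C i * norm z powr (\<epsilon> - 2 * a i)"
      by metis
    have "\<forall>\<^sub>F z in at_infinity. \<forall>i. Re (H z $ i $ i) \<le> C i * norm z powr (\<epsilon> - 2 * a i)"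
      using C by (rule eventually_all_finite)
    then have "\<forall>\<^sub>F z in at_infinity. \<forall>i. Re (H z $ i $ i) \<le> Max (range C) * norm z powr (\<epsilon> - 2 * a i)"
      by eventually_elim (meson Max_ge UNIV_I finite finite_imageI imageI mult_right_mono order_trans powr_ge_zero)
    then show ?thesis by blast
  qed
  ultimately show ?thesis using herm by (simp add: hitchin_metric_def)
qed

text \<open>Positivity bounds an off-diagonal entry by the geometric mean of two diagonal ones, so
  the exponents -2 a_i and -2 a_j average. The normalisation C >= 1 makes powers of C monotone in
  the exponent.\<close>

lemma hitchin_metric_entry_bound:
  fixes H :: "complex \<Rightarrow> complex ^ 'n ^ 'n"
  assumes "hitchin_metric \<Phi> a H" and \<epsilon>: "\<epsilon> > 0"
  obtains C where "C \<ge> 1"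
    and "\<forall>\<^sub>F z in at_infinity. \<forall>i j. norm (H z $ i $ j) \<le> C * norm z powr (\<epsilon> - a i - a j)"
proof -
  obtain C0 where C0: "\<forall>\<^sub>F z in at_infinity. \<forall>i. Re (H z $ i $ i) \<le> C0 * norm z powr (\<epsilon> - 2 * a i)"
    using assms by (auto simp: hitchin_metric_def)
  define C where "C = max C0 1"
  have herm: "hermitian_metric H" using assms by (simp add: hitchin_metric_def)
  have "\<forall>\<^sub>F z in at_infinity. norm (z :: complex) \<ge> 1"
    by (auto simp: eventually_at_infinity)
  with C0 have "\<forall>\<^sub>F z in at_infinity. \<forall>i j. norm (H z $ i $ j) \<le> C * norm z powr (\<epsilon> - a i - a j)"
  proof eventually_elim
    case (elim z)
    have le: "Re (H z $ i $ i) \<le> C * norm z powr (\<epsilon> - 2 * a i)" for i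
    proof -
      have "Re (H z $ i $ i) \<le> C0 * norm z powr (\<epsilon> - 2 * a i)" using elim by blast
      also have "\<dots> \<le> C * norm z powr (\<epsilon> - 2 * a i)"
        unfolding C_def by (intro mult_right_mono) auto
      finally show ?thesis .
    qed
    have psd: "Re (hprod (H z) v v) \<ge> 0" for v
      by (intro positive_definite_psd hermitian_metricD[OF herm])
    have nonneg: "Re (H z $ i $ i) \<ge> 0" for i
      using psd[of "axis i 1"] by (simp add: hprod_axis)
    have "norm (H z $ i $ j) \<le> C * norm z powr (\<epsilon> - a i - a j)" for i j
    proof (rule power2_le_imp_le)
      have "(norm (H z $ i $ j))\<^sup>2 \<le> Re (H z $ i $ i) * Re (H z $ j $ j)"
        by (intro psd_entry_bound hermitian_metricD[OF herm] psd)
      also have "\<dots> \<le> (C * norm z powr (\<epsilon> - 2 * a i)) * (C * norm z powr (\<epsilon> - 2 * a j))"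
        by (intro mult_mono le nonneg) (simp add: C_def)
      also have "\<dots> = C\<^sup>2 * norm z powr ((\<epsilon> - 2 * a i) + (\<epsilon> - 2 * a j))"
        by (simp only: powr_add power2_eq_square mult_ac)
      also have "(\<epsilon> - 2 * a i) + (\<epsilon> - 2 * a j) = (\<epsilon> - a i - a j) + (\<epsilon> - a i - a j)"
        by simp
      also have "C\<^sup>2 * norm z powr \<dots> = (C * norm z powr (\<epsilon> - a i - a j))\<^sup>2"
        by (simp only: powr_add power2_eq_square mult_ac)
      finally show "(norm (H z $ i $ j))\<^sup>2 \<le> (C * norm z powr (\<epsilon> - a i - a j))\<^sup>2" .
    qed (simp add: C_def)
    then show ?case by blast
  qed
  then show thesis using that[of C] by (simp add: C_def)
qed

text \<open>One term of a Leibniz expansion: the weights of the rows and of the columns add up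
  separately. \<open>S\<close> is the whole index set for the determinant and omits one row for a
  minor.\<close>

lemma permutation_prod_bound:
  fixes M :: "complex ^ 'n ^ 'n" and r \<epsilon> C :: real and a :: "'n \<Rightarrow> real"
  assumes "\<And>i j. norm (M $ i $ j) \<le> C * r powr (\<epsilon> - a i - a j)" and "C \<ge> 1" and "r > 0"
  shows "(\<Prod>i\<in>S. norm (M $ i $ p i))
    \<le> C ^ CARD('n) * r powr (card S * \<epsilon> - (\<Sum>i\<in>S. a i) - (\<Sum>i\<in>S. a (p i)))"
proof -
  have "(\<Prod>i\<in>S. norm (M $ i $ p i)) \<le> (\<Prod>i\<in>S. C * r powr (\<epsilon> - a i - a (p i)))"
    by (intro prod_mono) (auto intro: assms)
  also have "\<dots> = C ^ card S * r powr (\<Sum>i\<in>S. \<epsilon> - a i - a (p i))"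
    using assms by (simp add: prod.distrib powr_sum)
  also have "\<dots> \<le> C ^ CARD('n) * r powr (\<Sum>i\<in>S. \<epsilon> - a i - a (p i))"
    using assms by (intro mult_right_mono power_increasing card_mono) auto
  finally show ?thesis by (simp add: sum_subtractf)
qed

text \<open>A permutation does not change the sum of the weights, which is zero; in each Leibniz
  term only the \<epsilon> of the factors survives.\<close>

lemma det_bound:
  fixes M :: "complex ^ 'n ^ 'n" and r \<epsilon> C :: real and a :: "'n \<Rightarrow> real"
  assumes M: "\<And>i j. norm (M $ i $ j) \<le> C * r powr (\<epsilon> - a i - a j)" "C \<ge> 1" "r > 0"
    and sum0: "(\<Sum>i\<in>UNIV. a i) = 0"
  shows "norm (det M) \<le> fact (CARD('n)) * C ^ CARD('n) * r powr (CARD('n) * \<epsilon>)"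
proof -
  have "norm (det M) \<le> (\<Sum>p | p permutes (UNIV :: 'n set). norm (of_int (sign p) * (\<Prod>i\<in>UNIV. M $ i $ p i)))"
    unfolding det_def by (rule norm_sum)
  also have "\<dots> \<le> (\<Sum>p | p permutes (UNIV :: 'n set). C ^ CARD('n) * r powr (CARD('n) * \<epsilon>))"
  proof (intro sum_mono)
    fix p :: "'n \<Rightarrow> 'n" assume "p \<in> {p. p permutes UNIV}"
    then have "(\<Sum>i\<in>UNIV. a (p i)) = 0"
      using sum.permute[of p UNIV a] sum0 by (simp add: o_def)
    then have "(\<Prod>i\<in>UNIV. norm (M $ i $ p i)) \<le> C ^ CARD('n) * r powr (CARD('n) * \<epsilon>)"
      using permutation_prod_bound[OF M, where S = UNIV and p = p] sum0 by simp
    then show "norm (of_int (sign p) * (\<Prod>i\<in>UNIV. M $ i $ p i)) \<le> C ^ CARD('n) * r powr (CARD('n) * \<epsilon>)"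
      by (simp add: norm_mult prod_norm sign_def)
  qed
  also have "\<dots> = fact (CARD('n)) * C ^ CARD('n) * r powr (CARD('n) * \<epsilon>)"
    using card_permutations[of "UNIV :: 'n set"] by simp
  finally show ?thesis .
qed

text \<open>Column i is a basis vector, so only permutations with \<open>p j = i\<close> contribute.
  Omitting row j and column i from weights of total sum zero leaves the exponents \<open>a j\<close>
  and \<open>a i\<close>.\<close>

lemma minor_bound:
  fixes M :: "complex ^ 'n ^ 'n" and r \<epsilon> C :: real and a :: "'n \<Rightarrow> real"
  assumes M: "\<And>i j. norm (M $ i $ j) \<le> C * r powr (\<epsilon> - a i - a j)" "C \<ge> 1" "r \<ge> 1" and "\<epsilon> > 0"
    and sum0: "(\<Sum>i\<in>UNIV. a i) = 0"
  shows "norm (det (\<chi> k l. if l = i then (if k = j then 1 else 0) else M $ k $ l))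
    \<le> fact (CARD('n)) * C ^ CARD('n) * r powr (CARD('n) * \<epsilon> + a i + a j)"
    (is "norm (det ?N) \<le> _")
proof -
  let ?B = "C ^ CARD('n) * r powr (CARD('n) * \<epsilon> + a i + a j)"
  have "norm (det ?N) \<le> (\<Sum>p | p permutes (UNIV :: 'n set). norm (of_int (sign p) * (\<Prod>k\<in>UNIV. ?N $ k $ p k)))"
    unfolding det_def by (rule norm_sum)
  also have "\<dots> \<le> (\<Sum>p | p permutes (UNIV :: 'n set). ?B)"
  proof (intro sum_mono)
    fix p :: "'n \<Rightarrow> 'n" assume "p \<in> {p. p permutes UNIV}"
    then have p: "p permutes UNIV" by simp
    have "(\<Prod>k\<in>UNIV. norm (?N $ k $ p k)) \<le> ?B"
    proof (cases "p j = i")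
      case True
      have inj: "p k = i \<longleftrightarrow> k = j" for k
        using permutes_inj[OF p] True by (auto simp: inj_def)
      have sums: "(\<Sum>k\<in>UNIV - {j}. a k) = - a j" "(\<Sum>k\<in>UNIV - {j}. a (p k)) = - a i"
        using sum.permute[OF p, of a] sum0 True by (simp_all add: sum_diff1 o_def)
      have "(\<Prod>k\<in>UNIV. norm (?N $ k $ p k)) = norm (?N $ j $ p j) * (\<Prod>k\<in>UNIV - {j}. norm (?N $ k $ p k))"
        by (rule prod.remove) auto
      also have "\<dots> = (\<Prod>k\<in>UNIV - {j}. norm (M $ k $ p k))"
        using True by (simp add: inj)
      also have "\<dots> \<le> C ^ CARD('n) * r powr (card (UNIV - {j}) * \<epsilon> - - a j - - a i)"
        using permutation_prod_bound[OF M(1,2), where S = "UNIV - {j}" and p = p] M(3) unfolding sums by simp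
      also have "\<dots> \<le> ?B"
        using M \<open>\<epsilon> > 0\<close> by (intro mult_left_mono powr_mono) (auto intro!: mult_right_mono card_mono)
      finally show ?thesis .
    next
      case False
      obtain k where "p k = i" using permutes_surj[OF p] by (metis surjD)
      then have "norm (?N $ k $ p k) = 0" using False by auto
      then have "(\<Prod>k\<in>UNIV. norm (?N $ k $ p k)) = 0" by (meson UNIV_I finite prod_zero)
      moreover have "0 \<le> ?B" using M(2) by simp
      ultimately show ?thesis by linarith
    qed
    then show "norm (of_int (sign p) * (\<Prod>k\<in>UNIV. ?N $ k $ p k)) \<le> ?B"
      by (simp add: norm_mult prod_norm sign_def)
  qed
  also have "\<dots> = fact (CARD('n)) * ?B"
    using card_permutations[of "UNIV :: 'n set"] by simp
  finally show ?thesis by (simp only: mult.assoc)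
qed

lemma hitchin_metric_det_constant:
  fixes H :: "complex \<Rightarrow> complex ^ 'n ^ 'n"
  assumes H: "hitchin_metric \<Phi> a H" and sum0: "(\<Sum>i\<in>UNIV. a i) = 0"
  shows "norm (det (H z)) = norm (det (H 0))"
proof -
  have herm: "hermitian_metric H" using H by (simp add: hitchin_metric_def)
  note HD = hermitian_metricD[OF herm]
  let ?D = "\<lambda>z. det (H z)"
  \<comment> \<open>The square is positive as soon as the determinant is real and nonzero, which is
    all that is known of it here.\<close>
  define f where "f z = ?D z * ?D z" for z
  define s where "s z = complex_of_real (ln (Re (f z)))" for z
  have D: "?D z \<noteq> 0" "?D z \<in> \<real>" for z
    using HD(3,4)[of z] det_conj_transpose[of "H z"]
    by (simp_all add: Reals_cnj_iff invertible_det_nz)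
  have f: "Re (f z) > 0" "f z \<in> \<real>" and norm_f: "Re (f z) = (norm (?D z))\<^sup>2" for z
    using D[of z] unfolding f_def by (auto elim!: Reals_cases simp: power2_eq_square zero_less_mult_iff)
  have CkD: "Ck k ?D" for k by (intro Ck_det HD)
  then have Ckf: "Ck k f" for k unfolding f_def[abs_def] by (intro Ck_mult)
  have "d_z s z = 2 * trace (chern_connection H z)" for z
  proof -
    have "d_z s z = d_z f z / f z"
      unfolding s_def[abs_def] using f Ckf by (intro d_z_ln) (auto intro: Ck_Suc_differentiable)
    also have "d_z f z = 2 * d_z ?D z * ?D z"
      unfolding f_def[abs_def] using Ck_Suc_differentiable[OF CkD] by (subst d_z_mult) auto
    also have "d_z ?D z = trace (chern_connection H z) * ?D z"
      by (subst d_z_det) (auto simp: chern_connection_def mat_d_z_def HD)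
    finally show ?thesis using D(1)[of z] by (simp add: f_def)
  qed
  then have ds: "d_z s = (\<lambda>z. 2 * trace (chern_connection H z))" by auto
  have "s z = s 0"
  proof (rule harmonic_constant)
    show "Ck (Suc (Suc 0)) s" unfolding s_def[abs_def] by (intro Ck_of_real_ln Ckf f)
    show "s z \<in> \<real>" for z by (simp add: s_def)
    show "d_zbar (d_z s) z = 0" for z
    proof -
      have "d_zbar (d_z s) z = 2 * trace (mat_d_zbar (chern_connection H) z)"
        unfolding ds using mat_Ck_chern_connection[OF herm]
        by (subst d_zbar_cmult) (auto intro: Ck_Suc_differentiable[OF Ck_trace] simp: d_zbar_trace)
      also have "trace (mat_d_zbar (chern_connection H) z) = 0"
        using H trace_mul_sym[of "\<Phi> z" "h_adjoint (H z) (\<Phi> z)"]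
        by (simp add: hitchin_metric_def trace_sub)
      finally show ?thesis by simp
    qed
    show "\<exists>C. \<forall>\<^sub>F z in at_infinity. Re (s z) \<le> \<epsilon> * ln (norm z) + C" if \<epsilon>: "\<epsilon> > 0" for \<epsilon>
    proof -
      let ?n = "real CARD('n)"
      \<comment> \<open>The factor n in the denominator pays for the n factors of a Leibniz term,
        the factor 2 for the square in \<open>f\<close>.\<close>
      obtain C where C: "C \<ge> 1" "\<forall>\<^sub>F z in at_infinity. \<forall>i j.
          norm (H z $ i $ j) \<le> C * norm z powr (\<epsilon> / (2 * ?n) - a i - a j)"
        using hitchin_metric_entry_bound[OF H, of "\<epsilon> / (2 * ?n)"] \<epsilon> by auto
      define B where "B = fact (CARD('n)) * C ^ CARD('n)"
      have B: "B > 0" using C by (simp add: B_def)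
      have "\<forall>\<^sub>F z in at_infinity. norm (z :: complex) \<ge> 1"
        by (auto simp: eventually_at_infinity)
      with C(2) have "\<forall>\<^sub>F z in at_infinity. Re (s z) \<le> \<epsilon> * ln (norm z) + 2 * ln B"
      proof eventually_elim
        case (elim z)
        have z: "norm z > 0" using elim by linarith
        have "norm (?D z) \<le> B * norm z powr (?n * (\<epsilon> / (2 * ?n)))"
          unfolding B_def using elim z C(1) sum0 by (intro det_bound[where a = a]) auto
        also have "?n * (\<epsilon> / (2 * ?n)) = \<epsilon> / 2" by simp
        finally have "ln (norm (?D z)) \<le> ln (B * norm z powr (\<epsilon> / 2))"
          using D(1)[of z] by (subst ln_le_cancel_iff) (use B z in auto)
        also have "\<dots> = ln B + \<epsilon> / 2 * ln (norm z)"
          using B z by (simp add: ln_mult ln_powr)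
        finally show ?case
          using D(1)[of z] by (simp add: s_def norm_f ln_realpow)
      qed
      then show ?thesis by blast
    qed
  qed
  then have "exp (ln (Re (f z))) = exp (ln (Re (f 0)))"
    by (simp add: s_def)
  then have "(norm (?D z))\<^sup>2 = (norm (?D 0))\<^sup>2"
    using f norm_f by simp
  then show ?thesis by simp
qed

text \<open>Cramer's rule divides the minors by a determinant of constant modulus. Upper bounds on
  \<open>H\<close> thereby become upper bounds on its inverse, that is, lower bounds on the
  metric.\<close>

lemma hitchin_metric_inverse_bound:
  fixes H :: "complex \<Rightarrow> complex ^ 'n ^ 'n"
  assumes H: "hitchin_metric \<Phi> a H" and sum0: "(\<Sum>i\<in>UNIV. a i) = 0" and \<epsilon>: "\<epsilon> > 0"
  obtains C where "C > 0"
    and "\<forall>\<^sub>F z in at_infinity. \<forall>i j. norm (matrix_inv (H z) $ i $ j) \<le> C * norm z powr (\<epsilon> + a i + a j)"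
proof -
  have herm: "hermitian_metric H" using H by (simp add: hitchin_metric_def)
  let ?n = "real CARD('n)"
  obtain C where C: "C \<ge> 1" "\<forall>\<^sub>F z in at_infinity. \<forall>i j.
      norm (H z $ i $ j) \<le> C * norm z powr (\<epsilon> / ?n - a i - a j)"
    using hitchin_metric_entry_bound[OF H, of "\<epsilon> / ?n"] \<epsilon> by auto
  define D where "D = norm (det (H 0))"
  have D: "D > 0"
    using hermitian_metricD(4)[OF herm, of 0] by (simp add: D_def invertible_det_nz)
  define B where "B = fact (CARD('n)) * C ^ CARD('n)"
  have "\<forall>\<^sub>F z in at_infinity. norm (z :: complex) \<ge> 1"
    by (auto simp: eventually_at_infinity)
  with C(2) have "\<forall>\<^sub>F z in at_infinity. \<forall>i j.
      norm (matrix_inv (H z) $ i $ j) \<le> B / D * norm z powr (\<epsilon> + a i + a j)"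
  proof eventually_elim
    case (elim z)
    have "norm (matrix_inv (H z) $ i $ j) \<le> B / D * norm z powr (\<epsilon> + a i + a j)" for i j
    proof -
      let ?N = "\<chi> k l. if l = i then (if k = j then 1 else 0) else H z $ k $ l"
      have "norm (det ?N) \<le> B * norm z powr (?n * (\<epsilon> / ?n) + a i + a j)"
        unfolding B_def using elim C(1) sum0 \<epsilon> by (intro minor_bound[where a = a]) auto
      then have "norm (det ?N) / D \<le> B * norm z powr (\<epsilon> + a i + a j) / D"
        using D by (intro divide_right_mono) auto
      then show ?thesis
        using matrix_inv_entry[OF hermitian_metricD(4)[OF herm, of z], of i j]
          hitchin_metric_det_constant[OF H sum0, of z]
        by (simp add: norm_divide D_def)
    qed
    then show ?case by blast
  qed
  moreover have "B / D > 0" using C(1) D by (simp add: B_def)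
  ultimately show thesis using that by blast
qed

section \<open>Comparison of two solutions\<close>

lemma trace_mul_cycle: "trace (A ** B ** C) = trace (B ** C ** A)"
  for A :: "complex ^ 'n ^ 'm" and B :: "complex ^ 'l ^ 'n" and C :: "complex ^ 'm ^ 'l"
  using trace_mul_sym[of A "B ** C"] by (simp only: matrix_mul_assoc)

text \<open>Sesquilinear expansion, which completes the square when ln (tr g) is shown to be
  subharmonic.\<close>

lemma endo_form_scale_diff:
  fixes Y g :: "complex ^ 'n ^ 'n"
  shows "endo_form M H (Y - (\<chi> i j. c * g $ i $ j)) (Y - (\<chi> i j. c * g $ i $ j))
    = endo_form M H Y Y - cnj c * endo_form M H Y g - c * endo_form M H g Y
      + c * cnj c * endo_form M H g g"
proof -
  let ?c = "mat c :: complex ^ 'n ^ 'n"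
  have scale: "(\<chi> i j. c * g $ i $ j) = ?c ** g"
    by (simp add: vec_eq_iff mat_mult_nth)
  have l: "endo_form M H (mat d ** P) Q = d * endo_form M H P Q" for d P Q
    unfolding endo_form_def by (simp add: trace_mat_mult flip: matrix_mul_assoc)
  have r: "endo_form M H P (?c ** Q) = cnj c * endo_form M H P Q" for P Q
  proof -
    have "P ** M ** conj_transpose (?c ** Q) ** H = mat (cnj c) ** (P ** M ** conj_transpose Q ** H)"
      by (simp only: conj_transpose_mult conj_transpose_mat matrix_mul_assoc mat_central)
    then show ?thesis unfolding endo_form_def by (simp add: trace_mat_mult)
  qed
  have dl: "endo_form M H (P - Q) R = endo_form M H P R - endo_form M H Q R" for P Q R
    unfolding endo_form_def by (simp add: matrix_mul_diff_left trace_sub)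
  have dr: "endo_form M H R (P - Q) = endo_form M H R P - endo_form M H R Q" for P Q R
    unfolding endo_form_def by (simp add: matrix_mul_diff_left matrix_mul_diff_right conj_transpose_diff trace_sub)
  show ?thesis unfolding scale dl dr l r by (simp add: algebra_simps)
qed

text \<open>A Weitzenboeck identity: the right-hand side is \<open>|\<partial>\<^sub>z\<^sub>b\<^sub>a\<^sub>r g|\<^sup>2 + |[\<Phi>, g]|\<^sup>2\<close>, measured with \<open>H\<close> and \<open>H'\<close>.\<close>

lemma hitchin_comparison:
  fixes H H' :: "complex \<Rightarrow> complex ^ 'n ^ 'n"
  assumes H: "hitchin_metric \<Phi> a H" and H': "hitchin_metric \<Phi> a H'"
  defines "g \<equiv> \<lambda>z. matrix_inv (H z) ** H' z"
  shows "d_zbar (d_z (\<lambda>z. trace (g z))) z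
      = endo_form (matrix_inv (H' z)) (H z) (mat_d_zbar g z) (mat_d_zbar g z)
      + endo_form (matrix_inv (H' z)) (H z) (\<Phi> z ** g z - g z ** \<Phi> z) (\<Phi> z ** g z - g z ** \<Phi> z)"
proof -
  have herm: "hermitian_metric H" "hermitian_metric H'"
    using H H' by (simp_all add: hitchin_metric_def)
  note HD = hermitian_metricD[OF herm(1)] and HD' = hermitian_metricD[OF herm(2)]
  define J where "J z = matrix_inv (H z)" for z
  define J' where "J' z = matrix_inv (H' z)" for z
  have JH: "J z ** H z = mat 1" "H z ** J z = mat 1"
    and JH': "J' z ** H' z = mat 1" "H' z ** J' z = mat 1" for z
    using HD(4) HD'(4) by (simp_all add: J_def J'_def matrix_inv_matrix_mul matrix_mul_matrix_inv)
  have cancel: "A ** J z ** H z = A" "A ** H z ** J z = A" "A ** J' z ** H' z = A" "A ** H' z ** J' z = A"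
    for z and A :: "complex ^ 'n ^ 'n"
    using JH JH' by (simp_all flip: matrix_mul_assoc)
  have hermJ: "conj_transpose (J z) = J z" "conj_transpose (J' z) = J' z"
    "conj_transpose (H z) = H z" "conj_transpose (H' z) = H' z" for z
    using conj_transpose_matrix_inv[OF HD(4)[of z]] conj_transpose_matrix_inv[OF HD'(4)[of z]]
    by (simp_all add: J_def J'_def HD(3) HD'(3))
  have Ck: "mat_Ck k H" "mat_Ck k H'" "mat_Ck k J" "mat_Ck k J'" for k
    unfolding J_def[abs_def] J'_def[abs_def] by (intro mat_Ck_matrix_inv HD HD')+
  have g: "g = (\<lambda>z. J z ** H' z)" by (simp add: g_def J_def)
  have Ckg: "mat_Ck k g" for k unfolding g by (intro mat_Ck_mult Ck)
  define A where "A = chern_connection H"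
  define A' where "A' = chern_connection H'"
  have CkA: "mat_Ck k A" "mat_Ck k A'" for k
    unfolding A_def A'_def by (intro mat_Ck_chern_connection herm)+
  have A: "A z = J z ** mat_d_z H z" "A' z = J' z ** mat_d_z H' z" for z
    by (simp_all add: A_def A'_def J_def J'_def chern_connection_def mat_d_z_def)
  have dJ: "mat_d_z J z = - (J z ** mat_d_z H z ** J z)" for z
    unfolding J_def[abs_def] by (rule mat_d_z_matrix_inv[OF Ck(1) HD(4)])
  \<comment> \<open>The two Chern connections act on \<open>g\<close> from either side, and the
    (1,0) part of the covariant derivative of \<open>g\<close> vanishes because \<open>g\<close>
    compares their metrics.\<close>
  have dg: "mat_d_z g z = g z ** A' z - A z ** g z" for z
    unfolding g A
    by (subst mat_d_z_mult[OF Ck(3,2)]) (simp add: dJ matrix_mul_uminus_left matrix_mul_assoc cancel)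
  define Y where "Y = mat_d_zbar g"
  define X where "X z = \<Phi> z ** g z - g z ** \<Phi> z" for z
  define S where "S z = h_adjoint (H z) (\<Phi> z)" for z
  define S' where "S' z = h_adjoint (H' z) (\<Phi> z)" for z
  have dA: "mat_d_zbar A z = \<Phi> z ** S z - S z ** \<Phi> z"
    "mat_d_zbar A' z = \<Phi> z ** S' z - S' z ** \<Phi> z" for z
    using H H' by (simp_all add: hitchin_metric_def A_def A'_def S_def S'_def)
  have "d_z (\<lambda>z. trace (g z)) = (\<lambda>z. trace (g z ** A' z - A z ** g z))"
    using d_z_trace[OF Ckg] by (auto simp: dg)
  then have "d_zbar (d_z (\<lambda>z. trace (g z))) z
      = trace (mat_d_zbar (\<lambda>z. g z ** A' z - A z ** g z) z)"
    by (simp only:) (intro d_zbar_trace mat_Ck_diff mat_Ck_mult Ckg CkA)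
  also have "mat_d_zbar (\<lambda>z. g z ** A' z - A z ** g z) z
      = (Y z ** A' z + g z ** mat_d_zbar A' z) - (mat_d_zbar A z ** g z + A z ** Y z)"
    by (simp add: mat_d_zbar_diff mat_d_zbar_mult mat_Ck_mult Ckg CkA Y_def)
  \<comment> \<open>By cyclicity of the trace, tr (g [\<Phi>, S'] - [\<Phi>, S] g) = tr ([\<Phi>, g]
    (S - S')).\<close>
  also have "trace \<dots> = trace (Y z ** (A' z - A z)) + trace (X z ** (S z - S' z))"
    using trace_mul_sym[of "A z" "Y z"] trace_mul_cycle[of "g z" "S' z" "\<Phi> z"]
      trace_mul_cycle[of "g z" "S z" "\<Phi> z"] trace_mul_cycle[of "\<Phi> z" "g z" "S z"]
      trace_mul_cycle[of "\<Phi> z" "g z" "S' z"] trace_mul_cycle[of "g z" "\<Phi> z" "S z"]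
      trace_mul_cycle[of "S z" "\<Phi> z" "g z"]
    by (simp add: trace_add trace_sub X_def dA matrix_mul_diff_left matrix_mul_diff_right matrix_mul_assoc)
  \<comment> \<open>The connections differ by the adjoint of \<open>Y\<close> in the sense of
    \<open>endo_form\<close>, so the first trace is a squared norm.\<close>
  also have "A' z - A z = J' z ** conj_transpose (Y z) ** H z"
  proof -
    have "conj_transpose (Y z) = mat_d_z (\<lambda>z. conj_transpose (g z)) z"
      unfolding Y_def by (rule mat_d_z_conj_transpose[OF Ckg, symmetric])
    also have "(\<lambda>z. conj_transpose (g z)) = (\<lambda>z. H' z ** J z)"
      by (simp add: g conj_transpose_mult hermJ)
    also have "mat_d_z (\<lambda>z. H' z ** J z) z
        = mat_d_z H' z ** J z - H' z ** J z ** mat_d_z H z ** J z"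
      by (simp add: mat_d_z_mult Ck dJ matrix_mul_uminus_right matrix_mul_assoc)
    finally have "J' z ** conj_transpose (Y z) ** H z
        = J' z ** mat_d_z H' z ** J z ** H z - J' z ** H' z ** J z ** mat_d_z H z ** J z ** H z"
      by (simp only: matrix_mul_diff_left matrix_mul_diff_right matrix_mul_assoc)
    then show ?thesis by (simp add: cancel JH' A)
  qed
  \<comment> \<open>Likewise the two adjoints of the Higgs field differ by the adjoint of its
    commutator with \<open>g\<close>.\<close>
  also have "S z - S' z = J' z ** conj_transpose (X z) ** H z"
  proof -
    have "conj_transpose (X z) = H' z ** J z ** conj_transpose (\<Phi> z) - conj_transpose (\<Phi> z) ** H' z ** J z"
      by (simp add: X_def g conj_transpose_diff conj_transpose_mult hermJ matrix_mul_assoc)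
    then have "J' z ** conj_transpose (X z) ** H z = J' z ** H' z ** J z ** conj_transpose (\<Phi> z) ** H z
        - J' z ** conj_transpose (\<Phi> z) ** H' z ** J z ** H z"
      by (simp only: matrix_mul_diff_left matrix_mul_diff_right matrix_mul_assoc)
    then show ?thesis
      by (simp add: cancel JH' S_def S'_def h_adjoint_def J_def[symmetric] J'_def[symmetric])
  qed
  finally show ?thesis
    by (simp add: endo_form_def Y_def X_def J'_def matrix_mul_assoc)
qed

text \<open>For the form \<open>?E\<close> one has tr P = <P, g> and tr g = <g, g>, so the term
  subtracted on passing from tr g to its logarithm is absorbed by Cauchy-Schwarz. The defect is the
  squared norm of the part of \<partial>_zbar g orthogonal to g. Once the Laplacian of ln (tr g) is
  known to vanish, both this part and the commutator with the Higgs field are zero.\<close>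

lemma hitchin_comparison_rigid:
  fixes H H' :: "complex \<Rightarrow> complex ^ 'n ^ 'n"
  assumes H: "hitchin_metric \<Phi> a H" and H': "hitchin_metric \<Phi> a H'"
    and sum0: "(\<Sum>i\<in>UNIV. a i) = 0"
  defines "g \<equiv> \<lambda>z. matrix_inv (H z) ** H' z"
  shows "mat_d_zbar g z = 0" and "\<Phi> z ** g z = g z ** \<Phi> z"
    and "trace (g z) = trace (g 0)" and "mat_Ck k g"
    and "\<epsilon> > 0 \<Longrightarrow> \<exists>C. \<forall>\<^sub>F z in at_infinity. \<forall>i j. norm (g z $ i $ j) \<le> C * norm z powr (\<epsilon> + a i - a j)"
proof -
  have herm: "hermitian_metric H" "hermitian_metric H'"
    using H H' by (simp_all add: hitchin_metric_def)
  note HD = hermitian_metricD[OF herm(1)] and HD' = hermitian_metricD[OF herm(2)]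
  show Ckg: "mat_Ck k g" for k
    unfolding g_def by (intro mat_Ck_mult mat_Ck_matrix_inv HD HD')
  show growth: "\<exists>C. \<forall>\<^sub>F z in at_infinity. \<forall>i j. norm (g z $ i $ j) \<le> C * norm z powr (\<epsilon> + a i - a j)"
    if \<epsilon>: "\<epsilon> > 0" for \<epsilon>
  proof -
    obtain C where C: "C > 0" "\<forall>\<^sub>F z in at_infinity. \<forall>i j.
        norm (matrix_inv (H z) $ i $ j) \<le> C * norm z powr (\<epsilon> / 2 + a i + a j)"
      using hitchin_metric_inverse_bound[OF H sum0, of "\<epsilon> / 2"] \<epsilon> by auto
    obtain C' where C': "C' \<ge> 1" "\<forall>\<^sub>F z in at_infinity. \<forall>i j.
        norm (H' z $ i $ j) \<le> C' * norm z powr (\<epsilon> / 2 - a i - a j)"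
      using hitchin_metric_entry_bound[OF H', of "\<epsilon> / 2"] \<epsilon> by auto
    from C(2) C'(2) have "\<forall>\<^sub>F z in at_infinity. \<forall>i j.
        norm (g z $ i $ j) \<le> CARD('n) * (C * C') * norm z powr (\<epsilon> + a i - a j)"
    proof eventually_elim
      case (elim z)
      show ?case
      proof (intro allI)
        fix i j
        have "norm (g z $ i $ j) \<le> (\<Sum>k\<in>UNIV. norm (matrix_inv (H z) $ i $ k * H' z $ k $ j))"
          unfolding g_def matrix_matrix_mult_def by (simp add: norm_sum)
        also have "\<dots> \<le> (\<Sum>k\<in>(UNIV :: 'n set). C * C' * norm z powr (\<epsilon> + a i - a j))"
        proof (intro sum_mono)
          fix k
          have "norm (matrix_inv (H z) $ i $ k * H' z $ k $ j)
              \<le> (C * norm z powr (\<epsilon> / 2 + a i + a k)) * (C' * norm z powr (\<epsilon> / 2 - a k - a j))"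
            unfolding norm_mult using elim C(1) by (intro mult_mono) auto
          also have "\<dots> = C * C' * norm z powr ((\<epsilon> / 2 + a i + a k) + (\<epsilon> / 2 - a k - a j))"
            by (simp only: powr_add mult_ac)
          also have "(\<epsilon> / 2 + a i + a k) + (\<epsilon> / 2 - a k - a j) = \<epsilon> + a i - a j" by simp
          finally show "norm (matrix_inv (H z) $ i $ k * H' z $ k $ j) \<le> C * C' * norm z powr (\<epsilon> + a i - a j)" .
        qed
        also have "\<dots> = CARD('n) * (C * C') * norm z powr (\<epsilon> + a i - a j)" by simp
        finally show "norm (g z $ i $ j) \<le> CARD('n) * (C * C') * norm z powr (\<epsilon> + a i - a j)" .
      qed
    qed
    then show ?thesis by blast
  qed
  let ?E = "\<lambda>z. endo_form (matrix_inv (H' z)) (H z)"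
  have E_real: "?E z P P \<in> \<real>" and E_nonneg: "Re (?E z P P) \<ge> 0"
    and E_0: "Re (?E z P P) = 0 \<Longrightarrow> P = 0" for z P
  proof -
    note pd = positive_definite_matrix_inv[OF HD'(2)[of z]] HD(2)[of z]
    show "?E z P P \<in> \<real>" by (rule endo_form_real[OF pd])
    show "Re (?E z P P) \<ge> 0" by (rule endo_form_nonneg[OF pd])
    show "P = 0" if "Re (?E z P P) = 0" using endo_form_eq_0D[OF pd that] .
  qed
  define Y where "Y = mat_d_zbar g"
  define X where "X z = \<Phi> z ** g z - g z ** \<Phi> z" for z
  define f where "f z = trace (g z)" for z
  have g_adj: "conj_transpose (g z) = H' z ** matrix_inv (H z)" for z
    using conj_transpose_matrix_inv[OF HD(4)[of z]] by (simp add: g_def conj_transpose_mult HD(3) HD'(3))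
  \<comment> \<open>The trace is the product with \<open>g\<close>; in particular tr g is the
    squared norm of \<open>g\<close>, hence positive.\<close>
  have E_right: "?E z P (g z) = trace P" for z P
  proof -
    have "P ** matrix_inv (H' z) ** conj_transpose (g z) ** H z
        = P ** (matrix_inv (H' z) ** H' z) ** (matrix_inv (H z) ** H z)"
      by (simp only: g_adj matrix_mul_assoc)
    then show ?thesis
      by (simp add: endo_form_def matrix_inv_matrix_mul HD HD')
  qed
  have E_left: "?E z (g z) P = cnj (trace P)" for z P
  proof -
    have "g z ** matrix_inv (H' z) ** conj_transpose P ** H z
        = matrix_inv (H z) ** (H' z ** matrix_inv (H' z)) ** conj_transpose P ** H z"
      by (simp only: g_def matrix_mul_assoc)
    then have "?E z (g z) P = trace (matrix_inv (H z) ** conj_transpose P ** H z)"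
      by (simp add: endo_form_def matrix_mul_matrix_inv HD HD')
    also have "\<dots> = trace (conj_transpose P ** (H z ** matrix_inv (H z)))"
      using trace_mul_cycle[of "matrix_inv (H z)" "conj_transpose P" "H z"]
      by (simp only: matrix_mul_assoc)
    finally show ?thesis by (simp add: matrix_mul_matrix_inv HD trace_conj_transpose)
  qed
  have f_eq: "f z = ?E z (g z) (g z)" for z
    by (simp add: E_right f_def)
  have f_real: "f z \<in> \<real>" for z
    unfolding f_eq by (rule E_real)
  have f_pos: "Re (f z) > 0" for z
  proof -
    have "g z \<noteq> 0"
    proof
      assume "g z = 0"
      then have "H z ** g z = 0" by (simp add: vec_eq_iff matrix_matrix_mult_def)
      then have "H' z = 0"
        by (simp add: g_def matrix_mul_assoc matrix_mul_matrix_inv HD)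
      then have "det (H' z) = 0"
        by (metis det_0 mat_0)
      then show False using HD'(4)[of z] by (simp add: invertible_det_nz)
    qed
    then have "Re (?E z (g z) (g z)) \<noteq> 0" using E_0 by blast
    then show ?thesis using E_nonneg[of z "g z"] by (simp add: f_eq)
  qed
  have f_nz: "f z \<noteq> 0" for z using f_pos[of z] by auto
  have Ckf: "Ck k f" for k
    unfolding f_def[abs_def] by (intro Ck_trace Ckg)
  have df: "d_zbar f z = trace (Y z)" "d_z f z = cnj (trace (Y z))" for z
  proof -
    show *: "d_zbar f z = trace (Y z)" for z
      unfolding f_def[abs_def] Y_def by (rule d_zbar_trace[OF Ckg])
    show "d_z f z = cnj (trace (Y z))"
      using d_z_cnj[OF Ck_Suc_differentiable[OF Ckf], of z] f_real by (simp add: Reals_cnj_iff *)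
  qed
  \<comment> \<open>The component of \<partial>_zbar g orthogonal to \<open>g\<close> with respect
    to \<open>?E\<close>.\<close>
  define P where "P z = Y z - (\<chi> i j. trace (Y z) / f z * g z $ i $ j)" for z
  define s where "s z = complex_of_real (ln (Re (f z)))" for z
  have Cks: "Ck k s" for k
    unfolding s_def[abs_def] by (intro Ck_of_real_ln Ckf f_pos)
  have laplace: "d_zbar (d_z s) z = (?E z (P z) (P z) + ?E z (X z) (X z)) / f z" for z
  proof -
    have "d_z s z = d_z f z / f z" for z
      unfolding s_def[abs_def]
      by (intro d_z_ln f_real f_pos Ck_Suc_differentiable[OF Ckf])
    then have ds: "d_z s z * f z = d_z f z" for z using f_nz by simp
    then have "d_zbar (\<lambda>z. d_z s z * f z) z = d_zbar (d_z f) z" by (simp only:)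
    then have "d_zbar (d_z s) z * f z + d_z s z * d_zbar f z = d_zbar (d_z f) z"
      by (subst (asm) d_zbar_mult)
         (auto intro: Ck_Suc_differentiable[OF Ck_d_z[OF Cks]] Ck_Suc_differentiable[OF Ckf])
    also have "d_zbar (d_z f) z = ?E z (Y z) (Y z) + ?E z (X z) (X z)"
      unfolding f_def[abs_def] Y_def X_def g_def by (rule hitchin_comparison[OF H H'])
    finally have "d_zbar (d_z s) z * f z
        = ?E z (Y z) (Y z) - d_z s z * d_zbar f z + ?E z (X z) (X z)"
      by (simp add: algebra_simps)
    also have "?E z (Y z) (Y z) - d_z s z * d_zbar f z = ?E z (P z) (P z)"
    proof -
      have "cnj (f z) = f z" using f_real Reals_cnj_iff by blast
      moreover have "d_z s z = cnj (trace (Y z)) / f z"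
        using ds[of z] f_nz[of z] by (simp add: df field_simps)
      ultimately show ?thesis
        unfolding P_def endo_form_scale_diff E_left E_right df
        using f_nz[of z] by (simp add: f_def[symmetric])
    qed
    finally show ?thesis using f_nz[of z] by (simp add: field_simps)
  qed
  have Re_laplace: "Re (d_zbar (d_z s) z)
      = (Re (?E z (P z) (P z)) + Re (?E z (X z) (X z))) / Re (f z)" for z
  proof -
    have "f z = of_real (Re (f z))" using f_real by simp
    then show ?thesis unfolding laplace by (metis Re_divide_of_real plus_complex.sel(1))
  qed
  have growth_s: "\<exists>C. \<forall>\<^sub>F z in at_infinity. Re (s z) \<le> \<epsilon> * ln (norm z) + C" if \<epsilon>: "\<epsilon> > 0" for \<epsilon>
  proof -
    obtain C where C: "\<forall>\<^sub>F z in at_infinity. \<forall>i j. norm (g z $ i $ j) \<le> C * norm z powr (\<epsilon> + a i - a j)"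
      using growth[OF \<epsilon>] by blast
    have "\<forall>\<^sub>F z in at_infinity. norm (z :: complex) \<ge> 1"
      by (auto simp: eventually_at_infinity)
    with C have "\<forall>\<^sub>F z in at_infinity. Re (s z) \<le> \<epsilon> * ln (norm z) + ln (CARD('n) * C)"
    proof eventually_elim
      case (elim z)
      have z: "norm z > 0" using elim by linarith
      have "Re (f z) \<le> norm (f z)" by (rule complex_Re_le_cmod)
      also have "norm (f z) \<le> (\<Sum>i\<in>UNIV. norm (g z $ i $ i))"
        unfolding f_def trace_def by (rule norm_sum)
      also have "\<dots> \<le> (\<Sum>i\<in>(UNIV :: 'n set). C * norm z powr (\<epsilon> + a i - a i))"
        using elim by (intro sum_mono) blast
      finally have le: "Re (f z) \<le> CARD('n) * C * norm z powr \<epsilon>" by simp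
      with f_pos[of z] have "CARD('n) * C * norm z powr \<epsilon> > 0" by linarith
      then have C: "CARD('n) * C > 0" using z by (simp add: zero_less_mult_iff)
      have "ln (Re (f z)) \<le> ln (CARD('n) * C * norm z powr \<epsilon>)"
        using le f_pos[of z] by simp
      also have "\<dots> = ln (CARD('n) * C) + \<epsilon> * ln (norm z)"
        using C z by (subst ln_mult) (auto simp: ln_powr)
      finally show ?case by (simp add: s_def)
    qed
    then show ?thesis by blast
  qed
  have zero: "Re (d_zbar (d_z s) z) = 0" for z
  proof (rule Re_d_zbar_d_z_eq_0[OF Cks _ _ growth_s])
    show "s z \<in> \<real>" for z by (simp add: s_def)
    show "Re (d_zbar (d_z s) z) \<ge> 0" for z
      unfolding Re_laplace using E_nonneg f_pos[of z] by (simp add: less_imp_le)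
  qed
  have "Re (?E z (P z) (P z)) + Re (?E z (X z) (X z)) = 0" for z
    using zero[of z] f_pos[of z] unfolding Re_laplace by auto
  then have "Re (?E z (P z) (P z)) = 0" "Re (?E z (X z) (X z)) = 0" for z
    using E_nonneg[of z "P z"] E_nonneg[of z "X z"] by (smt (verit))+
  then have P0: "P z = 0" and X0: "X z = 0" for z
    using E_0 by blast+
  show "\<Phi> z ** g z = g z ** \<Phi> z" using X0[of z] by (simp add: X_def)
  have "s z = s 0" for z
  proof (rule harmonic_constant[OF Cks _ _ growth_s])
    show "s z \<in> \<real>" for z by (simp add: s_def)
    show "d_zbar (d_z s) z = 0" for z
      unfolding laplace by (simp add: P0 X0 endo_form_def trace_def matrix_matrix_mult_def)
  qed
  then have "exp (ln (Re (f z))) = exp (ln (Re (f 0)))" for z by (simp add: s_def)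
  then have "Re (f z) = Re (f 0)" for z using f_pos by simp
  then have f_const: "f z = f 0" for z
    using f_real by (simp add: complex_eq_iff complex_is_Real_iff)
  then show "trace (g z) = trace (g 0)" by (simp add: f_def)
  \<comment> \<open>With tr g constant, \<open>Y\<close> has trace zero and therefore equals its
    orthogonal component \<open>P\<close>, already known to vanish.\<close>
  have "f = (\<lambda>_. f 0)" using f_const by auto
  then have "trace (Y z) = 0"
    using df(1)[of z] d_zbar_const[of "f 0" z] by metis
  then show "mat_d_zbar g z = 0"
    using P0[of z] by (simp add: P_def Y_def vec_eq_iff)
qed

section \<open>Symmetry of the cyclic Higgs bundle\<close>

lemma mod_ring_eq_of_nat: "\<exists>m. (i :: 'k::nontriv mod_ring) = of_nat m"
proof -
  have "to_int_mod_ring i \<ge> 0"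
    using range_to_int_mod_ring[where 'a = 'k] by (metis atLeastLessThan_iff rangeI)
  then have "i = of_nat (nat (to_int_mod_ring i))"
    by (metis of_int_mod_ring_to_int_mod_ring of_int_of_int_mod_ring of_int_of_nat_eq int_nat_eq)
  then show ?thesis ..
qed

lemma mod_ring_induct:
  fixes i j :: "'k::nontriv mod_ring"
  assumes "P i" and "\<And>l. P l \<Longrightarrow> P (l + 1)"
  shows "P j"
proof -
  obtain m where m: "j - i = of_nat m" using mod_ring_eq_of_nat by blast
  have "P (i + of_nat m)"
  proof (induction m)
    case (Suc m)
    then have "P (i + of_nat m + 1)" by (rule assms(2))
    then show ?case by (simp add: add_ac)
  qed (use assms(1) in simp)
  then show ?thesis by (simp flip: m)
qed

lemma sum_mod_ring_shift: "(\<Sum>i\<in>UNIV. f (i + c)) = (\<Sum>i\<in>UNIV. f i)" for c :: "'k::nontriv mod_ring"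
  by (rule sum.reindex_bij_witness[of _ "\<lambda>i. i - c" "\<lambda>i. i + c"]) auto

text \<open>Telescoping over the m steps from i to j gives a_i - a_j = - m N / K modulo integers,
  because each \<open>b\<close> is an integer. If this is an integer, K divides m N, and coprimality
  makes K divide m.\<close>

lemma filtration_weights_incongruent:
  fixes a :: "'k::nontriv mod_ring \<Rightarrow> real" and b :: "'k mod_ring \<Rightarrow> nat"
  assumes "coprime CARD('k) N"
    and a: "\<And>i. real (b i) - real N / real CARD('k) = a i - a (i + 1)"
    and "a i - a j \<in> \<int>"
  shows "i = j"
proof -
  obtain m where m: "j - i = of_nat m" using mod_ring_eq_of_nat by blast
  have "a i - a (i + of_nat l) + real l * real N / real CARD('k) \<in> \<int>" for l
  proof (induction l)
    case (Suc l)
    have "a i - a (i + of_nat (Suc l)) + real (Suc l) * real N / real CARD('k)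
      = a i - a (i + of_nat l) + real l * real N / real CARD('k) + real (b (i + of_nat l))"
      using a[of "i + of_nat l"] by (simp add: add_divide_distrib algebra_simps)
    then show ?case using Suc by (simp only: Ints_add Ints_of_nat)
  qed simp
  from Ints_diff[OF this[of m] assms(3)] have "real m * real N / real CARD('k) \<in> \<int>"
    by (simp flip: m)
  then obtain n where "real m * real N / real CARD('k) = of_int n" by (elim Ints_cases)
  then have "real_of_int (int m * int N) = real_of_int (n * int CARD('k))"
    by (simp add: field_simps)
  then have "int m * int N = n * int CARD('k)" by (simp only: of_int_eq_iff)
  then have "int CARD('k) dvd int (m * N)" by simp
  then have "CARD('k) dvd m"
    using assms(1) by (simp add: coprime_dvd_mult_left_iff del: of_nat_mult)
  then have "(of_nat m :: 'k mod_ring) = 0"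
    by (simp add: of_nat_eq_0_iff_char_dvd)
  with m show ?thesis by simp
qed

section \<open>Invariance of the Higgs term under phases and constant unitary frames; the circle
  action\<close>

definition higgs_commutator :: "complex ^ 'n ^ 'n \<Rightarrow> complex ^ 'n ^ 'n \<Rightarrow> complex ^ 'n ^ 'n" where
  "higgs_commutator M F = F ** h_adjoint M F - h_adjoint M F ** F"

lemma higgs_commutator_scale:
  fixes F M :: "complex ^ 'n ^ 'n"
  assumes "\<kappa> * cnj \<kappa> = 1"
  shows "higgs_commutator M (mat \<kappa> ** F) = higgs_commutator M F"
proof -
  have central: "A ** (mat d ** B) = mat d ** (A ** B)" for d and A B :: "complex ^ 'n ^ 'n"
    by (simp only: matrix_mul_assoc mat_central)
  have "conj_transpose (mat \<kappa> ** F) = mat (cnj \<kappa>) ** conj_transpose F"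
    unfolding conj_transpose_mult conj_transpose_mat by (rule mat_central)
  then have h: "h_adjoint M (mat \<kappa> ** F) = mat (cnj \<kappa>) ** h_adjoint M F"
    unfolding h_adjoint_def by (simp only: matrix_mul_assoc mat_central)
  have "mat \<kappa> ** F ** (mat (cnj \<kappa>) ** h_adjoint M F) = mat (cnj \<kappa>) ** (mat \<kappa> ** F ** h_adjoint M F)"
    by (rule central)
  moreover have "mat (cnj \<kappa>) ** h_adjoint M F ** (mat \<kappa> ** F) = mat \<kappa> ** (mat (cnj \<kappa>) ** h_adjoint M F ** F)"
    by (rule central)
  ultimately show ?thesis
    unfolding higgs_commutator_def h using assms by (simp add: matrix_mul_assoc mat_mult_mat mult.commute[of "cnj \<kappa>"])
qed

lemma matrix_inv_unitary_congruence:
  fixes T M :: "complex ^ 'n ^ 'n"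
  assumes T: "T ** conj_transpose T = mat 1" and M: "invertible M"
  shows "matrix_inv (conj_transpose T ** M ** T) = conj_transpose T ** matrix_inv M ** T"
proof (rule matrix_inv_unique)
  have T': "conj_transpose T ** T = mat 1" using T matrix_left_right_inverse by blast
  have "conj_transpose T ** matrix_inv M ** T ** (conj_transpose T ** M ** T)
      = conj_transpose T ** (matrix_inv M ** (T ** conj_transpose T) ** M) ** T"
    by (simp only: matrix_mul_assoc)
  then show "conj_transpose T ** matrix_inv M ** T ** (conj_transpose T ** M ** T) = mat 1"
    by (simp add: T T' matrix_inv_matrix_mul[OF M])
qed

lemma higgs_commutator_unitary_congruence:
  fixes T M F :: "complex ^ 'n ^ 'n"
  assumes T: "T ** conj_transpose T = mat 1" and M: "invertible M"
  shows "higgs_commutator (conj_transpose T ** M ** T) (conj_transpose T ** F ** T)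
    = conj_transpose T ** higgs_commutator M F ** T"
proof -
  have c: "A ** T ** conj_transpose T = A" for A :: "complex ^ 'n ^ 'n"
    using T by (simp flip: matrix_mul_assoc)
  have h: "h_adjoint (conj_transpose T ** M ** T) (conj_transpose T ** F ** T)
    = conj_transpose T ** h_adjoint M F ** T"
    unfolding h_adjoint_def matrix_inv_unitary_congruence[OF assms]
    by (simp add: conj_transpose_mult matrix_mul_assoc c)
  show ?thesis
    unfolding higgs_commutator_def h
    by (simp add: matrix_mul_diff_left matrix_mul_diff_right matrix_mul_assoc c)
qed

definition diag_matrix :: "('n \<Rightarrow> complex) \<Rightarrow> complex ^ 'n ^ 'n" where
  "diag_matrix t = (\<chi> i j. if i = j then t i else 0)"

lemma diag_matrix_mult: "(diag_matrix t ** A) $ i $ j = t i * A $ i $ j"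
  and mult_diag_matrix: "(B ** diag_matrix t) $ l $ i = B $ l $ i * t i"
  for A :: "complex ^ 'm ^ 'n" and B :: "complex ^ 'n ^ 'm"
  by (simp_all add: diag_matrix_def matrix_matrix_mult_def if_distrib[where f = "\<lambda>x. x * _"]
      if_distrib[where f = "\<lambda>x. _ * x"] cong: if_cong)

lemma conj_transpose_diag_matrix: "conj_transpose (diag_matrix t) = diag_matrix (\<lambda>i. cnj (t i))"
  by (auto simp: diag_matrix_def conj_transpose_def vec_eq_iff)

text \<open>The circle acts by rotating \<open>z\<close>, multiplying the Higgs field by a phase, and the constant gauge
  transformation with weights \<open>a\<close>.\<close>

lemma hitchin_metric_rotate:
  fixes a :: "'k::nontriv mod_ring \<Rightarrow> real" and b :: "'k mod_ring \<Rightarrow> nat" and \<theta> :: real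
  assumes H: "hitchin_metric (higgs_field b) a H"
    and a: "\<And>i. real (b i) - \<beta> = a i - a (i + 1)"
  defines "T \<equiv> diag_matrix (\<lambda>i. cis (\<theta> * a i))"
  shows "hitchin_metric (higgs_field b) a (\<lambda>z. conj_transpose T ** H (cis \<theta> * z) ** T)"
    (is "hitchin_metric _ _ ?H'")
proof -
  have herm: "hermitian_metric H" using H by (simp add: hitchin_metric_def)
  note HD = hermitian_metricD[OF herm]
  let ?\<rho> = "\<lambda>z. cis \<theta> * z"
  have \<rho>: "?\<rho> holomorphic_on UNIV" "(?\<rho> has_field_derivative cis \<theta>) (at z)" for z
    by (auto intro!: holomorphic_intros derivative_eq_intros)
  have T: "T ** conj_transpose T = mat 1"
    unfolding T_def conj_transpose_diag_matrix
    by (auto simp: vec_eq_iff diag_matrix_mult) (auto simp: diag_matrix_def mat_def cis_cnj cis_mult)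
  have T': "conj_transpose T ** T = mat 1" using T matrix_left_right_inverse by blast
  have Tentry: "(conj_transpose T ** M ** T) $ i $ j = cis (\<theta> * (a j - a i)) * M $ i $ j" for M i j
    unfolding T_def conj_transpose_diag_matrix
    by (simp add: mult_diag_matrix diag_matrix_mult cis_cnj mult_ac cis_mult[symmetric] right_diff_distrib
        flip: cis_mult) (simp add: cis_mult mult.left_commute flip: mult.assoc)
  have comp: "mat_Ck k (\<lambda>z. F (cis \<theta> * z))" if "mat_Ck k F"
    for k and F :: "complex \<Rightarrow> complex ^ 'k mod_ring ^ 'k mod_ring"
    using that Ck_compose_holomorphic[OF \<rho>(1)] by (auto simp: mat_Ck_def)
  have CkH': "mat_Ck k ?H'" for k
    by (intro mat_Ck_mult mat_Ck_const comp HD)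
  have herm': "hermitian_metric ?H'"
    unfolding hermitian_metric_def
  proof (intro conjI allI impI)
    show "smooth (\<lambda>z. ?H' z $ i $ j)" for i j
      using CkH' by (auto simp: smooth_def mat_Ck_def)
    show "conj_transpose (?H' z) = ?H' z" for z
      by (simp add: conj_transpose_mult HD matrix_mul_assoc)
    show "Re (hprod (?H' z) v v) > 0" if "v \<noteq> 0" for z v
    proof -
      have "conj_transpose T *v (T *v v) = v" by (simp add: matrix_vector_mul_assoc T')
      then have "T *v v \<noteq> 0" using that by auto
      then show ?thesis
        using HD(2)[of "?\<rho> z"]
        by (simp add: hprod_mult_right[of "conj_transpose T ** _"] hprod_mult_left[of "conj_transpose T"] positive_definite_def)
    qed
  qed
  \<comment> \<open>The rotation is holomorphic with derivative \<open>cis \<theta>\<close>. The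
    factors from \<open>d_z\<close> and \<open>d_zbar\<close> are conjugate phases and cancel in the
    curvature.\<close>
  have dz: "mat_d_z (\<lambda>z. conj_transpose T ** F (?\<rho> z) ** T) z $ i $ j
        = cis \<theta> * (conj_transpose T ** mat_d_z F (?\<rho> z) ** T) $ i $ j"
      "mat_d_zbar (\<lambda>z. conj_transpose T ** F (?\<rho> z) ** T) z $ i $ j
        = cnj (cis \<theta>) * (conj_transpose T ** mat_d_zbar F (?\<rho> z) ** T) $ i $ j"
    if F: "mat_Ck (Suc 0) F" for F z i j
  proof -
    have d: "(\<lambda>w. F w $ i $ j) differentiable (at w)" for w
      by (rule mat_Ck_Suc_differentiable[OF F])
    have d': "(\<lambda>w. F (?\<rho> w) $ i $ j) differentiable (at z)"
      using comp[OF F] by (rule mat_Ck_Suc_differentiable)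
    show "mat_d_z (\<lambda>z. conj_transpose T ** F (?\<rho> z) ** T) z $ i $ j
        = cis \<theta> * (conj_transpose T ** mat_d_z F (?\<rho> z) ** T) $ i $ j"
      unfolding Tentry using d_z_compose[OF d \<rho>(2)]
      by (simp add: mat_d_z_def Tentry d_z_cmult[OF d'])
    show "mat_d_zbar (\<lambda>z. conj_transpose T ** F (?\<rho> z) ** T) z $ i $ j
        = cnj (cis \<theta>) * (conj_transpose T ** mat_d_zbar F (?\<rho> z) ** T) $ i $ j"
      unfolding Tentry using d_zbar_compose[OF d \<rho>(2)]
      by (simp add: mat_d_zbar_def Tentry d_zbar_cmult[OF d'])
  qed
  let ?A = "chern_connection H"
  have A: "?A w = matrix_inv (H w) ** mat_d_z H w" for w
    by (simp add: chern_connection_def mat_d_z_def)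
  have A': "chern_connection ?H' z = mat (cis \<theta>) ** (conj_transpose T ** ?A (?\<rho> z) ** T)" for z
  proof -
    have "mat_d_z ?H' z = mat (cis \<theta>) ** (conj_transpose T ** mat_d_z H (?\<rho> z) ** T)"
      by (simp add: vec_eq_iff dz(1)[OF HD(1)] mat_mult_nth)
    moreover have "A ** (mat d ** B) = mat d ** (A ** B)" for d and A B :: "complex ^ 'k mod_ring ^ 'k mod_ring"
      by (simp only: matrix_mul_assoc mat_central)
    ultimately have "chern_connection ?H' z = mat (cis \<theta>) **
        (conj_transpose T ** matrix_inv (H (?\<rho> z)) ** T ** (conj_transpose T ** mat_d_z H (?\<rho> z) ** T))"
      by (simp add: chern_connection_def mat_d_z_def[symmetric] matrix_inv_unitary_congruence[OF T HD(4)])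
    also have "conj_transpose T ** matrix_inv (H (?\<rho> z)) ** T ** (conj_transpose T ** mat_d_z H (?\<rho> z) ** T)
        = conj_transpose T ** (matrix_inv (H (?\<rho> z)) ** (T ** conj_transpose T) ** mat_d_z H (?\<rho> z)) ** T"
      by (simp only: matrix_mul_assoc)
    finally show ?thesis by (simp add: T A)
  qed
  have Ck_A: "mat_Ck k ?A" for k by (rule mat_Ck_chern_connection[OF herm])
  have curv: "mat_d_zbar (chern_connection ?H') z = conj_transpose T ** mat_d_zbar ?A (?\<rho> z) ** T" for z
  proof -
    have "mat_d_zbar (chern_connection ?H') z $ i $ j
        = (conj_transpose T ** mat_d_zbar ?A (?\<rho> z) ** T) $ i $ j" for i j
    proof -
      have "(\<lambda>z. chern_connection ?H' z $ i $ j) = (\<lambda>z. cis \<theta> * (conj_transpose T ** ?A (?\<rho> z) ** T) $ i $ j)"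
        by (simp only: A' mat_mult_nth)
      moreover have "(\<lambda>z. (conj_transpose T ** ?A (?\<rho> z) ** T) $ i $ j) differentiable (at z)"
        by (intro mat_Ck_Suc_differentiable mat_Ck_mult mat_Ck_const comp Ck_A)
      ultimately have "mat_d_zbar (chern_connection ?H') z $ i $ j
          = cis \<theta> * mat_d_zbar (\<lambda>z. conj_transpose T ** ?A (?\<rho> z) ** T) z $ i $ j"
        by (simp add: mat_d_zbar_def d_zbar_cmult)
      also have "\<dots> = (conj_transpose T ** mat_d_zbar ?A (?\<rho> z) ** T) $ i $ j"
        unfolding dz(2)[OF Ck_A] by (simp add: cis_cnj cis_mult flip: mult.assoc)
      finally show ?thesis .
    qed
    then show ?thesis by (simp add: vec_eq_iff)
  qed
  \<comment> \<open>The gauge phase \<open>\<theta> * (a (i + 1) - a i)\<close> and the phase of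
    \<open>z ^ b i\<close> add up to \<theta> \<beta> for every i; this is the relation that defines
    the weights. A common phase drops out of the Higgs term.\<close>
  have field: "conj_transpose T ** higgs_field b (?\<rho> z) ** T = mat (cis (\<theta> * \<beta>)) ** higgs_field b z" for z
  proof -
    have "cis (\<theta> * (a (i + 1) - a i)) * cis \<theta> ^ b i = cis (\<theta> * \<beta>)" for i
    proof -
      have "\<theta> * (a (i + 1) - a i) + real (b i) * \<theta> = \<theta> * \<beta>"
        using arg_cong[OF a[of i], of "\<lambda>x. \<theta> * x"] by (simp add: algebra_simps)
      then show ?thesis by (simp add: Complex.DeMoivre cis_mult)
    qed
    then show ?thesis
      unfolding vec_eq_iff Tentry mat_mult_nth
      by (auto simp: higgs_field_def power_mult_distrib simp flip: mult.assoc)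
  qed
  have "mat_d_zbar (chern_connection ?H') z = higgs_commutator (?H' z) (higgs_field b z)" for z
  proof -
    have "mat_d_zbar (chern_connection ?H') z
        = conj_transpose T ** higgs_commutator (H (?\<rho> z)) (higgs_field b (?\<rho> z)) ** T"
      using H unfolding curv by (simp add: hitchin_metric_def higgs_commutator_def)
    also have "\<dots> = higgs_commutator (?H' z) (mat (cis (\<theta> * \<beta>)) ** higgs_field b z)"
      using higgs_commutator_unitary_congruence[OF T HD(4)] field by metis
    also have "\<dots> = higgs_commutator (?H' z) (higgs_field b z)"
      by (rule higgs_commutator_scale) (simp add: cis_cnj cis_mult)
    finally show ?thesis .
  qed
  moreover have "\<exists>C. \<forall>\<^sub>F z in at_infinity. \<forall>i. Re (?H' z $ i $ i) \<le> C * norm z powr (\<epsilon> - 2 * a i)"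
    if \<epsilon>: "\<epsilon> > 0" for \<epsilon>
  proof -
    obtain C R where "\<And>z i. norm z \<ge> R \<Longrightarrow> Re (H z $ i $ i) \<le> C * norm z powr (\<epsilon> - 2 * a i)"
      using H \<epsilon> unfolding hitchin_metric_def eventually_at_infinity by meson
    from this[of "?\<rho> z" for z] show ?thesis
      unfolding Tentry eventually_at_infinity by (auto simp: norm_mult)
  qed
  ultimately show ?thesis
    using herm' unfolding hitchin_metric_def higgs_commutator_def by blast
qed

text \<open>\<open>g\<close> is an entire matrix function commuting with the Higgs field. Along a
  cyclic off-diagonal the growth exponents a_(i+k) - a_(j+k) sum to zero and are nonzero, so one of
  them is negative and Liouville's theorem kills that entry. Commutation spreads the zero along the
  off-diagonal and identifies all diagonal entries.\<close>

lemma cyclic_hitchin_metric_unique: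
  fixes a :: "'k::nontriv mod_ring \<Rightarrow> real" and b :: "'k mod_ring \<Rightarrow> nat"
  assumes H: "hitchin_metric (higgs_field b) a H" and H': "hitchin_metric (higgs_field b) a H'"
    and sum0: "(\<Sum>i\<in>UNIV. a i) = 0"
    and incongruent: "\<And>i j. a i - a j \<in> \<int> \<Longrightarrow> i = j"
  shows "\<exists>c. \<forall>z i j. H' z $ i $ j = c * H z $ i $ j"
proof -
  define g where "g z = matrix_inv (H z) ** H' z" for z
  note rigid = hitchin_comparison_rigid[OF H H' sum0, folded g_def]
  have hol: "(\<lambda>z. g z $ i $ j) holomorphic_on UNIV" for i j
  proof -
    have "d_zbar (\<lambda>z. g z $ i $ j) z = 0" for z
      using rigid(1)[of z] by (simp add: mat_d_zbar_def vec_eq_iff)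
    then show ?thesis
      unfolding holomorphic_on_def field_differentiable_def
      using d_zbar_zero_imp_field_derivative[OF mat_Ck_Suc_differentiable[OF rigid(4)]] by blast
  qed
  have commute: "z ^ b i * g z $ (i + 1) $ (j + 1) = g z $ i $ j * z ^ b j" for z i j
  proof -
    have "(higgs_field b z ** g z) $ i $ (j + 1) = (\<Sum>k\<in>UNIV. if k = i + 1 then z ^ b i * g z $ k $ (j + 1) else 0)"
      by (simp add: matrix_matrix_mult_def higgs_field_def if_distrib[where f = "\<lambda>x. x * _"] cong: if_cong)
    moreover have "(g z ** higgs_field b z) $ i $ (j + 1)
        = (\<Sum>k\<in>UNIV. g z $ i $ k * (if j + 1 = k + 1 then z ^ b k else 0))"
      by (simp only: matrix_matrix_mult_def higgs_field_def vec_lambda_beta)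
    moreover have "\<dots> = (\<Sum>k\<in>UNIV. if k = j then g z $ i $ k * z ^ b k else 0)"
      by (intro sum.cong) auto
    ultimately show ?thesis using rigid(2)[of z] by simp
  qed
  have offdiag: "g z $ i $ j = 0" if ij: "i \<noteq> j" and "z \<noteq> 0" for z i j
  proof -
    have "\<exists>k. a (i + k) - a (j + k) < 0"
    proof (rule ccontr)
      assume "\<not> ?thesis"
      then have ge: "a (i + k) - a (j + k) \<ge> 0" for k by (simp add: not_less)
      have "(\<Sum>k\<in>UNIV. a (i + k) - a (j + k)) = 0"
        using sum_mod_ring_shift[of a i] sum_mod_ring_shift[of a j]
        by (simp add: sum_subtractf add.commute)
      then have "\<forall>k\<in>UNIV. a (i + k) - a (j + k) = 0"
        using ge by (subst (asm) sum_nonneg_eq_0_iff) auto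
      then have "a (i + 0) - a (j + 0) = 0" by blast
      then have "a i - a j = 0" by simp
      then show False using incongruent[of i j] ij by auto
    qed
    then obtain k where k: "a (i + k) - a (j + k) < 0" by blast
    \<comment> \<open>Half the gap: the bound for this entry becomes a multiple of |z|^(-\<delta>),
      so an entire function tends to zero at infinity.\<close>
    define \<delta> where "\<delta> = - (a (i + k) - a (j + k)) / 2"
    have \<delta>: "\<delta> > 0" using k by (simp add: \<delta>_def)
    obtain C where C: "\<forall>\<^sub>F z in at_infinity. \<forall>i j. norm (g z $ i $ j) \<le> C * norm z powr (\<delta> + a i - a j)"
      using rigid(5)[OF \<delta>] by blast
    have "((\<lambda>z. g z $ (i + k) $ (j + k)) \<longlongrightarrow> 0) at_infinity"
    proof (rule Lim_null_comparison)
      have eq: "\<delta> + a (i + k) - a (j + k) = - \<delta>" by (simp add: \<delta>_def field_simps)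
      show "\<forall>\<^sub>F z in at_infinity. norm (g z $ (i + k) $ (j + k)) \<le> C * norm z powr (- \<delta>)"
        using C unfolding eq[symmetric] by (rule eventually_mono) blast
      have "((\<lambda>x. x powr (- \<delta>)) \<longlongrightarrow> 0) at_top"
        using \<delta> by (intro tendsto_neg_powr filterlim_ident) auto
      then have "((\<lambda>z. norm (z :: complex) powr (- \<delta>)) \<longlongrightarrow> 0) at_infinity"
        by (rule filterlim_compose) (rule filterlim_norm_at_top)
      then show "((\<lambda>z. C * norm (z :: complex) powr (- \<delta>)) \<longlongrightarrow> 0) at_infinity"
        by (rule tendsto_mult_right_zero)
    qed
    then have zero: "g z $ (i + k) $ (j + k) = 0" for z
      by (rule Liouville_weak_0[OF hol])
    \<comment> \<open>Away from the origin the powers of \<open>z\<close> in the commutation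
      relation can be cancelled, and the zero travels around the whole cycle.\<close>
    have "g z $ (i + l) $ (j + l) = 0" for l
    proof (rule mod_ring_induct[of "\<lambda>l. g z $ (i + l) $ (j + l) = 0" k])
      show "g z $ (i + (l + 1)) $ (j + (l + 1)) = 0" if "g z $ (i + l) $ (j + l) = 0" for l
        using commute[of z "i + l" "j + l"] that \<open>z \<noteq> 0\<close> by (simp add: add.assoc)
    qed (rule zero)
    from this[of 0] show ?thesis by simp
  qed
  have diag: "g z $ i $ i = g z $ j $ j" if "z \<noteq> 0" for z i j
  proof (rule mod_ring_induct[of "\<lambda>l. g z $ i $ i = g z $ l $ l" i])
    show "g z $ i $ i = g z $ (l + 1) $ (l + 1)" if "g z $ i $ i = g z $ l $ l" for l
      using commute[of z l l] that \<open>z \<noteq> 0\<close> by simp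
  qed simp
  \<comment> \<open>The trace of \<open>g\<close> is constant in z, so the common diagonal value is
    constant as well.\<close>
  define c where "c = trace (g 0) / CARD('k)"
  have scalar: "g z $ i $ j = (if i = j then c else 0)" if "z \<noteq> 0" for z i j
  proof (cases "i = j")
    case True
    have "(\<Sum>k\<in>UNIV. g z $ k $ k) = (\<Sum>k\<in>(UNIV :: 'k mod_ring set). g z $ j $ j)"
      by (intro sum.cong diag that refl)
    then have "trace (g 0) = CARD('k) * g z $ j $ j"
      using rigid(3)[of z] by (simp add: trace_def)
    then show ?thesis using True by (simp add: c_def)
  qed (simp add: offdiag that)
  have "g z $ i $ j = (if i = j then c else 0)" for z i j
  proof (cases "z = 0")
    case True
    have lim: "((\<lambda>z. g z $ i $ j) \<longlongrightarrow> g 0 $ i $ j) (at 0)"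
      using holomorphic_on_imp_continuous_on[OF hol[of i j]] by (simp add: continuous_on_def)
    have "((\<lambda>z. g z $ i $ j) \<longlongrightarrow> (if i = j then c else 0)) (at 0)"
      by (rule tendsto_eventually) (auto simp: eventually_at_filter scalar)
    from tendsto_unique[OF at_neq_bot lim this] show ?thesis using True by simp
  qed (rule scalar)
  then have "g z = mat c" for z by (simp add: vec_eq_iff mat_def)
  moreover have "H z ** g z = H' z" for z
    using H unfolding g_def by (simp add: hitchin_metric_def matrix_mul_assoc
        matrix_mul_matrix_inv hermitian_metricD(4))
  ultimately have "H' z = H z ** mat c" for z by metis
  then have "H' z $ i $ j = c * H z $ i $ j" for z i j
    by (simp add: mult_mat_nth)
  then show ?thesis by blast
qed

text \<open>By uniqueness the rotated metric is a multiple of \<open>H\<close>, and the multiple is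
  1. On diagonal entries the gauge phases cancel, which is radiality. For \<theta> = 2 pi the
  rotation is trivial but the gauge phase of entry (i, j) is exp (2 pi \<i> (a_j - a_i)), different
  from 1 for i distinct from j, so the entry vanishes.\<close>

lemma cyclic_hitchin_metric_symmetric:
  fixes a :: "'k::nontriv mod_ring \<Rightarrow> real" and b :: "'k mod_ring \<Rightarrow> nat"
  assumes H: "hitchin_metric (higgs_field b) a H"
    and a: "\<And>i. real (b i) - \<beta> = a i - a (i + 1)"
    and sum0: "(\<Sum>i\<in>UNIV. a i) = 0"
    and incongruent: "\<And>i j. a i - a j \<in> \<int> \<Longrightarrow> i = j"
  shows "i \<noteq> j \<Longrightarrow> H z $ i $ j = 0" and "H (cis \<theta> * z) $ i $ i = H z $ i $ i"
proof -
  have herm: "hermitian_metric H" using H by (simp add: hitchin_metric_def)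
  have sym: "cnj (cis (\<theta> * a i)) * H (cis \<theta> * z) $ i $ j * cis (\<theta> * a j) = H z $ i $ j" for \<theta> z i j
  proof -
    have "\<exists>c. \<forall>z i j. cnj (cis (\<theta> * a i)) * H (cis \<theta> * z) $ i $ j * cis (\<theta> * a j) = c * H z $ i $ j"
      using cyclic_hitchin_metric_unique[OF H hitchin_metric_rotate[OF H a, of \<theta>] sum0 incongruent]
      by (simp add: conj_transpose_diag_matrix mult_diag_matrix diag_matrix_mult)
    then obtain c where c: "\<And>z i j. cnj (cis (\<theta> * a i)) * H (cis \<theta> * z) $ i $ j * cis (\<theta> * a j) = c * H z $ i $ j"
      by blast
    have "axis i 1 \<noteq> (0 :: complex ^ 'k mod_ring)" by (simp add: axis_eq_0_iff)
    then have "Re (H 0 $ i $ i) > 0"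
      using hermitian_metricD(2)[OF herm, of 0] unfolding positive_definite_def by (metis hprod_axis)
    \<comment> \<open>The origin is fixed by every rotation, so the multiple can be read off
      there.\<close>
    moreover have "H 0 $ i $ i = c * H 0 $ i $ i"
      using c[of i 0 i] by (simp add: mult_ac cis_cnj cis_mult flip: mult.assoc)
    ultimately have "c = 1" by auto
    then show ?thesis using c by simp
  qed
  show "H (cis \<theta> * z) $ i $ i = H z $ i $ i"
  proof -
    have "cnj (cis (\<theta> * a i)) * cis (\<theta> * a i) = 1" by (simp add: cis_cnj cis_mult)
    then show ?thesis using sym[of \<theta> i z i] by (simp add: mult_ac flip: mult.assoc)
  qed
  show "H z $ i $ j = 0" if "i \<noteq> j"
  proof (rule ccontr)
    assume "H z $ i $ j \<noteq> 0"
    moreover have "cis (2 * pi * (a j - a i)) * H z $ i $ j = H z $ i $ j"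
    proof -
      have "cis (2 * pi * (a j - a i)) = cnj (cis (2 * pi * a i)) * cis (2 * pi * a j)"
        by (simp add: cis_cnj cis_mult right_diff_distrib)
      then have "cis (2 * pi * (a j - a i)) * H z $ i $ j
          = cnj (cis (2 * pi * a i)) * H z $ i $ j * cis (2 * pi * a j)"
        by (simp only: mult_ac)
      also have "\<dots> = H z $ i $ j" using sym[of "2 * pi" i z j] by (simp only: cis_2pi mult_1)
      finally show ?thesis .
    qed
    ultimately have "cis (2 * pi * (a j - a i)) = 1" by simp
    then have "cos (2 * pi * (a j - a i)) = 1"
      by (metis cis.sel(1) one_complex.sel(1))
    then obtain n :: int where "2 * pi * (a j - a i) = of_int n * 2 * pi"
      by (auto simp: cos_one_2pi_int)
    then have "a j - a i = of_int n" by simp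
    then have "j = i" by (intro incongruent) simp
    with that show False by simp
  qed
qed

section \<open>The radial Toda lattice\<close>

text \<open>This is exp (-x) >= 1 - x. Summed over the lattice, it bounds the force term in the
  derivative of \<Sum> v_i v_i' below by the potential.\<close>

lemma one_plus_le_exp_mult: "exp x - 1 \<le> x * exp x" for x :: real
proof -
  have "(1 - x) * exp x \<le> exp (- x) * exp x"
    using exp_ge_add_one_self[of "- x"] by (intro mult_right_mono) auto
  then show ?thesis by (simp add: exp_minus field_simps)
qed

text \<open>\<open>Q\<close> is the energy whose derivative is the integrand of the regulated norm. Its limit at
  \<open>+\<infinity>\<close> comes from \<open>|Q| \<le> S'\<close> with \<open>S = \<Sum> v\<^sub>i v\<^sub>i' \<le> 0\<close>, the latter because
  \<open>sqrt (1 + \<Sum> v\<^sub>i\<^sup>2)\<close> is convex and sublinear.\<close>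

lemma toda_energy:
  fixes v v' :: "'k::nontriv mod_ring \<Rightarrow> real \<Rightarrow> real" and q :: real
  assumes v: "\<And>i x. (v i has_real_derivative v' i x) (at x)"
    and v': "\<And>i x. (v' i has_real_derivative
        4 * exp (2 * q * x) * (exp (v i x - v (i + 1) x) - exp (v (i - 1) x - v i x))) (at x)"
    and q: "q > 0"
    and growth: "\<And>\<epsilon>. \<epsilon> > 0 \<Longrightarrow> \<exists>C. \<forall>\<^sub>F x in at_top. \<forall>i. \<bar>v i x\<bar> \<le> \<epsilon> * x + C"
  defines "G \<equiv> \<lambda>x. exp (2 * q * x) * (\<Sum>i\<in>UNIV. exp (v i x - v (i + 1) x) - 1)"
  defines "Q \<equiv> \<lambda>x. (\<Sum>i\<in>UNIV. (v' i x)\<^sup>2) / 2 - 4 * G x"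
  shows "(Q has_real_derivative - 8 * q * G x) (at x)" and "G x \<ge> 0" and "(Q \<longlongrightarrow> 0) at_top"
proof -
  define X where "X i x = exp (v i x - v (i + 1) x)" for i x
  define c where "c x = 4 * exp (2 * q * x)" for x
  have c_pos: "c x > 0" for x by (simp add: c_def)
  \<comment> \<open>Summation by parts around the cycle.\<close>
  have shift: "(\<Sum>i\<in>UNIV. f i * (X i x - X (i - 1) x)) = (\<Sum>i\<in>UNIV. (f i - f (i + 1)) * X i x)" for f x
    using sum_mod_ring_shift[of "\<lambda>i. f i * X (i - 1) x" 1]
    by (simp add: right_diff_distrib left_diff_distrib sum_subtractf)
  have v'': "(v' i has_real_derivative c x * (X i x - X (i - 1) x)) (at x)" for i x
    using v'[of i x] by (simp add: c_def X_def)
  have telescope: "(\<Sum>i\<in>UNIV. v i x - v (i + 1) x) = 0" for x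
    using sum_mod_ring_shift[of "\<lambda>i. v i x" 1] by (simp add: sum_subtractf)
  have G: "4 * G x = c x * (\<Sum>i\<in>UNIV. X i x - 1)" for x
    by (simp add: G_def X_def c_def)
  show G_nonneg: "G x \<ge> 0" for x
  proof -
    \<comment> \<open>The inequality exp u >= 1 + u is summed; the exponents add up to zero around
      the cycle.\<close>
    have "(\<Sum>i\<in>UNIV. v i x - v (i + 1) x) \<le> (\<Sum>i\<in>UNIV. X i x - 1)"
    proof (intro sum_mono)
      fix i
      show "v i x - v (i + 1) x \<le> X i x - 1"
        using exp_ge_add_one_self[of "v i x - v (i + 1) x"] unfolding X_def by linarith
    qed
    then have "0 \<le> c x * (\<Sum>i\<in>UNIV. X i x - 1)"
      using c_pos[of x] by (intro mult_nonneg_nonneg) (simp_all only: telescope less_imp_le)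
    then show ?thesis using G[of x] by linarith
  qed
  have X': "(X i has_real_derivative X i x * (v' i x - v' (i + 1) x)) (at x)" for i x
    unfolding X_def[abs_def] by (auto intro!: derivative_eq_intros v)
  show Q': "(Q has_real_derivative - 8 * q * G x) (at x)" for x
  proof -
    have Q: "Q = (\<lambda>x. (\<Sum>i\<in>UNIV. (v' i x)\<^sup>2) / 2 - c x * (\<Sum>i\<in>UNIV. X i x - 1))"
      by (simp add: Q_def G)
    have c': "(c has_real_derivative 2 * q * c x) (at x)"
      unfolding c_def[abs_def] by (auto intro!: derivative_eq_intros)
    have "(Q has_real_derivative (\<Sum>i\<in>UNIV. 2 * v' i x * (c x * (X i x - X (i - 1) x))) / 2
        - (2 * q * c x * (\<Sum>i\<in>UNIV. X i x - 1) + (\<Sum>i\<in>UNIV. X i x * (v' i x - v' (i + 1) x)) * c x)) (at x)"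
      unfolding Q by (auto intro!: derivative_eq_intros v'' X' c' simp: mult_ac)
    also have "(\<Sum>i\<in>UNIV. 2 * v' i x * (c x * (X i x - X (i - 1) x))) / 2
        = c x * (\<Sum>i\<in>UNIV. v' i x * (X i x - X (i - 1) x))"
      by (simp add: sum_distrib_left sum_divide_distrib mult_ac)
    \<comment> \<open>The kinetic term cancels against the derivative of the exponentials; only the
      derivative of the coupling \<open>c\<close> remains.\<close>
    also have "\<dots> = (\<Sum>i\<in>UNIV. X i x * (v' i x - v' (i + 1) x)) * c x"
      by (simp only: shift mult_ac)
    also have "\<dots> - (2 * q * c x * (\<Sum>i\<in>UNIV. X i x - 1) + \<dots>) = - 2 * q * (c x * (\<Sum>i\<in>UNIV. X i x - 1))"
      by simp
    also have "\<dots> = - 8 * q * G x" by (simp flip: G)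
    finally show ?thesis .
  qed
  \<comment> \<open>\<open>S\<close> is half the derivative of \<open>E\<close>, and
    \<open>W\<close> is the derivative of \<open>S\<close>. The summand 1 keeps \<open>E\<close>
    positive, so that its square root is differentiable everywhere.\<close>
  define E where "E x = 1 + (\<Sum>i\<in>UNIV. (v i x)\<^sup>2)" for x
  define S where "S x = (\<Sum>i\<in>UNIV. v i x * v' i x)" for x
  define W where "W x = (\<Sum>i\<in>UNIV. (v' i x)\<^sup>2) + c x * (\<Sum>i\<in>UNIV. v i x * (X i x - X (i - 1) x))" for x
  have E_pos: "E x > 0" for x
    unfolding E_def by (intro add_pos_nonneg sum_nonneg) auto
  have E': "(E has_real_derivative 2 * S x) (at x)" for x
    unfolding E_def[abs_def] S_def by (auto intro!: derivative_eq_intros v simp: sum_distrib_left mult_ac)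
  have S': "(S has_real_derivative W x) (at x)" for x
    unfolding S_def[abs_def] W_def
    by (auto intro!: derivative_eq_intros v v'' simp: sum_distrib_left power2_eq_square sum.distrib mult_ac)
  have W: "W x \<ge> (\<Sum>i\<in>UNIV. (v' i x)\<^sup>2) + 4 * G x" for x
  proof -
    have "(\<Sum>i\<in>UNIV. X i x - 1) \<le> (\<Sum>i\<in>UNIV. (v i x - v (i + 1) x) * X i x)"
      unfolding X_def by (intro sum_mono one_plus_le_exp_mult)
    also have "\<dots> = (\<Sum>i\<in>UNIV. v i x * (X i x - X (i - 1) x))"
      by (simp only: shift)
    finally show ?thesis
      using c_pos[of x] by (simp add: W_def G mult_left_mono)
  qed
  have S_nonpos: "S x \<le> 0" for x
  proof -
    let ?p = "\<lambda>x. sqrt (E x)"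
    have p': "(?p has_real_derivative S x / sqrt (E x)) (at x)" for x
      using E_pos[of x] by (auto intro!: derivative_eq_intros E' simp: field_simps)
    have p'': "((\<lambda>x. S x / sqrt (E x)) has_real_derivative
        (W x * sqrt (E x) - S x * (S x / sqrt (E x))) / (sqrt (E x) * sqrt (E x))) (at x)" for x
      using E_pos[of x] by (intro DERIV_divide S' p') simp
    \<comment> \<open>Cauchy-Schwarz for the vectors of the \<open>v i\<close> and the
      \<open>v' i\<close>, combined with W >= \<Sum> v_i'^2, is the convexity of the square root of
      \<open>E\<close>.\<close>
    have convex: "(W x * sqrt (E x) - S x * (S x / sqrt (E x))) / (sqrt (E x) * sqrt (E x)) \<ge> 0" for x
    proof -
      have "(S x)\<^sup>2 \<le> (\<Sum>i\<in>UNIV. (v i x)\<^sup>2) * (\<Sum>i\<in>UNIV. (v' i x)\<^sup>2)"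
        unfolding S_def by (rule Cauchy_Schwarz_ineq_sum)
      also have "\<dots> \<le> E x * W x"
        using W[of x] G_nonneg[of x] by (intro mult_mono) (auto simp: E_def intro!: add_nonneg_nonneg sum_nonneg)
      finally have "S x * S x \<le> W x * sqrt (E x) * sqrt (E x)"
        using E_pos[of x] by (simp add: power2_eq_square mult_ac)
      then have "S x * (S x / sqrt (E x)) \<le> W x * sqrt (E x)"
        using E_pos[of x] by (simp add: field_simps)
      then show ?thesis using E_pos[of x] by simp
    qed
    have "S x / sqrt (E x) \<le> 0"
    proof (rule deriv_nonpos_of_convex_sublinear[OF p' p'' convex])
      fix \<epsilon> :: real assume \<epsilon>: "\<epsilon> > 0"
      let ?K = "real CARD('k)"
      obtain C where C: "\<forall>\<^sub>F x in at_top. \<forall>i. \<bar>v i x\<bar> \<le> \<epsilon> / ?K * x + C"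
        using growth[of "\<epsilon> / ?K"] \<epsilon> by auto
      have "\<forall>\<^sub>F x in at_top. ?p x \<le> \<epsilon> * x + (1 + ?K * C)"
        using C
      proof eventually_elim
        case (elim x)
        have "L2_set (\<lambda>i. v i x) UNIV \<le> (\<Sum>i\<in>UNIV. \<bar>v i x\<bar>)" by (rule L2_set_le_sum_abs)
        also have "\<dots> \<le> (\<Sum>i\<in>(UNIV :: 'k mod_ring set). \<epsilon> / ?K * x + C)"
          using elim by (intro sum_mono) blast
        also have "\<dots> = \<epsilon> * x + ?K * C" by (simp add: distrib_left)
        finally have "L2_set (\<lambda>i. v i x) UNIV \<le> \<epsilon> * x + ?K * C" .
        moreover have "?p x \<le> sqrt 1 + L2_set (\<lambda>i. v i x) UNIV"
          unfolding E_def L2_set_def by (intro sqrt_add_le_add_sqrt sum_nonneg) auto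
        ultimately show ?case by simp
      qed
      then show "\<exists>C. \<forall>\<^sub>F x in at_top. ?p x \<le> \<epsilon> * x + C" by blast
    qed
    then show ?thesis using E_pos[of x] by (simp add: divide_le_0_iff)
  qed
  have abs_Q: "\<bar>Q x\<bar> \<le> W x" for x
  proof -
    have "(\<Sum>i\<in>UNIV. (v' i x)\<^sup>2) \<ge> 0" by (intro sum_nonneg) auto
    then show ?thesis using W[of x] G_nonneg[of x] unfolding Q_def by linarith
  qed
  have small: "\<exists>x\<ge>x0. \<bar>Q x\<bar> < \<delta>" if "\<delta> > 0" for \<delta> x0
  proof (rule ccontr)
    assume "\<not> ?thesis"
    then have ge: "W x \<ge> \<delta>" if "x \<ge> x0" for x
      using abs_Q[of x] that by force
    \<comment> \<open>If \<open>W\<close> stayed above \<delta>, \<open>S\<close> would have climbed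
      to at least 1 at this point, against \<open>S_nonpos\<close>.\<close>
    define y where "y = x0 + (1 - S x0) / \<delta>"
    have "x0 < y" using that S_nonpos[of x0] by (simp add: y_def)
    then obtain z where z: "x0 < z" "S y - S x0 = (y - x0) * W z"
      using MVT2[of x0 y S W] S' by metis
    have "(y - x0) * \<delta> \<le> (y - x0) * W z"
      using \<open>x0 < y\<close> z(1) ge[of z] by (intro mult_left_mono) auto
    also have "(y - x0) * \<delta> = 1 - S x0" using that by (simp add: y_def)
    finally show False using z(2) S_nonpos[of y] by linarith
  qed
  have antimono: "Q y \<le> Q x" if "x \<le> y" for x y
  proof (rule DERIV_nonpos_imp_nonincreasing[OF that])
    fix t
    show "\<exists>d. (Q has_real_derivative d) (at t) \<and> d \<le> 0"
      using Q'[of t] G_nonneg[of t] q by (intro exI conjI) (auto simp: mult_nonneg_nonneg)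
  qed
  \<comment> \<open>A decreasing function that has become negative cannot come arbitrarily close to
    zero again.\<close>
  have Q_nonneg: "Q x \<ge> 0" for x
  proof (rule ccontr)
    assume "\<not> Q x \<ge> 0"
    then obtain y where "y \<ge> x" "\<bar>Q y\<bar> < - Q x" using small[of "- Q x" x] by auto
    then show False using antimono[of x y] by linarith
  qed
  show "(Q \<longlongrightarrow> 0) at_top"
  proof (rule tendstoI)
    fix \<delta> :: real assume "\<delta> > 0"
    then obtain y where y: "\<bar>Q y\<bar> < \<delta>" using small by blast
    show "\<forall>\<^sub>F x in at_top. dist (Q x) 0 < \<delta>"
      using eventually_ge_at_top[of y]
      by eventually_elim (use antimono y Q_nonneg in \<open>force simp: dist_real_def\<close>)
  qed
qed

section \<open>Reduction of Hitchin's equation to the Toda lattice\<close>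

text \<open>The squared \<open>H\<close>-norm of the component e_(i+1) -> e_i of the Higgs field
  when \<open>H\<close> is diagonal.\<close>

definition toda_potential :: "('k::nontriv mod_ring \<Rightarrow> nat) \<Rightarrow> (complex \<Rightarrow> complex ^ 'k mod_ring ^ 'k mod_ring) \<Rightarrow>
    'k mod_ring \<Rightarrow> complex \<Rightarrow> real" where
  "toda_potential b H i z = norm z ^ (2 * b i) * (Re (H z $ i $ i) / Re (H z $ (i + 1) $ (i + 1)))"

lemma hermitian_metric_diag:
  assumes "hermitian_metric H"
  shows "Re (H z $ i $ i) > 0" and "H z $ i $ i = of_real (Re (H z $ i $ i))"
proof -
  have "axis i 1 \<noteq> (0 :: complex ^ 'a)" by (simp add: axis_eq_0_iff)
  then show "Re (H z $ i $ i) > 0"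
    using hermitian_metricD(2)[OF assms, of z] unfolding positive_definite_def by (metis hprod_axis)
  have "cnj (H z $ i $ i) = H z $ i $ i"
    using arg_cong[OF hermitian_metricD(3)[OF assms, of z], of "\<lambda>M. M $ i $ i"]
    by (simp add: conj_transpose_def)
  then show "H z $ i $ i = of_real (Re (H z $ i $ i))" by (simp add: complex_eq_iff)
qed

text \<open>For a diagonal metric both products of the Higgs field and its adjoint have squared
  norms of arrows on the diagonal: the arrow into e_i for one order, the arrow out of e_i, of index
  i - 1, for the other.\<close>

lemma
  fixes H :: "complex \<Rightarrow> complex ^ 'k::nontriv mod_ring ^ 'k mod_ring"
  assumes herm: "hermitian_metric H" and diag: "\<And>z i j. i \<noteq> j \<Longrightarrow> H z $ i $ j = 0"
  shows higgs_diag: "(higgs_field b z ** h_adjoint (H z) (higgs_field b z)) $ i $ i = of_real (toda_potential b H i z)"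
    and higgs_diag': "(h_adjoint (H z) (higgs_field b z) ** higgs_field b z) $ i $ i = of_real (toda_potential b H (i - 1) z)"
    and chern_connection_diag: "chern_connection H z $ i $ i = d_z (\<lambda>z. of_real (ln (Re (H z $ i $ i)))) z"
proof -
  note pos = hermitian_metric_diag(1)[OF herm] and real = hermitian_metric_diag(2)[OF herm]
  have Hz: "H z = diag_matrix (\<lambda>i. H z $ i $ i)"
    using diag by (auto simp: vec_eq_iff diag_matrix_def)
  have nz: "H z $ i $ i \<noteq> 0" for i using pos[of z i] by auto
  define J where "J = diag_matrix (\<lambda>i. inverse (H z $ i $ i))"
  have J: "matrix_inv (H z) = J"
  proof (rule matrix_inv_unique)
    show "J ** H z = mat 1"
      unfolding J_def using diag nz by (auto simp: vec_eq_iff diag_matrix_mult) (auto simp: mat_def)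
  qed
  have S: "h_adjoint (H z) (higgs_field b z) $ i $ j
      = inverse (H z $ i $ i) * cnj (higgs_field b z $ j $ i) * H z $ j $ j" for i j
    unfolding h_adjoint_def J unfolding J_def
    by (subst (2) Hz) (simp add: mult_diag_matrix diag_matrix_mult conj_transpose_def)
  have pot: "z ^ b i * (inverse (H z $ (i + 1) $ (i + 1)) * cnj (z ^ b i) * H z $ i $ i)
      = of_real (toda_potential b H i z)" for i
  proof -
    have "z ^ b i * (inverse (H z $ (i + 1) $ (i + 1)) * cnj (z ^ b i) * H z $ i $ i)
        = (z ^ b i * cnj (z ^ b i)) * (H z $ i $ i / H z $ (i + 1) $ (i + 1))"
      by (simp only: divide_inverse mult_ac)
    also have "z ^ b i * cnj (z ^ b i) = of_real (norm z ^ (2 * b i))"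
      by (simp only: complex_cnj_power power_mult_distrib[symmetric] complex_norm_square[symmetric]
          of_real_power power_mult)
    also have "of_real (norm z ^ (2 * b i)) * (H z $ i $ i / H z $ (i + 1) $ (i + 1))
        = of_real (toda_potential b H i z)"
    proof -
      obtain p p' where "H z $ i $ i = of_real p" "H z $ (i + 1) $ (i + 1) = of_real p'"
        using real by blast
      then show ?thesis by (simp add: toda_potential_def)
    qed
    finally show ?thesis .
  qed
  have "(higgs_field b z ** h_adjoint (H z) (higgs_field b z)) $ i $ i
      = (\<Sum>k\<in>UNIV. if k = i + 1 then z ^ b i * (inverse (H z $ (i + 1) $ (i + 1)) * cnj (z ^ b i) * H z $ i $ i) else 0)"
    unfolding matrix_matrix_mult_def vec_lambda_beta S unfolding higgs_field_def vec_lambda_beta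
    by (intro sum.cong) auto
  then show "(higgs_field b z ** h_adjoint (H z) (higgs_field b z)) $ i $ i = of_real (toda_potential b H i z)"
    unfolding pot by simp
  have "(h_adjoint (H z) (higgs_field b z) ** higgs_field b z) $ i $ i
      = (\<Sum>k\<in>UNIV. if k = i - 1 then z ^ b (i - 1) * (inverse (H z $ (i - 1 + 1) $ (i - 1 + 1)) * cnj (z ^ b (i - 1)) * H z $ (i - 1) $ (i - 1)) else 0)"
    unfolding matrix_matrix_mult_def vec_lambda_beta S unfolding higgs_field_def vec_lambda_beta
    by (intro sum.cong) (auto simp: mult_ac)
  then show "(h_adjoint (H z) (higgs_field b z) ** higgs_field b z) $ i $ i = of_real (toda_potential b H (i - 1) z)"
    unfolding pot by simp
  have "d_z (\<lambda>z. of_real (ln (Re (H z $ i $ i)))) z = d_z (\<lambda>z. H z $ i $ i) z / H z $ i $ i"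
    using pos real by (intro d_z_ln mat_Ck_Suc_differentiable[OF hermitian_metricD(1)[OF herm]])
      (metis Reals_of_real)+
  also have "\<dots> = chern_connection H z $ i $ i"
    unfolding chern_connection_def J unfolding J_def by (simp add: diag_matrix_mult field_simps)
  finally show "chern_connection H z $ i $ i = d_z (\<lambda>z. of_real (ln (Re (H z $ i $ i)))) z" ..
qed

text \<open>In the coordinate ln z the Laplacian of a radial function is its second derivative in x.
  The 4 comes from the Laplacian being 4 \<partial>_zbar \<partial>_z, and the factor (exp x)^2 from
  pulling back along \<open>exp\<close>.\<close>

lemma toda_equation:
  fixes H :: "complex \<Rightarrow> complex ^ 'k::nontriv mod_ring ^ 'k mod_ring"
  assumes H: "hitchin_metric (higgs_field b) a H" and diag: "\<And>z i j. i \<noteq> j \<Longrightarrow> H z $ i $ j = 0"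
    and radial: "\<And>\<theta> z i. H (cis \<theta> * z) $ i $ i = H z $ i $ i"
  defines "y \<equiv> \<lambda>i x. ln (Re (H (of_real (exp x)) $ i $ i))"
  obtains y' where "\<And>i x. (y i has_real_derivative y' i x) (at x)"
    and "\<And>i x. (y' i has_real_derivative
      4 * (exp x)\<^sup>2 * (toda_potential b H i (of_real (exp x)) - toda_potential b H (i - 1) (of_real (exp x)))) (at x)"
    and "\<And>i. (y' i \<longlongrightarrow> 0) at_bot"
proof -
  have herm: "hermitian_metric H" using H by (simp add: hitchin_metric_def)
  define u where "u i z = complex_of_real (ln (Re (H z $ i $ i)))" for i z
  define U where "U i z = u i (exp z)" for i z
  have exp: "exp holomorphic_on UNIV" by (intro holomorphic_intros)
  have Cku: "Ck k (u i)" for k i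
    unfolding u_def[abs_def]
    by (intro Ck_of_real_ln hermitian_metric_diag[OF herm]) (use hermitian_metricD(1)[OF herm] in \<open>simp add: mat_Ck_def\<close>)
  have CkU: "Ck k (U i)" for k i
    unfolding U_def[abs_def] by (rule Ck_compose_holomorphic[OF exp Cku])
  have laplace_u: "d_zbar (d_z (u i)) z = of_real (toda_potential b H i z - toda_potential b H (i - 1) z)" for i z
  proof -
    have "d_z (u i) = (\<lambda>z. chern_connection H z $ i $ i)"
      unfolding u_def[abs_def] using chern_connection_diag[OF herm diag] by auto
    then have "d_zbar (d_z (u i)) z = mat_d_zbar (chern_connection H) z $ i $ i"
      by (simp add: mat_d_zbar_def)
    also have "\<dots> = of_real (toda_potential b H i z) - of_real (toda_potential b H (i - 1) z)"
      using H by (simp add: hitchin_metric_def higgs_diag[OF herm diag] higgs_diag'[OF herm diag])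
    finally show ?thesis by simp
  qed
  let ?D = "\<lambda>i v z. frechet_derivative (U i) (at z) v"
  have UD: "U i differentiable (at z)" "?D i v differentiable (at z)" for i v z
    using Ck_Suc_differentiable[OF CkU] Ck_Suc_differentiable[OF Ck_SucD[OF CkU]] by blast+
  \<comment> \<open>Points on a vertical line are mapped by \<open>exp\<close> to rotations of each
    other, so \<open>U i\<close> depends on x alone and its vertical derivatives vanish.\<close>
  have U_radial: "U i (Complex x t) = U i (Complex x 0)" for i x t
  proof -
    have "exp (Complex x t) = cis t * exp (Complex x 0)"
      by (simp add: exp_eq_polar mult.commute)
    then show ?thesis using radial[of t "exp (Complex x 0)" i] by (simp add: U_def u_def)
  qed
  have Di: "Re (?D i \<i> (Complex x t)) = 0" for i x t
  proof -
    have "((\<lambda>t. Re (U i (Complex x t))) has_real_derivative Re (?D i \<i> (Complex x t))) (at t)"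
      by (rule DERIV_Re_along_imaginary_axis[OF UD(1)])
    moreover have "(\<lambda>t. Re (U i (Complex x t))) = (\<lambda>t. Re (U i (Complex x 0)))"
      by (rule ext, subst U_radial, rule refl)
    ultimately have "((\<lambda>t. Re (U i (Complex x 0))) has_real_derivative Re (?D i \<i> (Complex x t))) (at t)"
      by (simp only:)
    then show ?thesis by (rule DERIV_unique) (rule DERIV_const)
  qed
  have Dii: "Re (frechet_derivative (?D i \<i>) (at (Complex x t)) \<i>) = 0" for i x t
  proof -
    have "((\<lambda>t. Re (?D i \<i> (Complex x t))) has_real_derivative
        Re (frechet_derivative (?D i \<i>) (at (Complex x t)) \<i>)) (at t)"
      by (rule DERIV_Re_along_imaginary_axis[OF UD(2)])
    then have "((\<lambda>t. 0) has_real_derivative Re (frechet_derivative (?D i \<i>) (at (Complex x t)) \<i>)) (at t)"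
      by (simp only: Di)
    then show ?thesis by (rule DERIV_unique) (rule DERIV_const)
  qed
  have real_exp: "exp (Complex x 0) = of_real (exp x)" for x
    by (simp add: complex_eq_iff Re_exp Im_exp)
  define y' where "y' i x = Re (?D i 1 (Complex x 0))" for i x
  show thesis
  proof
    show "(y i has_real_derivative y' i x) (at x)" for i x
      using DERIV_Re_along_real_axis[where x = x and t = 0, OF UD(1)[of i]]
      by (simp add: y_def y'_def U_def u_def real_exp)
    show "(y' i has_real_derivative
      4 * (exp x)\<^sup>2 * (toda_potential b H i (of_real (exp x)) - toda_potential b H (i - 1) (of_real (exp x)))) (at x)" for i x
    proof -
      have "U i w \<in> \<real>" for w by (simp add: U_def u_def)
      from Re_d_zbar_d_z[OF CkU this, of "Complex x 0"]
      have "Re (frechet_derivative (?D i 1) (at (Complex x 0)) 1) = Re (4 * d_zbar (d_z (U i)) (Complex x 0))"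
        by (simp add: Dii)
      also have "d_zbar (d_z (U i)) (Complex x 0)
          = d_zbar (d_z (u i)) (of_real (exp x)) * (deriv exp (Complex x 0) * cnj (deriv exp (Complex x 0)))"
        unfolding U_def[abs_def] d_zbar_d_z_compose[OF Cku exp] real_exp ..
      also have "deriv exp (Complex x 0) = of_real (exp x)"
        by (simp add: DERIV_imp_deriv[OF DERIV_exp] real_exp)
      finally have "Re (frechet_derivative (?D i 1) (at (Complex x 0)) 1)
        = 4 * (exp x)\<^sup>2 * (toda_potential b H i (of_real (exp x)) - toda_potential b H (i - 1) (of_real (exp x)))"
        by (simp add: laplace_u power2_eq_square algebra_simps)
      then show ?thesis
        using DERIV_Re_along_real_axis[where x = x and t = 0, OF UD(2)[of i 1]] by (simp add: y'_def[abs_def])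
    qed
    show "(y' i \<longlongrightarrow> 0) at_bot" for i
    proof -
      \<comment> \<open>d/dx is r d/dr: the factor exp x tends to 0 while the derivatives of the
        smooth function \<open>u i\<close> stay bounded near the origin.\<close>
      have y'_eq: "y' i x = exp x * Re (d_z (u i) (of_real (exp x)) + d_zbar (u i) (of_real (exp x)))" for x
      proof -
        have "?D i 1 (Complex x 0) = d_z (U i) (Complex x 0) + d_zbar (U i) (Complex x 0)"
          using frechet_derivative_eq_d_z[OF UD(1), of i "Complex x 0" 1] by simp
        also have "\<dots> = d_z (u i) (of_real (exp x)) * of_real (exp x) + d_zbar (u i) (of_real (exp x)) * of_real (exp x)"
          unfolding U_def[abs_def]
            d_z_compose[of "u i" exp, OF Ck_Suc_differentiable[OF Cku] DERIV_exp]
            d_zbar_compose[of "u i" exp, OF Ck_Suc_differentiable[OF Cku] DERIV_exp] real_exp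
          by simp
        finally show ?thesis by (simp add: y'_def algebra_simps)
      qed
      have exp0: "((\<lambda>x. complex_of_real (exp x)) \<longlongrightarrow> 0) at_bot"
        using tendsto_of_real[OF exp_at_bot] by simp
      have cont: "isCont (d_z (u i)) 0" "isCont (d_zbar (u i)) 0"
        using Ck_d_z[OF Cku, of 0] Ck_d_zbar[OF Cku, of 0] by (simp_all add: continuous_on_eq_continuous_at)
      have "((\<lambda>x. exp x * Re (d_z (u i) (of_real (exp x)) + d_zbar (u i) (of_real (exp x))))
          \<longlongrightarrow> 0 * Re (d_z (u i) 0 + d_zbar (u i) 0)) at_bot"
        by (intro tendsto_intros exp_at_bot isCont_tendsto_compose[OF cont(1) exp0]
            isCont_tendsto_compose[OF cont(2) exp0])
      moreover have "y' i = (\<lambda>x. exp x * Re (d_z (u i) (of_real (exp x)) + d_zbar (u i) (of_real (exp x))))"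
        by (rule ext) (rule y'_eq)
      ultimately show ?thesis by (simp only: mult_zero_left)
    qed
  qed
qed

section \<open>Integration of radial functions\<close>

text \<open>The measures are compared on the half-lines {x<..}. For the sign-reversed norm their
  preimages are balls, of finite area pi x^2, which the density reproduces by integration.\<close>

lemma distr_lborel_minus_norm:
  "distr lborel borel (\<lambda>z::complex. - norm z) = density lborel (\<lambda>s. ennreal (if s < 0 then - 2 * pi * s else 0))"
    (is "?M = ?N")
proof (rule measure_eqI_lessThan)
  show sets: "sets ?M = sets borel" "sets ?N = sets borel" by simp_all
  have M: "emeasure ?M {x<..} = (if x < 0 then ennreal (pi * x\<^sup>2) else 0)" for x
  proof -
    have "emeasure ?M {x<..} = emeasure lborel ((\<lambda>z::complex. - norm z) -` {x<..} \<inter> space lborel)"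
      by (rule emeasure_distr) auto
    also have "(\<lambda>z::complex. - norm z) -` {x<..} \<inter> space lborel = ball 0 (- x)"
      by auto
    also have "emeasure lborel (ball (0::complex) (- x)) = (if x < 0 then ennreal (pi * x\<^sup>2) else 0)"
      using emeasure_ball[of "- x" "0 :: complex"] by (auto simp: unit_ball_vol_2 ball_empty)
    finally show ?thesis .
  qed
  then show "emeasure ?M {x<..} < \<infinity>" for x by simp
  show "emeasure ?M {x<..} = emeasure ?N {x<..}" for x
  proof -
    have "emeasure ?N {x<..} = (\<integral>\<^sup>+s. ennreal (if s < 0 then - 2 * pi * s else 0) * indicator {x<..} s \<partial>lborel)"
      by (rule emeasure_density) auto
    also have "\<dots> = (if x < 0 then ennreal (pi * x\<^sup>2) else 0)"
    proof (cases "x < 0")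
      case True
      have "(\<integral>\<^sup>+s. ennreal (if s < 0 then - 2 * pi * s else 0) * indicator {x<..} s \<partial>lborel)
          = (\<integral>\<^sup>+s. ennreal (- 2 * pi * s) * indicator {x..0} s \<partial>lborel)"
      proof (rule nn_integral_cong_AE)
        show "AE s in lborel. ennreal (if s < 0 then - 2 * pi * s else 0) * indicator {x<..} s
            = ennreal (- 2 * pi * s) * indicator {x..0} s"
          using AE_lborel_singleton[of x] by eventually_elim (auto simp: indicator_def)
      qed
      also have "\<dots> = ennreal (- pi * 0\<^sup>2 - (- pi * x\<^sup>2))"
      proof (rule nn_integral_FTC_Icc[where F = "\<lambda>s. - pi * s\<^sup>2"])
        show "((\<lambda>s. - pi * s\<^sup>2) has_real_derivative - 2 * pi * s) (at s)" for s
          by (auto intro!: derivative_eq_intros)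
        show "0 \<le> - 2 * pi * s" if "s \<in> {x..0}" for s
          using that mult_nonneg_nonpos[of "2 * pi" s] by simp
      qed (use True in auto)
      finally show ?thesis using True by simp
    next
      case False
      then have "(\<lambda>s. ennreal (if s < 0 then - 2 * pi * s else 0) * indicator {x<..} s) = (\<lambda>_. 0)"
        by (auto simp: indicator_def)
      then show ?thesis using False by simp
    qed
    finally show ?thesis by (simp add: M)
  qed
qed

text \<open>Polar coordinates: the integral is pushed forward along the negative norm, written with
  its density, and reflected back to the positive half-line.\<close>

lemma integral_lborel_radial:
  fixes f :: "real \<Rightarrow> real"
  assumes [measurable]: "f \<in> borel_measurable borel"
  shows "(LINT z|lborel. f (norm (z :: complex))) = 2 * pi * (LBINT r=0..\<infinity>. r * f r)"
proof -
  have "(LINT z|lborel. f (norm (z :: complex))) = (LINT s|distr lborel borel (\<lambda>z::complex. - norm z). f (- s))"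
    by (subst integral_distr) auto
  also have "\<dots> = (LINT s|lborel. (if s < 0 then - 2 * pi * s else 0) *\<^sub>R f (- s))"
    unfolding distr_lborel_minus_norm by (rule integral_density) (auto simp: mult_nonneg_nonpos)
  also have "\<dots> = (LINT s|distr lborel borel uminus. (if s < 0 then - 2 * pi * s else 0) *\<^sub>R f (- s))"
    by (simp only: lborel_distr_uminus)
  also have "\<dots> = (LINT r|lborel. (if - r < 0 then - 2 * pi * (- r) else 0) *\<^sub>R f (- (- r)))"
    by (rule integral_distr) auto
  also have "\<dots> = (LINT r|lborel. 2 * pi * (indicator {0<..} r *\<^sub>R (r * f r)))"
    by (intro Bochner_Integration.integral_cong) (auto simp: indicator_def)
  also have "\<dots> = 2 * pi * (LBINT r=0..\<infinity>. r * f r)"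
    by (simp add: interval_lebesgue_integral_0_infty set_lebesgue_integral_def)
  finally show ?thesis .
qed

section \<open>The weight attached to a partition\<close>

lemma index_of_bounds: "1 \<le> index_of (i :: 'k::nontriv mod_ring)" "index_of i \<le> CARD('k)"
  and of_nat_index_of: "of_nat (index_of i) = i"
proof -
  have range: "0 \<le> to_int_mod_ring i" "to_int_mod_ring i < int CARD('k)"
    using range_to_int_mod_ring[where 'a = 'k] by (metis atLeastLessThan_iff rangeI)+
  have of_int: "of_int (to_int_mod_ring i) = i"
    by (simp add: of_int_of_int_mod_ring)
  have "to_int_mod_ring i > 0" if "i \<noteq> 0"
  proof -
    have "to_int_mod_ring i \<noteq> 0" using of_int that by (metis of_int_0)
    with range(1) show ?thesis by linarith
  qed
  then show "1 \<le> index_of i" "index_of i \<le> CARD('k)"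
    using range(2) by (auto simp: index_of_def Suc_le_eq)
  show "of_nat (index_of i) = i"
  proof (cases "i = 0")
    case False
    have "(of_nat (nat (to_int_mod_ring i)) :: 'k mod_ring) = of_int (int (nat (to_int_mod_ring i)))"
      by (simp only: of_int_of_nat_eq)
    also have "\<dots> = i" using range(1) of_int by simp
    finally show ?thesis using False by (simp add: index_of_def)
  qed (simp add: index_of_def)
qed

lemma bij_betw_index_of: "bij_betw index_of (UNIV :: 'k::nontriv mod_ring set) {1..CARD('k)}"
proof -
  have inj: "inj (index_of :: 'k mod_ring \<Rightarrow> nat)"
    by (metis injI of_nat_index_of)
  have "range (index_of :: 'k mod_ring \<Rightarrow> nat) = {1..CARD('k)}"
    by (rule card_subset_eq) (use index_of_bounds[where 'k = 'k] card_image[OF inj] in auto)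
  with inj show ?thesis by (simp add: bij_betw_def)
qed

lemma index_of_of_nat: "m \<in> {1..CARD('k)} \<Longrightarrow> index_of (of_nat m :: 'k::nontriv mod_ring) = m"
  using bij_betw_index_of[where 'k = 'k] by (metis bij_betw_iff_bijections of_nat_index_of)

lemma index_of_add_1:
  "index_of (i + 1 :: 'k::nontriv mod_ring) = (if index_of i = CARD('k) then 1 else index_of i + 1)"
proof (cases "index_of i = CARD('k)")
  case True
  then have "i = 0" using of_nat_index_of[of i] by simp
  then show ?thesis
    using index_of_of_nat[of 1, where 'k = 'k] True by (simp add: Suc_le_eq)
next
  case False
  then have "index_of i + 1 \<in> {1..CARD('k)}" using index_of_bounds[of i] by auto
  from index_of_of_nat[OF this] show ?thesis
    using False by (simp add: of_nat_index_of add.commute)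
qed

text \<open>The difference \<open>d\<close> between the unprojected weight, corrected by \<rho>, and
  the shifted \<open>a\<close> is invariant under i -> i + 1, hence constant; the projection removes
  the constant because \<rho> and \<open>a\<close> have zero sum. The shift by one arises because
  n_i - n_(i+1) is b_(i+1), not b_i.\<close>

lemma W_weight_shifted_nth:
  fixes b :: "'k::nontriv mod_ring \<Rightarrow> nat" and a :: "'k mod_ring \<Rightarrow> real"
  assumes N: "(\<Sum>i\<in>UNIV. b i) = N"
    and a: "\<And>i. real (b i) - real N / real CARD('k) = a i - a (i + 1)"
    and sum0: "(\<Sum>i\<in>UNIV. a i) = 0"
  shows "(W_weight N b - (real N / real CARD('k)) *\<^sub>R weyl_vector) $ i = a (i + 1)"
proof -
  let ?K = "real CARD('k)"
  define n where "n i = real N - (\<Sum>j = 1..index_of i. real (b (of_nat j)))" for i :: "'k mod_ring"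
  define \<rho> where "\<rho> i = (?K + 1 - 2 * real (index_of i)) / 2" for i :: "'k mod_ring"
  have K: "?K > 0" by simp
  have sum_index: "(\<Sum>i\<in>(UNIV :: 'k mod_ring set). f (index_of i)) = (\<Sum>j = 1..CARD('k). f j)" for f :: "nat \<Rightarrow> real"
    by (rule sum.reindex_bij_betw[OF bij_betw_index_of])
  have "(\<Sum>i\<in>UNIV. \<rho> i) = 0"
  proof -
    have "(\<Sum>j = 1..n. real j) = real n * (real n + 1) / 2" for n
      by (induction n) (auto simp: field_simps)
    from this[of "CARD('k)"] have "(\<Sum>j = 1..CARD('k). ?K + 1 - 2 * real j) = 0"
      by (simp add: sum_subtractf flip: sum_distrib_left)
    then show ?thesis
      unfolding \<rho>_def sum_divide_distrib[symmetric] sum_index[of "\<lambda>j. ?K + 1 - 2 * real j"] by simp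
  qed
  have "(\<Sum>j = 1..CARD('k). real (b (of_nat j))) = (\<Sum>i\<in>(UNIV :: 'k mod_ring set). real (b (of_nat (index_of i))))"
    by (rule sum_index[of "\<lambda>j. real (b (of_nat j))", symmetric])
  also have "\<dots> = real N" by (simp add: of_nat_index_of flip: N)
  finally have total: "(\<Sum>j = 1..CARD('k). real (b (of_nat j))) = real N" .
  define d where "d i = n i - real N / ?K * \<rho> i - a (i + 1)" for i
  have "d (i + 1) = d i" for i
  proof (cases "index_of i = CARD('k)")
    \<comment> \<open>The wrap-around from index K to index 1: n goes from 0 to N - b_1 by
      \<open>total\<close>, and N/K times the jump K - 1 of \<rho> leaves exactly N/K - b_1,
      cancelled by the change of \<open>a\<close>.\<close>
    case True
    then have "i = 0" using of_nat_index_of[of i] by simp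
    moreover have "index_of (1 :: 'k mod_ring) = 1"
      using index_of_add_1[of i] True \<open>i = 0\<close> by simp
    ultimately show ?thesis
      using True total a[of 1] K by (simp add: d_def n_def \<rho>_def index_of_add_1 field_simps)
  next
    case False
    then have idx: "index_of (i + 1) = Suc (index_of i)"
      by (simp only: index_of_add_1 if_False Suc_eq_plus1)
    have "(of_nat (Suc (index_of i)) :: 'k mod_ring) = i + 1"
      by (simp add: of_nat_index_of add.commute)
    then have "n (i + 1) = n i - real (b (i + 1))"
      unfolding n_def idx by (simp add: add.commute)
    moreover have "\<rho> (i + 1) = \<rho> i - 1"
      unfolding \<rho>_def idx by (simp add: field_simps)
    ultimately have "d (i + 1) = n i - real (b (i + 1)) - real N / ?K * (\<rho> i - 1) - a (i + 1 + 1)"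
      by (simp only: d_def)
    also have "\<dots> = d i"
      using a[of "i + 1"] unfolding d_def right_diff_distrib by linarith
    finally show ?thesis .
  qed
  then have const: "d i = d 0" for i
    by (rule_tac mod_ring_induct[of "\<lambda>i. d i = d 0" 0]) auto
  then have n: "n i = a (i + 1) + real N / ?K * \<rho> i + d 0" for i
    using const[of i] unfolding d_def[of i] by linarith
  have "W_weight N b $ i = n i - (\<Sum>i\<in>UNIV. n i) / ?K"
    by (simp add: W_weight_def proj_one_perp_def inner_vec_def n_def)
  moreover have "(\<Sum>i\<in>UNIV. n i) = ?K * d 0"
    unfolding n using sum_mod_ring_shift[of a 1] sum0 \<open>(\<Sum>i\<in>UNIV. \<rho> i) = 0\<close>
    by (simp add: sum.distrib flip: sum_distrib_left sum_divide_distrib)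
  ultimately have "W_weight N b $ i = n i - d 0" using K by simp
  moreover have "weyl_vector $ i = \<rho> i"
    by (simp add: weyl_vector_def \<rho>_def)
  ultimately show ?thesis using n[of i] by simp
qed

section \<open>The regulated norm\<close>

text \<open>Diagonality and radiality make the integrand a function \<open>F\<close> of r = |z| with
  exp (2 x) F (exp x) = G x: one factor exp x comes from the measure r dr, the other from dr = exp x
  dx.\<close>

lemma regulated_norm_eq:
  fixes a :: "'k::nontriv mod_ring \<Rightarrow> real" and b :: "'k mod_ring \<Rightarrow> nat"
  assumes H: "hitchin_metric (higgs_field b) a H" and "coprime CARD('k) N"
    and a: "\<And>i. real (b i) - real N / real CARD('k) = a i - a (i + 1)"
    and sum0: "(\<Sum>i\<in>UNIV. a i) = 0"
  shows "regulated_norm N (higgs_field b) H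
    = of_real (real CARD('k) / (real CARD('k) + real N) * (\<Sum>i\<in>UNIV. (a i)\<^sup>2))"
proof -
  let ?K = "real CARD('k)"
  define \<beta> where "\<beta> = real N / ?K"
  define q where "q = 1 + \<beta>"
  have q: "q > 0" by (simp add: q_def \<beta>_def add_pos_nonneg)
  have herm: "hermitian_metric H" using H by (simp add: hitchin_metric_def)
  have incongruent: "i = j" if "a i - a j \<in> \<int>" for i j
    using filtration_weights_incongruent[of N b a i j] assms(2) a that by blast
  have diag: "H z $ i $ j = 0" if "i \<noteq> j" for z i j
    by (rule cyclic_hitchin_metric_symmetric(1)[OF H a sum0 incongruent that])
  have radial: "H (cis \<theta> * z) $ i $ i = H z $ i $ i" for \<theta> z i
    by (rule cyclic_hitchin_metric_symmetric(2)[OF H a sum0 incongruent])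
  note pos = hermitian_metric_diag(1)[OF herm]
  define y where "y i x = ln (Re (H (of_real (exp x)) $ i $ i))" for i x
  obtain y' where y: "\<And>i x. (y i has_real_derivative y' i x) (at x)"
    and y': "\<And>i x. (y' i has_real_derivative
      4 * (exp x)\<^sup>2 * (toda_potential b H i (of_real (exp x)) - toda_potential b H (i - 1) (of_real (exp x)))) (at x)"
    and y'_lim: "\<And>i. (y' i \<longlongrightarrow> 0) at_bot"
    using toda_equation[OF H diag radial] unfolding y_def[abs_def] by metis
  \<comment> \<open>The term 2 a_i x cancels the growth |z|^(-2 a_i) allowed for the i-th diagonal
    entry.\<close>
  define v where "v i x = y i x + 2 * a i * x" for i x
  define v' where "v' i x = y' i x + 2 * a i" for i x
  \<comment> \<open>The relation between \<open>b\<close> and \<open>a\<close> turns the exponent 2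
    + 2 b_i into 2 q, the same for all i, plus 2 a_i - 2 a_(i+1), which is absorbed into
    \<open>v\<close>.\<close>
  have potential: "(exp x)\<^sup>2 * toda_potential b H i (of_real (exp x))
      = exp (2 * q * x) * exp (v i x - v (i + 1) x)" for i x
  proof -
    have "Re (H (of_real (exp x)) $ i $ i) / Re (H (of_real (exp x)) $ (i + 1) $ (i + 1)) = exp (y i x - y (i + 1) x)"
      using pos by (simp add: y_def exp_diff)
    moreover have "norm (complex_of_real (exp x)) ^ (2 * b i) = exp (2 * real (b i) * x)"
      by (simp add: exp_of_nat_mult[symmetric] mult_ac)
    ultimately have "(exp x)\<^sup>2 * toda_potential b H i (of_real (exp x))
        = exp (2 * x + (2 * real (b i) * x + (y i x - y (i + 1) x)))"
      by (simp add: toda_potential_def exp_add exp_double)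
    also have "2 * x + (2 * real (b i) * x + (y i x - y (i + 1) x)) = 2 * q * x + (v i x - v (i + 1) x)"
    proof -
      have "real (b i) = \<beta> + a i - a (i + 1)" using a[of i] by (simp add: \<beta>_def)
      then have "2 * real (b i) * x = 2 * (\<beta> + a i - a (i + 1)) * x" by simp
      then show ?thesis by (simp add: v_def q_def algebra_simps)
    qed
    finally show ?thesis by (simp only: exp_add)
  qed
  have v: "(v i has_real_derivative v' i x) (at x)" for i x
    unfolding v_def[abs_def] v'_def by (auto intro!: derivative_eq_intros y)
  have v': "(v' i has_real_derivative
      4 * exp (2 * q * x) * (exp (v i x - v (i + 1) x) - exp (v (i - 1) x - v i x))) (at x)" for i x
  proof -
    have "4 * (exp x)\<^sup>2 * (toda_potential b H i (of_real (exp x)) - toda_potential b H (i - 1) (of_real (exp x)))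
        = 4 * exp (2 * q * x) * (exp (v i x - v (i + 1) x) - exp (v (i - 1) x - v i x))"
      using potential[of x i] potential[of x "i - 1"] by (simp add: algebra_simps)
    then show ?thesis
      using y'[of i x] unfolding v'_def[abs_def] by (auto intro!: derivative_eq_intros)
  qed
  \<comment> \<open>Adaptedness bounds each \<open>v i\<close> above. The sum of all
    \<open>v i\<close> is the constant ln |det H|, so upper bounds on the others bound each one
    below.\<close>
  have growth: "\<exists>C. \<forall>\<^sub>F x in at_top. \<forall>i. \<bar>v i x\<bar> \<le> \<epsilon> * x + C" if \<epsilon>: "\<epsilon> > 0" for \<epsilon>
  proof -
    define D where "D = ln (norm (det (H 0)))"
    have sum_v: "(\<Sum>i\<in>UNIV. v i x) = D" for x
    proof -
      let ?w = "complex_of_real (exp x)"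
      have "det (H ?w) = (\<Prod>i\<in>UNIV. H ?w $ i $ i)" by (rule det_diagonal) (rule diag)
      then have "norm (det (H ?w)) = (\<Prod>i\<in>UNIV. Re (H ?w $ i $ i))"
        using pos[of ?w] hermitian_metric_diag(2)[OF herm, of ?w]
        by (simp add: prod_norm[symmetric]) (metis (no_types, lifting) abs_of_pos norm_of_real)
      then have "ln (norm (det (H ?w))) = (\<Sum>i\<in>UNIV. y i x)"
        using pos by (simp add: ln_prod y_def less_imp_neq[symmetric])
      then have "(\<Sum>i\<in>UNIV. y i x) = D"
        unfolding D_def hitchin_metric_det_constant[OF H sum0, of ?w] by simp
      then show ?thesis
        using sum0 by (simp add: v_def sum.distrib flip: sum_distrib_left sum_distrib_right)
    qed
    obtain C0 R where C0: "\<And>z i. norm z \<ge> R \<Longrightarrow> Re (H z $ i $ i) \<le> C0 * norm z powr (\<epsilon> / ?K - 2 * a i)"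
      using H \<epsilon> unfolding hitchin_metric_def eventually_at_infinity by (metis divide_pos_pos of_nat_0_less_iff zero_less_card_finite)
    define C where "C = ln (max C0 1)"
    have C: "C \<ge> 0" by (simp add: C_def)
    have upper: "v i x \<le> \<epsilon> / ?K * x + C" if "exp x \<ge> R" for i x
    proof -
      have "Re (H (of_real (exp x)) $ i $ i) \<le> C0 * exp x powr (\<epsilon> / ?K - 2 * a i)"
        using C0[of "of_real (exp x)" i] that by simp
      also have "\<dots> \<le> max C0 1 * exp x powr (\<epsilon> / ?K - 2 * a i)"
        by (intro mult_right_mono) auto
      also have "\<dots> = exp (C + (\<epsilon> / ?K - 2 * a i) * x)"
        by (simp add: C_def exp_add powr_def)
      finally have "y i x \<le> ln (exp (C + (\<epsilon> / ?K - 2 * a i) * x))"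
        using pos unfolding y_def by (subst ln_le_cancel_iff) auto
      then show ?thesis by (simp add: v_def algebra_simps)
    qed
    have bound: "\<bar>v i x\<bar> \<le> \<epsilon> * x + (\<bar>D\<bar> + ?K * C)" if "exp x \<ge> R" "x \<ge> 0" for i x
    proof -
      let ?B = "\<epsilon> / ?K * x + C"
      have B: "?B \<ge> 0" using C \<epsilon> that(2) by simp
      have KB: "?K * ?B = \<epsilon> * x + ?K * C" by (simp add: distrib_left)
      have "v i x \<le> 1 * ?B" using upper[OF that(1), of i] by simp
      also have "\<dots> \<le> ?K * ?B" using B by (intro mult_right_mono) (auto simp: Suc_le_eq)
      finally have up: "v i x \<le> \<epsilon> * x + ?K * C" unfolding KB .
      have "D = v i x + (\<Sum>j\<in>UNIV - {i}. v j x)"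
        unfolding sum_v[of x, symmetric] by (rule sum.remove) auto
      also have "(\<Sum>j\<in>UNIV - {i}. v j x) \<le> (\<Sum>j\<in>UNIV - {i}. ?B)"
        by (intro sum_mono upper that)
      also have "\<dots> \<le> (\<Sum>j\<in>(UNIV :: 'k mod_ring set). ?B)"
        using B by (intro sum_mono2) auto
      also have "\<dots> = \<epsilon> * x + ?K * C" using KB by simp
      finally show ?thesis using up by linarith
    qed
    have "\<forall>\<^sub>F x in at_top. x \<ge> max 0 (ln (max R 1))" by (rule eventually_ge_at_top)
    then have "\<forall>\<^sub>F x in at_top. \<forall>i. \<bar>v i x\<bar> \<le> \<epsilon> * x + (\<bar>D\<bar> + ?K * C)"
    proof eventually_elim
      case (elim x)
      then have "exp (ln (max R 1)) \<le> exp x" by (subst exp_le_cancel_iff) auto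
      then have "exp x \<ge> R" by simp
      moreover have "x \<ge> 0" using elim by linarith
      ultimately show ?case using bound by blast
    qed
    then show ?thesis by blast
  qed
  define G where "G x = exp (2 * q * x) * (\<Sum>i\<in>UNIV. exp (v i x - v (i + 1) x) - 1)" for x
  define Q where "Q x = (\<Sum>i\<in>UNIV. (v' i x)\<^sup>2) / 2 - 4 * G x" for x
  note energy = toda_energy[OF v v' q growth, folded G_def, folded Q_def]
  define F where "F r = (\<Sum>i\<in>UNIV. toda_potential b H i (of_real r)) - ?K * r powr (2 * \<beta>)" for r
  have F_G: "(exp x)\<^sup>2 * F (exp x) = G x" for x
  proof -
    have "(exp x)\<^sup>2 * exp x powr (2 * \<beta>) = exp (2 * q * x)"
      by (simp add: powr_def q_def distrib_left distrib_right exp_add exp_double[symmetric] mult_ac)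
    then show ?thesis
      by (simp add: F_def G_def right_diff_distrib sum_distrib_left potential sum_subtractf mult.left_commute)
  qed
  have pot_cont: "continuous_on UNIV (toda_potential b H i)" for i
  proof -
    have cont: "continuous_on UNIV (\<lambda>z. H z $ j $ j)" for j
      using hermitian_metricD(1)[OF herm, of 0] by (simp add: mat_Ck_def)
    show ?thesis
      unfolding toda_potential_def[abs_def]
      by (intro continuous_on_mult continuous_on_power continuous_on_norm continuous_on_id
          continuous_on_divide continuous_on_Re cont) (use pos in \<open>simp add: less_imp_neq[symmetric]\<close>)
  qed
  \<comment> \<open>The potentials are continuous at z = 0, so G vanishes in the limit and only the
    kinetic term with v_i' -> 2 a_i survives.\<close>
  have Q_bot: "(Q \<longlongrightarrow> 2 * (\<Sum>i\<in>UNIV. (a i)\<^sup>2)) at_bot"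
  proof -
    have exp0: "((\<lambda>x. complex_of_real (exp x)) \<longlongrightarrow> 0) at_bot"
      using tendsto_of_real[OF exp_at_bot] by simp
    have "((\<lambda>x. toda_potential b H i (of_real (exp x))) \<longlongrightarrow> toda_potential b H i 0) at_bot" for i
      using pot_cont[of i] by (intro isCont_tendsto_compose[OF _ exp0]) (simp add: continuous_on_eq_continuous_at)
    moreover have "((\<lambda>x. exp (2 * q * x)) \<longlongrightarrow> 0) at_bot"
      using q by (intro filterlim_compose[OF exp_at_bot] filterlim_tendsto_pos_mult_at_bot[OF tendsto_const _ filterlim_ident]) auto
    ultimately have "((\<lambda>x. (exp x)\<^sup>2 * (\<Sum>i\<in>UNIV. toda_potential b H i (of_real (exp x))) - ?K * exp (2 * q * x))
        \<longlongrightarrow> 0\<^sup>2 * (\<Sum>i\<in>UNIV. toda_potential b H i 0) - ?K * 0) at_bot"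
      by (intro tendsto_intros exp_at_bot)
    moreover have "(\<lambda>x. (exp x)\<^sup>2 * (\<Sum>i\<in>UNIV. toda_potential b H i (of_real (exp x))) - ?K * exp (2 * q * x)) = G"
      by (auto simp: G_def sum_distrib_left potential sum_subtractf right_diff_distrib mult.commute)
    ultimately have "(G \<longlongrightarrow> 0) at_bot" by simp
    then have "(Q \<longlongrightarrow> (\<Sum>i\<in>UNIV. (0 + 2 * a i)\<^sup>2) / 2 - 4 * 0) at_bot"
      unfolding Q_def[abs_def] v'_def by (intro tendsto_intros y'_lim) auto
    then show ?thesis by (simp add: power_mult_distrib sum_distrib_left sum_divide_distrib)
  qed
  have radial_integral: "(LBINT r=0..\<infinity>. r * F r) = (\<Sum>i\<in>UNIV. (a i)\<^sup>2) / (4 * q)"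
  proof -
    \<comment> \<open>Since Q' = - 8 q G, this is an antiderivative of G (ln r) / r. The integrand
      is nonnegative, so the limits at both ends of the half-line determine the integral.\<close>
    let ?R = "\<lambda>r. - Q (ln r) / (8 * q)"
    have rF: "r * F r = G (ln r) / r" if "r > 0" for r
      using F_G[of "ln r"] that by (simp add: power2_eq_square field_simps)
    have "(LBINT r=0..\<infinity>. r * F r) = 0 - - (2 * (\<Sum>i\<in>UNIV. (a i)\<^sup>2)) / (8 * q)"
    proof (rule interval_integral_FTC_nonneg(2)[where F = ?R])
      fix r assume "0 < ereal r"
      then have r: "r > 0" by simp
      have "((\<lambda>r. Q (ln r)) has_real_derivative - 8 * q * G (ln r) * (1 / r)) (at r)"
        by (rule DERIV_chain2[OF energy(1) DERIV_ln_divide[OF r]])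
      from DERIV_cdivide[OF DERIV_minus[OF this], of "8 * q"]
      show "(?R has_real_derivative r * F r) (at r)"
        using q r by (simp add: rF)
      have "isCont (\<lambda>r. F r) r"
        unfolding F_def[abs_def] using r pot_cont
        by (intro continuous_intros isCont_o2[of r "of_real :: real \<Rightarrow> complex"])
           (auto simp: continuous_on_eq_continuous_at)
      then show "isCont (\<lambda>r. r * F r) r" by (intro continuous_intros)
    next
      show "AE x in lborel. 0 < ereal x \<longrightarrow> ereal x < \<infinity> \<longrightarrow> 0 \<le> x * F x"
        using energy(2) by (auto simp: rF)
      have "((\<lambda>r. Q (ln r)) \<longlongrightarrow> 2 * (\<Sum>i\<in>UNIV. (a i)\<^sup>2)) (at_right 0)"
        by (rule filterlim_compose[OF Q_bot ln_at_0])
      then have "(?R \<longlongrightarrow> - (2 * (\<Sum>i\<in>UNIV. (a i)\<^sup>2)) / (8 * q)) (at_right 0)"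
        using q by (intro tendsto_intros) auto
      then show "((?R \<circ> real_of_ereal) \<longlongrightarrow> - (2 * (\<Sum>i\<in>UNIV. (a i)\<^sup>2)) / (8 * q)) (at_right 0)"
        unfolding zero_ereal_def ereal_tendsto_simps .
      have "((\<lambda>r. Q (ln r)) \<longlongrightarrow> 0) at_top"
        by (rule filterlim_compose[OF energy(3) ln_at_top])
      then have "(?R \<longlongrightarrow> - 0 / (8 * q)) at_top"
        using q by (intro tendsto_intros) auto
      then show "((?R \<circ> real_of_ereal) \<longlongrightarrow> 0) (at_left \<infinity>)"
        unfolding ereal_tendsto_simps by simp
    qed simp
    then show ?thesis using q by (simp add: field_simps)
  qed
  have pot_radial: "toda_potential b H i z = toda_potential b H i (of_real (norm z))" for i z
  proof -
    have "H z $ j $ j = H (of_real (norm z)) $ j $ j" for j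
      using radial[of "Arg z" "of_real (norm z)" j] rcis_cmod_Arg[of z]
      by (simp add: rcis_def mult.commute)
    then show ?thesis by (simp add: toda_potential_def)
  qed
  have integrand: "trace (higgs_field b z ** h_adjoint (H z) (higgs_field b z)
       - mat (of_real (norm z powr (2 * real N / real CARD('k mod_ring))))) = of_real (F (norm z))" for z
    unfolding trace_sub F_def
    by (simp add: trace_def higgs_diag[OF herm diag] mat_def \<beta>_def flip: pot_radial)
  have F_meas: "F \<in> borel_measurable borel"
  proof -
    have "continuous_on UNIV (\<lambda>r. toda_potential b H i (of_real r))" for i
      using pot_cont[of i] by (rule continuous_on_compose2) (auto intro: continuous_intros)
    note [measurable] = borel_measurable_continuous_onI[OF this]
    show ?thesis unfolding F_def[abs_def] by measurable
  qed
  have "regulated_norm N (higgs_field b) H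
      = \<i> / of_real pi * (LINT z|lborel. of_real (F (norm (z :: complex))) * (- 2 * \<i>))"
    unfolding regulated_norm_def integral_form_def integrand ..
  also have "(LINT z|lborel. of_real (F (norm (z :: complex))) * (- 2 * \<i>))
      = of_real (LINT z|lborel. F (norm (z :: complex))) * (- 2 * \<i>)"
    by (simp only: integral_mult_left_zero integral_complex_of_real)
  also have "\<i> / of_real pi * (of_real (LINT z|lborel. F (norm (z :: complex))) * (- 2 * \<i>))
      = of_real (2 / pi * (LINT z|lborel. F (norm (z :: complex))))"
    by (simp add: complex_eq_iff)
  \<comment> \<open>The constants combine to 2/pi * 2 pi / (4 q) = 1/q.\<close>
  also have "2 / pi * (LINT z|lborel. F (norm (z :: complex))) = (\<Sum>i\<in>UNIV. (a i)\<^sup>2) / q"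
    unfolding integral_lborel_radial[OF F_meas] radial_integral using q by (simp add: field_simps)
  also have "\<dots> = ?K / (?K + real N) * (\<Sum>i\<in>UNIV. (a i)\<^sup>2)"
    by (simp add: q_def \<beta>_def field_simps)
  finally show ?thesis .
qed

theorem theorem5p3:
  fixes K N :: nat
    and b :: "'k::nontriv mod_ring \<Rightarrow> nat"
    and \<alpha> :: "'k mod_ring \<Rightarrow> real"
    and h :: "complex \<Rightarrow> complex ^ 'k mod_ring ^ 'k mod_ring"
  assumes "K = CARD('k)" and "K \<ge> 2" and "N \<ge> 1" and "coprime K N"
    and "(\<Sum>i\<in>UNIV. b i) = N"
    and "\<And>i. real (b i) - real N / real K = \<alpha> i - \<alpha> (i + 1)"
    and "(\<Sum>i\<in>UNIV. \<alpha> i) = 0"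
    and "harmonic_metric (direct_sum_filtration \<alpha>) (higgs_field b) h"
  shows "regulated_norm N (higgs_field b) h
           = complex_of_real (1 / 12 * (real K - 1 - c_eff N (W_weight N b)))"
proof -
  note K = assms(1)
  have a: "real (b i) - real N / real CARD('k) = \<alpha> i - \<alpha> (i + 1)" for i
    using assms(6) by (simp add: K)
  let ?L = "W_weight N b - (real N / real CARD('k)) *\<^sub>R weyl_vector"
  have "(norm ?L)\<^sup>2 = (\<Sum>i\<in>UNIV. (?L $ i)\<^sup>2)"
    unfolding power2_norm_eq_inner inner_vec_def by (simp add: power2_eq_square)
  also have "\<dots> = (\<Sum>i\<in>UNIV. (\<alpha> (i + 1))\<^sup>2)"
    by (simp only: W_weight_shifted_nth[OF assms(5) a assms(7)])
  also have "\<dots> = (\<Sum>i\<in>UNIV. (\<alpha> i)\<^sup>2)"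
    by (rule sum_mod_ring_shift)
  finally have "1 / 12 * (real K - 1 - c_eff N (W_weight N b))
      = real CARD('k) / (real CARD('k) + real N) * (\<Sum>i\<in>UNIV. (\<alpha> i)\<^sup>2)"
    by (simp add: c_eff_def K)
  moreover have "coprime CARD('k) N" using assms(4) by (simp add: K)
  ultimately show ?thesis
    using regulated_norm_eq[OF hitchin_metric_of_harmonic_metric[OF assms(8)] _ a assms(7)] by metis
qed

end
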